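(* Let $R$ be a non-trivial rational link (one or two components) with determinant $D$. Let $N$ be the number of crossings in any Schubert Normal Form of $R$. Then $N = 2D - 2$.
   Context: Rational links are the $2$-bridge links, i.e., links admitting diagrams with exactly two over-arcs (bridges); such a link has one or two components. A non-trivial rational link is a rational link which is neither the trivial knot nor the trivial $2$-component link. A Schubert Normal Form (SNF) of such a link is the standard $2$-bridge diagram of Schubert (Math. Z. 65 (1956)): it consists of two disjoint embedded segments in the plane (the bridges) and two disjoint embedded curves (the under-strands) joining the endpoints of the bridges, such that every crossing is one of an under-strand passing under the interior of a bridge; traveling along an under-strand starting from an end of a bridge, one first passes under the other bridge and thereafter passes under the two bridges alternately; and traveling along each bridge, one meets the two under-strands alternately. *)

theory Defs
  imports
    "HOL-Library.Multiset"
    "Jordan_Normal_Form.Determinant"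
begin

section \<open>Link diagrams\<close>

text \<open>
  A link diagram is given by a planar diagram code. The edges carry labels, and every vertex lists
  the edge ends around it counterclockwise. \<open>Crossing a b c d\<close> is a crossing whose under-strand
  runs through \<open>a\<close> and \<open>c\<close> and whose over-strand runs through \<open>b\<close> and \<open>d\<close>. \<open>Point a b\<close> is a
  marked point of the curve, which cuts it into the edges \<open>a\<close> and \<open>b\<close>. Marked points make it
  possible to represent components without crossings (\<open>Point a a\<close> is a crossingless circle) and to
  mark the ends of bridges. Links are unoriented.
\<close>

datatype vertex = Crossing nat nat nat nat | Point nat nat

type_synonym diagram = "vertex list"

fun ends :: "vertex \<Rightarrow> nat list" where
  "ends (Crossing a b c d) = [a, b, c, d]"
| "ends (Point a b) = [a, b]"

fun relabel :: "(nat \<Rightarrow> nat) \<Rightarrow> vertex \<Rightarrow> vertex" where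
  "relabel f (Crossing a b c d) = Crossing (f a) (f b) (f c) (f d)"
| "relabel f (Point a b) = Point (f a) (f b)"

definition edge_ends :: "diagram \<Rightarrow> nat list" where
  "edge_ends D = concat (map ends D)"

definition edges :: "diagram \<Rightarrow> nat set" where
  "edges D = set (edge_ends D)"

text \<open>Crossings are referred to by their position in the list.\<close>

definition crossings :: "diagram \<Rightarrow> nat set" where
  "crossings D = {i. i < length D \<and> (\<exists>a b c d. D ! i = Crossing a b c d)}"

text \<open>The classes of the equivalence relation on \<open>A\<close> generated by \<open>r \<subseteq> A \<times> A\<close>.\<close>

definition generated_classes :: "'a set \<Rightarrow> ('a \<times> 'a) set \<Rightarrow> 'a set set" where
  "generated_classes A r = A // (r \<union> r\<inverse>)\<^sup>*"

definition darts :: "diagram \<Rightarrow> (nat \<times> nat) set" where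
  "darts D = {(i, k). i < length D \<and> k < length (ends (D ! i))}"

text \<open>
  The boundary of a face is traced by going along an edge to its other end and then on to the
  next edge end around the vertex reached there.
\<close>

definition face_step :: "diagram \<Rightarrow> ((nat \<times> nat) \<times> (nat \<times> nat)) set" where
  "face_step D = {((i, k), (j, Suc l mod length (ends (D ! j)))) | i k j l.
     (i, k) \<in> darts D \<and> (j, l) \<in> darts D \<and> (i, k) \<noteq> (j, l) \<and>
     ends (D ! i) ! k = ends (D ! j) ! l}"

definition faces :: "diagram \<Rightarrow> (nat \<times> nat) set set" where
  "faces D = generated_classes (darts D) (face_step D)"

text \<open>Connected components of the underlying graph (not components of the link).\<close>

definition graph_components :: "diagram \<Rightarrow> nat set set" where
  "graph_components D = generated_classes (edges D)
     {(a, b). \<exists>v\<in>set D. a \<in> set (ends v) \<and> b \<in> set (ends v)}"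

text \<open>
  Planarity is Euler's formula. As \<open>V - E + F \<le> 2\<close> holds for each connected component, with faces
  counted separately for each of them, the equation says that all of them are planar. The relative
  position of several connected components in the plane is not recorded, since it does not affect
  the link type.
\<close>

definition link_diagram :: "diagram \<Rightarrow> bool" where
  "link_diagram D \<longleftrightarrow>
     (\<forall>a\<in>edges D. count_list (edge_ends D) a = 2) \<and>
     length D + card (faces D) = card (edges D) + 2 * card (graph_components D)"

section \<open>Links\<close>

text \<open>
  The moves are only applied between link diagrams. There every label occurs exactly twice, so
  labels occurring twice on one side of a move occur nowhere else (\<open>m\<close>, \<open>n\<close> below are
  automatically inner edges of the move), and Euler's formula ensures that moves which create
  crossings are carried out inside a face. The remaining labels may coincide.

  In \<open>R2\<close> the strand from \<open>a\<close> to \<open>b\<close> is pushed over the strand from \<open>c\<close> to \<open>d\<close>. In \<open>R3\<close> the top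
  strand \<open>t1 t2 t3\<close> passes over the crossing of the middle strand \<open>m1 m2 m3\<close> with the bottom strand
  \<open>b1 b2 b3\<close>; \<open>R3_mirror\<close> is its reflection in a line of the plane.
\<close>

inductive move :: "diagram \<Rightarrow> diagram \<Rightarrow> bool" where
  reorder: "mset D = mset E \<Longrightarrow> move D E"
| rename: "inj_on f (edges D) \<Longrightarrow> move D (map (relabel f) D)"
| rotate_crossing: "move (Crossing a b c d # T) (Crossing c d a b # T)"
| rotate_point: "move (Point a b # T) (Point b a # T)"
| remove_point: "a \<noteq> b \<Longrightarrow> move (Point a b # T) (map (relabel (id(b := a))) T)"
| R1: "move (Crossing m m a b # T) (Point a b # T)"
| R1_mirror: "move (Crossing a m m b # T) (Point a b # T)"
| R2: "move (Crossing c m n a # Crossing n m d b # T) (Point a b # Point c d # T)"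
| R3: "move
     (Crossing b1 m2 b2 m1 # Crossing b2 t2 b3 t1 # Crossing m2 t3 m3 t2 # T)
     (Crossing b2 m3 b3 m2 # Crossing m1 t2 m2 t1 # Crossing b1 t3 b2 t2 # T)"
| R3_mirror: "move
     (Crossing b1 m1 b2 m2 # Crossing b2 t1 b3 t2 # Crossing m2 t2 m3 t3 # T)
     (Crossing b2 m2 b3 m3 # Crossing m1 t1 m2 t2 # Crossing b1 t2 b2 t3 # T)"

definition same_link :: "diagram \<Rightarrow> diagram \<Rightarrow> bool" where
  "same_link = equivclp (\<lambda>D E. link_diagram D \<and> link_diagram E \<and> move D E)"

text \<open>A link is represented by the set of all its diagrams.\<close>

definition link_of :: "diagram \<Rightarrow> diagram set" where
  "link_of D = {E. same_link D E}"

definition is_link :: "diagram set \<Rightarrow> bool" where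
  "is_link R \<longleftrightarrow> (\<exists>D. link_diagram D \<and> R = link_of D)"

definition trivial_knot :: "diagram set" where
  "trivial_knot = link_of [Point 0 0]"

definition trivial_two_component_link :: "diagram set" where
  "trivial_two_component_link = link_of [Point 0 0, Point 1 1]"

section \<open>Determinant\<close>

text \<open>The arcs of a diagram: maximal parts of the curves that do not pass under a crossing.\<close>

definition arcs :: "diagram \<Rightarrow> nat set set" where
  "arcs D = generated_classes (edges D)
     ({(b, d). \<exists>a c. Crossing a b c d \<in> set D} \<union> {(a, b). Point a b \<in> set D})"

text \<open>
  Fox's colouring matrix: each crossing contributes the equation
  \<open>2 * over - under - under' = 0\<close> in the colours of the arcs.
\<close>

definition colouring_entry :: "diagram \<Rightarrow> nat \<Rightarrow> nat set \<Rightarrow> int" where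
  "colouring_entry D i A = (case D ! i of
       Crossing a b c d \<Rightarrow> 2 * of_bool (b \<in> A) - of_bool (a \<in> A) - of_bool (c \<in> A)
     | Point a b \<Rightarrow> 0)"

text \<open>
  The first minors, i.e. those of size one less than the number of arcs, as absolute values.
  A selection of rows and columns is given by an enumeration, whose order only affects the sign.
\<close>

definition first_minors :: "diagram \<Rightarrow> nat set" where
  "first_minors D =
     {nat \<bar>det (mat n n (\<lambda>(p, q). colouring_entry D (rs ! p) (As ! q)))\<bar> | n rs As.
        n = card (arcs D) - 1 \<and>
        distinct rs \<and> length rs = n \<and> set rs \<subseteq> crossings D \<and>
        distinct As \<and> length As = n \<and> set As \<subseteq> arcs D}"

text \<open>
  If every component has an under-crossing, there are as many crossings as arcs, and all first
  minors have the same absolute value, the determinant. Taking the greatest common divisor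
  (the product of the first \<open>n - 1\<close> entries in the Smith normal form for \<open>n\<close> arcs) makes
  this independent of the choice of a minor; it also gives \<open>0\<close> if there are too few
  crossings to form a first minor, where the link is split.
\<close>

definition diagram_determinant :: "diagram \<Rightarrow> nat" where
  "diagram_determinant D = Gcd (first_minors D)"

definition link_determinant :: "diagram set \<Rightarrow> nat" where
  "link_determinant R = (THE d. \<exists>D\<in>R. d = diagram_determinant D)"

section \<open>Rational links and Schubert normal forms\<close>

text \<open>A path consists of the edges it traverses and the crossings between successive edges.\<close>

type_synonym path = "nat list \<times> nat list"

abbreviation path_edges :: "path \<Rightarrow> nat list" where "path_edges \<equiv> fst"
abbreviation path_crossings :: "path \<Rightarrow> nat list" where "path_crossings \<equiv> snd"

definition over_path :: "diagram \<Rightarrow> path \<Rightarrow> bool" where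
  "over_path D p \<longleftrightarrow> length (path_edges p) = Suc (length (path_crossings p)) \<and>
     (\<forall>k < length (path_crossings p). path_crossings p ! k < length D \<and>
        (\<exists>a b c d. D ! (path_crossings p ! k) = Crossing a b c d \<and>
           {b, d} = {path_edges p ! k, path_edges p ! Suc k}))"

definition under_path :: "diagram \<Rightarrow> path \<Rightarrow> bool" where
  "under_path D p \<longleftrightarrow> length (path_edges p) = Suc (length (path_crossings p)) \<and>
     (\<forall>k < length (path_crossings p). path_crossings p ! k < length D \<and>
        (\<exists>a b c d. D ! (path_crossings p ! k) = Crossing a b c d \<and>
           {a, c} = {path_edges p ! k, path_edges p ! Suc k}))"

text \<open>
  The diagram \<open>D\<close> consists of the two bridges \<open>br False\<close>, \<open>br True\<close> and the two under-strands
  \<open>us False\<close>, \<open>us True\<close>. At every crossing an under-strand passes under a bridge, and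
  the marked points are the ends of the bridges, where they are joined to the under-strands.
\<close>

definition bridge_presentation ::
    "diagram \<Rightarrow> (bool \<Rightarrow> path) \<Rightarrow> (bool \<Rightarrow> path) \<Rightarrow> bool" where
  "bridge_presentation D br us \<longleftrightarrow>
     (\<forall>i. over_path D (br i)) \<and> (\<forall>i. under_path D (us i)) \<and>
     distinct (path_edges (br False) @ path_edges (br True) @
               path_edges (us False) @ path_edges (us True)) \<and>
     set (path_edges (br False) @ path_edges (br True) @
          path_edges (us False) @ path_edges (us True)) = edges D \<and>
     distinct (path_crossings (br False) @ path_crossings (br True)) \<and>
     set (path_crossings (br False) @ path_crossings (br True)) = crossings D \<and>
     distinct (path_crossings (us False) @ path_crossings (us True)) \<and>
     set (path_crossings (us False) @ path_crossings (us True)) = crossings D \<and>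
     (\<forall>x y. Point x y \<in> set D \<longrightarrow>
        (x \<in> (\<Union>i. set (path_edges (br i))) \<longleftrightarrow> y \<in> (\<Union>i. set (path_edges (us i)))))"

definition rational_link :: "diagram set \<Rightarrow> bool" where
  "rational_link R \<longleftrightarrow> is_link R \<and> (\<exists>D\<in>R. \<exists>br us. bridge_presentation D br us)"

definition nontrivial_rational_link :: "diagram set \<Rightarrow> bool" where
  "nontrivial_rational_link R \<longleftrightarrow>
     rational_link R \<and> R \<noteq> trivial_knot \<and> R \<noteq> trivial_two_component_link"

definition joined_to :: "diagram \<Rightarrow> nat \<Rightarrow> path \<Rightarrow> bool" where
  "joined_to D x p \<longleftrightarrow>
     (\<exists>y\<in>set (path_edges p). Point x y \<in> set D \<or> Point y x \<in> set D)"

text \<open>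
  Starting from an end of bridge \<open>i\<close>, the path \<open>p\<close> passes first under the other bridge
  \<open>\<not> i\<close>, then under \<open>i\<close>, and so on.
\<close>

definition alternates_from_start :: "diagram \<Rightarrow> (bool \<Rightarrow> path) \<Rightarrow> path \<Rightarrow> bool" where
  "alternates_from_start D br p \<longleftrightarrow>
     (\<forall>i. joined_to D (hd (path_edges p)) (br i) \<longrightarrow>
        (\<forall>k < length (path_crossings p).
           path_crossings p ! k \<in> set (path_crossings (br (if even k then \<not> i else i)))))"

definition schubert_normal_form :: "diagram \<Rightarrow> bool" where
  "schubert_normal_form D \<longleftrightarrow> link_diagram D \<and>
     (\<exists>br us. bridge_presentation D br us \<and>
        (\<forall>j. alternates_from_start D br (us j) \<and>
             alternates_from_start D br (rev (path_edges (us j)), rev (path_crossings (us j)))) \<and>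
        (\<forall>i j k. Suc k < length (path_crossings (br i)) \<longrightarrow>
           \<not> {path_crossings (br i) ! k, path_crossings (br i) ! Suc k}
                \<subseteq> set (path_crossings (us j))))"

end

theory Submission
imports Defs "HOL-Library.Poly_Mapping" "HOL-Computational_Algebra.Group_Closure"
begin

text \<open>
  The determinant is computed from Fox colourings. In a Schubert normal form colour one bridge \<open>0\<close> and
  the other \<open>1\<close>. Passing under a bridge reflects the colour of an under-strand in the colour of that
  bridge, and as an under-strand meets the two bridges alternately, the colours along it run through
  \<open>0, 2, -2, 4, -4, \<dots>\<close> (or the same sequence with \<open>0\<close> and \<open>1\<close> exchanged). So after \<open>n\<close> crossings the
  colour misses the colour of the bridge that the strand ends on by \<open>n + 1\<close>. If both under-strands have
  the same number \<open>n\<close> of crossings, the colouring group modulo constants is cyclic of order \<open>n + 1\<close>;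
  hence the determinant is \<open>n + 1\<close>, while the diagram has \<open>2 n\<close> crossings.

  Two points need work. The first is that the determinant of a link may be read off any of its
  diagrams. The first minors of the colouring matrix generate an ideal which depends only on the group
  presented by the matrix, because it does not change under Tietze transformations
  (\<open>divides_first_minors_closure\<close>, \<open>divides_first_minors_eliminate\<close>). It is convenient to let all edges,
  instead of the arcs, generate the group: then the relations belong to single vertices, and each
  Reidemeister move amounts to eliminating the inner edges of the move
  (\<open>divides_colouring_minors_move\<close>).

  The second point is that the under-strands have equally many crossings
  (\<open>strands_equal_length\<close>). Along a bridge the two under-strands alternate, so their numbers of
  crossings with it differ by at most one. When both under-strands join different bridges, both lengths
  are even and could differ by two. Then both outermost crossings of every bridge would belong to the
  longer under-strand. Follow this strand from its start on a bridge to the outermost crossing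
  of that bridge next to its start: the closed curve obtained in this way, together with the end of
  the bridge, would be crossed an odd number of times by the rest of the diagram. This is impossible in the plane. When both under-strands
  return to the bridge where they start, the counts agree unless one strand has a single crossing and the
  other one none, which planarity excludes as well, or neither of them has a crossing, and then the
  diagram consists of two disjoint circles.

  Since planarity is given by Euler's formula, what has to be derived from it is that every set of
  edges with even degree at all vertices separates the faces into two colours
  (\<open>even_edge_set_bounds_faces\<close>); this is a count of subspaces over the field with two elements.
\<close>

section \<open>First minors of an integer presentation\<close>

definition minor :: "('a \<Rightarrow>\<^sub>0 int) list \<Rightarrow> 'a list \<Rightarrow> int" where
  "minor rs cs = det (mat (length cs) (length cs) (\<lambda>(p, q). Poly_Mapping.lookup (rs ! p) (cs ! q)))"

text \<open>
  The ideal generated by the minors of size \<open>n\<close> is described by the common divisors of these minors. Rows and columns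
  may be repeated, as this only adds zero minors. It makes the notion monotone in the relations and linear
  in each row.
\<close>

definition divides_minors :: "nat \<Rightarrow> 'a set \<Rightarrow> ('a \<Rightarrow>\<^sub>0 int) set \<Rightarrow> int \<Rightarrow> bool" where
  "divides_minors n X L d \<longleftrightarrow> (\<forall>rs cs. length rs = n \<longrightarrow> length cs = n \<longrightarrow> set rs \<subseteq> L \<longrightarrow> set cs \<subseteq> X \<longrightarrow>
     d dvd minor rs cs)"

definition divides_first_minors :: "'a set \<Rightarrow> ('a \<Rightarrow>\<^sub>0 int) set \<Rightarrow> int \<Rightarrow> bool" where
  "divides_first_minors X L = divides_minors (card X - 1) X L"

lemma divides_minorsI:
  "(\<And>rs cs. length rs = n \<Longrightarrow> length cs = n \<Longrightarrow> set rs \<subseteq> L \<Longrightarrow> set cs \<subseteq> X \<Longrightarrow> d dvd minor rs cs)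
    \<Longrightarrow> divides_minors n X L d"
  unfolding divides_minors_def by blast

lemma divides_minorsD:
  "divides_minors n X L d \<Longrightarrow> length rs = n \<Longrightarrow> length cs = n \<Longrightarrow> set rs \<subseteq> L \<Longrightarrow> set cs \<subseteq> X \<Longrightarrow> d dvd minor rs cs"
  unfolding divides_minors_def by blast

lemma divides_minors_mono:
  "divides_minors n X L d \<Longrightarrow> K \<subseteq> L \<Longrightarrow> Y \<subseteq> X \<Longrightarrow> divides_minors n Y K d"
  unfolding divides_minors_def by blast

definition drop_nth :: "nat \<Rightarrow> 'a list \<Rightarrow> 'a list" where
  "drop_nth k xs = take k xs @ drop (Suc k) xs"

lemma length_drop_nth: "k < length xs \<Longrightarrow> length (drop_nth k xs) = length xs - 1"
  by (auto simp: drop_nth_def)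

lemma nth_drop_nth:
  "k < length xs \<Longrightarrow> i < length xs - 1 \<Longrightarrow> drop_nth k xs ! i = xs ! (if i < k then i else Suc i)"
  by (auto simp: drop_nth_def nth_append)

lemma set_drop_nth: "set (drop_nth k xs) \<subseteq> set xs"
  by (auto simp: drop_nth_def dest: in_set_takeD in_set_dropD)

lemma drop_nth_update: "k < length xs \<Longrightarrow> drop_nth k (xs[k := x]) = drop_nth k xs"
  by (simp add: drop_nth_def)

lemma set_drop_nth_distinct:
  assumes "distinct xs" "k < length xs"
  shows "set (drop_nth k xs) = set xs - {xs ! k}"
proof -
  have xs: "xs = take k xs @ xs ! k # drop (Suc k) xs"
    using assms(2) by (simp add: id_take_nth_drop)
  then have "distinct (take k xs @ xs ! k # drop (Suc k) xs)" using assms(1) by simp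
  then have "xs ! k \<notin> set (drop_nth k xs)" by (auto simp: drop_nth_def)
  moreover have "set xs = insert (xs ! k) (set (drop_nth k xs))"
    by (subst xs) (simp add: drop_nth_def)
  ultimately show ?thesis by simp
qed

lemma minor_matrix_delete:
  assumes "length rs = n" "length cs = n" "i < n" "j < n"
  shows "det (mat_delete (mat n n (\<lambda>(p, q). Poly_Mapping.lookup (rs ! p) (cs ! q))) i j)
     = minor (drop_nth i rs) (drop_nth j cs)"
proof -
  have "mat_delete (mat n n (\<lambda>(p, q). Poly_Mapping.lookup (rs ! p) (cs ! q))) i j
    = mat (length (drop_nth j cs)) (length (drop_nth j cs))
        (\<lambda>(p, q). Poly_Mapping.lookup (drop_nth i rs ! p) (drop_nth j cs ! q))"
    using assms by (intro eq_matI) (auto simp: mat_delete_def length_drop_nth nth_drop_nth)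
  then show ?thesis unfolding minor_def by simp
qed

lemma minor_row_expansion:
  assumes "length rs = n" "length cs = n" "k < n"
  shows "minor rs cs = (\<Sum>j<n. Poly_Mapping.lookup (rs ! k) (cs ! j) *
           ((-1) ^ (k + j) * minor (drop_nth k rs) (drop_nth j cs)))"
proof -
  let ?A = "mat n n (\<lambda>(p, q). Poly_Mapping.lookup (rs ! p) (cs ! q))"
  have "minor rs cs = det ?A" using assms by (simp add: minor_def)
  also have "\<dots> = (\<Sum>j<n. ?A $$ (k, j) * cofactor ?A k j)"
    by (rule laplace_expansion_row) (use assms in auto)
  also have "\<dots> = (\<Sum>j<n. Poly_Mapping.lookup (rs ! k) (cs ! j) *
           ((-1) ^ (k + j) * minor (drop_nth k rs) (drop_nth j cs)))"
    by (rule sum.cong) (use assms in \<open>auto simp: cofactor_def minor_matrix_delete\<close>)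
  finally show ?thesis .
qed

lemma minor_column_expansion:
  assumes "length rs = n" "length cs = n" "k < n"
  shows "minor rs cs = (\<Sum>i<n. Poly_Mapping.lookup (rs ! i) (cs ! k) *
           ((-1) ^ (i + k) * minor (drop_nth i rs) (drop_nth k cs)))"
proof -
  let ?A = "mat n n (\<lambda>(p, q). Poly_Mapping.lookup (rs ! p) (cs ! q))"
  have "minor rs cs = det ?A" using assms by (simp add: minor_def)
  also have "\<dots> = (\<Sum>i<n. ?A $$ (i, k) * cofactor ?A i k)"
    by (rule laplace_expansion_column) (use assms in auto)
  also have "\<dots> = (\<Sum>i<n. Poly_Mapping.lookup (rs ! i) (cs ! k) *
           ((-1) ^ (i + k) * minor (drop_nth i rs) (drop_nth k cs)))"
    by (rule sum.cong) (use assms in \<open>auto simp: cofactor_def minor_matrix_delete\<close>)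
  finally show ?thesis .
qed

lemma minor_repeated_row:
  assumes "\<not> distinct rs" "length rs = length cs"
  shows "minor rs cs = 0"
proof -
  obtain i j where ij: "i < length rs" "j < length rs" "i \<noteq> j" "rs ! i = rs ! j"
    using assms(1) by (auto simp: distinct_conv_nth)
  show ?thesis unfolding minor_def
    by (rule det_identical_rows[of _ "length cs" i j]) (use ij assms in auto)
qed

lemma minor_repeated_column:
  assumes "\<not> distinct cs" "length rs = length cs"
  shows "minor rs cs = 0"
proof -
  obtain i j where ij: "i < length cs" "j < length cs" "i \<noteq> j" "cs ! i = cs ! j"
    using assms(1) by (auto simp: distinct_conv_nth)
  show ?thesis unfolding minor_def
    by (rule det_identical_columns[of _ "length cs" i j]) (use ij assms in auto)
qed

lemma minor_zero_column:
  assumes "length rs = length cs" "x \<in> set cs" "\<And>r. r \<in> set rs \<Longrightarrow> Poly_Mapping.lookup r x = 0"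
  shows "minor rs cs = 0"
proof -
  obtain k where k: "k < length cs" "cs ! k = x" using assms(2) by (auto simp: in_set_conv_nth)
  have "Poly_Mapping.lookup (rs ! i) (cs ! k) = 0" if "i < length cs" for i
    using assms k that by simp
  then show ?thesis using minor_column_expansion[OF assms(1) refl k(1)] by simp
qed

lemma minor_row_diff:
  assumes "length rs = length cs" "k < length rs"
  shows "minor (rs[k := u - v]) cs = minor (rs[k := u]) cs - minor (rs[k := v]) cs"
proof -
  have "minor (rs[k := w]) cs = (\<Sum>j<length cs. Poly_Mapping.lookup w (cs ! j) *
           ((-1) ^ (k + j) * minor (drop_nth k rs) (drop_nth j cs)))" for w
    using minor_row_expansion[of "rs[k := w]" "length cs" cs k] assms by (simp add: drop_nth_update)
  then show ?thesis by (simp add: lookup_minus left_diff_distrib sum_subtractf)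
qed

lemma minor_row_zero:
  assumes "length rs = length cs" "k < length rs"
  shows "minor (rs[k := 0]) cs = 0"
  using minor_row_diff[OF assms, of 0 0] by simp

subsection \<open>Tietze transformations\<close>

text \<open>
  Minors are additive in every row, so rows may be replaced one after the other by combinations of relations.
\<close>

lemma divides_minors_closure:
  assumes "divides_minors n X L d"
  shows "divides_minors n X (group_closure L) d"
proof (rule divides_minorsI)
  fix rs :: "('a \<Rightarrow>\<^sub>0 int) list" and cs
  assume rs: "length rs = n" "length cs = n" "set rs \<subseteq> group_closure L" "set cs \<subseteq> X"
  have *: "d dvd minor rs' cs"
    if "length rs' = n" "m \<le> n" "\<forall>i<m. rs' ! i \<in> group_closure L" "\<forall>i. m \<le> i \<and> i < n \<longrightarrow> rs' ! i \<in> L" for m rs'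
    using that
  proof (induction m arbitrary: rs')
    case 0
    then have "set rs' \<subseteq> L" by (auto simp: in_set_conv_nth)
    then show ?case using divides_minorsD[OF assms] 0 rs by blast
  next
    case (Suc m)
    have "d dvd minor (rs'[m := u]) cs" if "u \<in> group_closure L" for u
      using that
    proof (induction u rule: group_closure.induct)
      case (base s)
      show ?case
      proof (cases "s = 0")
        case True
        then show ?thesis using minor_row_zero[of rs' cs m] Suc.prems rs by simp
      next
        case False
        then have "s \<in> L" using base by simp
        then show ?thesis using Suc.prems by (intro Suc.IH) (auto simp: nth_list_update)
      qed
    next
      case (diff s t)
      then show ?case using minor_row_diff[of rs' cs m s t] Suc.prems rs by simp
    qed
    from this[of "rs' ! m"] show ?case using Suc.prems by simp
  qed
  have "\<forall>i<n. rs ! i \<in> group_closure L" using rs(1,3) nth_mem by blast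
  with rs(1) show "d dvd minor rs cs" by (intro *[of rs n]) auto
qed

lemma group_closure_superset: "S \<subseteq> group_closure (S :: 'a::ab_group_add set)"
  by (auto intro: group_closure.base)

lemma group_closure_minimal:
  assumes "S \<subseteq> group_closure (T :: 'a::ab_group_add set)"
  shows "group_closure S \<subseteq> group_closure T"
proof
  fix x assume "x \<in> group_closure S"
  then show "x \<in> group_closure T"
    by induction (use assms in \<open>auto intro: group_closure.diff\<close>)
qed

lemma group_closure_eqI:
  "S \<subseteq> group_closure T \<Longrightarrow> T \<subseteq> group_closure (S :: 'a::ab_group_add set) \<Longrightarrow> group_closure S = group_closure T"
  by (meson group_closure_minimal subset_antisym)

lemma divides_first_minors_closure:
  "group_closure L = group_closure K \<Longrightarrow> divides_first_minors X L = divides_first_minors X K"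
  unfolding divides_first_minors_def fun_eq_iff
  by (metis divides_minors_closure divides_minors_mono group_closure_superset order_refl)

text \<open>
  The determinant expands along the row of the new relation \<open>x = w\<close>. The column of \<open>x\<close> has its only
  non-zero entry in this row, so the cofactors are first minors of the smaller presentation or zero.
\<close>

lemma divides_first_minors_insert:
  assumes X: "finite X" "X \<noteq> {}" "x \<notin> X" and L: "\<And>r. r \<in> L \<Longrightarrow> Poly_Mapping.keys r \<subseteq> X"
    and w: "Poly_Mapping.keys w \<subseteq> X"
  shows "divides_first_minors (insert x X) (insert (frag_of x - w) L) = divides_first_minors X L"
proof (intro ext iffI)
  obtain n where n: "card X = Suc n" using X by (metis card_eq_0_iff not0_implies_Suc)
  have nx: "Poly_Mapping.lookup w x = 0" "\<And>r. r \<in> L \<Longrightarrow> Poly_Mapping.lookup r x = 0"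
    using L w X(3) by (auto simp: in_keys_iff subset_iff)
  fix d
  {
    assume *: "divides_first_minors (insert x X) (insert (frag_of x - w) L) d"
    show "divides_first_minors X L d" unfolding divides_first_minors_def
    proof (rule divides_minorsI)
      fix rs cs
      assume rs: "length rs = card X - 1" "length cs = card X - 1" "set rs \<subseteq> L" "set cs \<subseteq> X"
      have "d dvd minor ((frag_of x - w) # rs) (x # cs)"
        using * unfolding divides_first_minors_def
        by (rule divides_minorsD) (use rs X n in auto)
      moreover have "minor ((frag_of x - w) # rs) (x # cs) =
         (\<Sum>i<Suc n. if i = 0 then minor rs cs else 0)"
      proof -
        have "minor ((frag_of x - w) # rs) (x # cs) =
            (\<Sum>i<Suc n. Poly_Mapping.lookup (((frag_of x - w) # rs) ! i) ((x # cs) ! 0) *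
               ((-1) ^ (i + 0) * minor (drop_nth i ((frag_of x - w) # rs)) (drop_nth 0 (x # cs))))"
          by (rule minor_column_expansion) (use rs n in auto)
        also have "\<dots> = (\<Sum>i<Suc n. if i = 0 then minor rs cs else 0)"
        proof (rule sum.cong)
          fix i assume i: "i \<in> {..<Suc n}"
          show "Poly_Mapping.lookup (((frag_of x - w) # rs) ! i) ((x # cs) ! 0) *
               ((-1) ^ (i + 0) * minor (drop_nth i ((frag_of x - w) # rs)) (drop_nth 0 (x # cs)))
             = (if i = 0 then minor rs cs else 0)"
          proof (cases i)
            case 0
            then show ?thesis using nx(1) by (simp add: drop_nth_def lookup_minus)
          next
            case (Suc j)
            then have "rs ! j \<in> L" using i rs n by (auto simp: subset_iff)
            then show ?thesis using Suc nx(2) by simp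
          qed
        qed simp
        finally show ?thesis .
      qed
      ultimately show "d dvd minor rs cs" by (cases "n = 0") auto
    qed
  }
  {
    assume *: "divides_first_minors X L d"
    have small: "d dvd minor rs cs" if "length rs = n" "length cs = n" "set rs \<subseteq> L" "set cs \<subseteq> insert x X" for rs cs
    proof (cases "x \<in> set cs")
      case True
      then have "minor rs cs = 0" using nx that by (intro minor_zero_column[of _ _ x]) auto
      then show ?thesis by simp
    next
      case False
      then show ?thesis using * that n unfolding divides_first_minors_def
        by (intro divides_minorsD[of n X L]) auto
    qed
    show "divides_first_minors (insert x X) (insert (frag_of x - w) L) d" unfolding divides_first_minors_def
    proof (rule divides_minorsI)
      fix rs cs
      assume "length rs = card (insert x X) - 1" "length cs = card (insert x X) - 1"
        and rs2: "set rs \<subseteq> insert (frag_of x - w) L" "set cs \<subseteq> insert x X"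
      then have rs: "length rs = Suc n" "length cs = Suc n" using X n by auto
      show "d dvd minor rs cs"
      proof (cases "distinct rs")
        case False
        then show ?thesis using rs by (simp add: minor_repeated_row)
      next
        case True
        obtain k where k: "k < Suc n" "set (drop_nth k rs) \<subseteq> L"
        proof (cases "frag_of x - w \<in> set rs")
          case True
          then obtain k where "k < Suc n" "rs ! k = frag_of x - w" using rs by (auto simp: in_set_conv_nth)
          then show thesis using that[of k] rs rs2 set_drop_nth_distinct[OF \<open>distinct rs\<close>, of k] by auto
        next
          case False
          then show thesis using that[of 0] rs2 set_drop_nth[of 0 rs] by auto
        qed
        have "d dvd minor (drop_nth k rs) (drop_nth j cs)" if "j < Suc n" for j
          using that k rs rs2 set_drop_nth[of j cs] by (intro small) (auto simp: length_drop_nth)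
        then show ?thesis
          unfolding minor_row_expansion[OF rs k(1)] by (intro dvd_sum dvd_mult) simp
      qed
    qed
  }
qed

lemma divides_first_minors_union:
  assumes "finite Z" "finite Y" "Y \<noteq> {}" "Z \<inter> Y = {}" and L: "\<And>r. r \<in> L \<Longrightarrow> Poly_Mapping.keys r \<subseteq> Y"
    and w: "\<And>z. z \<in> Z \<Longrightarrow> Poly_Mapping.keys (w z) \<subseteq> Y"
  shows "divides_first_minors (Z \<union> Y) ((\<lambda>z. frag_of z - w z) ` Z \<union> L) = divides_first_minors Y L"
  using assms(1,4) w
proof (induction Z)
  case empty
  then show ?case by simp
next
  case (insert z Z)
  have keys: "Poly_Mapping.keys (frag_of x - w x) \<subseteq> Z \<union> Y" if "x \<in> Z" for x
    using keys_diff[of "frag_of x" "w x"] insert.prems that by (fastforce simp: keys_frag_of)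
  have "divides_first_minors (insert z (Z \<union> Y))
          (insert (frag_of z - w z) ((\<lambda>z. frag_of z - w z) ` Z \<union> L))
     = divides_first_minors (Z \<union> Y) ((\<lambda>z. frag_of z - w z) ` Z \<union> L)"
  proof (rule divides_first_minors_insert)
    show "Poly_Mapping.keys r \<subseteq> Z \<union> Y" if "r \<in> (\<lambda>z. frag_of z - w z) ` Z \<union> L" for r
      using that keys L by blast
  qed (use insert.hyps insert.prems assms(2,3) in auto)
  also have "\<dots> = divides_first_minors Y L" using insert by auto
  finally show ?case by simp
qed

lemma frag_extend_congruent:
  assumes "Poly_Mapping.keys r \<subseteq> X" "\<And>x. x \<in> X \<Longrightarrow> frag_of x - w x \<in> group_closure L"
  shows "r - frag_extend w r \<in> group_closure L"
  using assms(1)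
proof (induction r rule: frag_induction)
  case zero
  then show ?case by simp
next
  case (one x)
  then show ?case using assms(2) by simp
next
  case (diff a b)
  have "(a - frag_extend w a) - (b - frag_extend w b) \<in> group_closure L"
    using diff by (rule group_closure.diff)
  moreover have "(a - frag_extend w a) - (b - frag_extend w b) = (a - b) - frag_extend w (a - b)"
    by (simp add: frag_extend_diff)
  ultimately show ?case by simp
qed

text \<open>
  The relations generate the same group as the substituted relations together with \<open>x = w x\<close> for the
  eliminated generators \<open>x\<close>. The latter can be dropped along with these generators.
\<close>

theorem divides_first_minors_eliminate:
  assumes X: "finite X" "Y \<subseteq> X" "Y \<noteq> {}" and L: "\<And>r. r \<in> L \<Longrightarrow> Poly_Mapping.keys r \<subseteq> X"
    and w: "\<And>x. x \<in> X \<Longrightarrow> Poly_Mapping.keys (w x) \<subseteq> Y"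
    and fixed: "\<And>y. y \<in> Y \<Longrightarrow> w y = frag_of y"
    and congr: "\<And>x. x \<in> X \<Longrightarrow> frag_of x - w x \<in> group_closure L"
  shows "divides_first_minors X L = divides_first_minors Y (frag_extend w ` L)"
proof -
  let ?K = "(\<lambda>z. frag_of z - w z) ` (X - Y) \<union> frag_extend w ` L"
  have ext: "frag_extend w r \<in> group_closure L" if "r \<in> L" for r
  proof -
    have "r - (r - frag_extend w r) \<in> group_closure L"
      using that by (intro group_closure.diff frag_extend_congruent[of _ X] L congr) (auto intro: group_closure.base)
    then show ?thesis by simp
  qed
  have K: "frag_of x - w x \<in> group_closure ?K" if "x \<in> X" for x
    using that fixed by (cases "x \<in> Y") (auto intro!: group_closure.base)
  have "r \<in> group_closure ?K" if "r \<in> L" for r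
  proof -
    have "r - frag_extend w r \<in> group_closure ?K"
      by (rule frag_extend_congruent[of r X]) (use L K that in auto)
    moreover have "frag_extend w r \<in> group_closure ?K" using that by (auto intro: group_closure.base)
    ultimately show ?thesis by (metis diff_add_cancel group_closure_add)
  qed
  then have "group_closure L = group_closure ?K"
    using ext congr by (intro group_closure_eqI) auto
  then have "divides_first_minors X L = divides_first_minors X ?K"
    by (rule divides_first_minors_closure)
  also have "divides_first_minors X ?K = divides_first_minors ((X - Y) \<union> Y) ?K"
    using X(2) by (simp add: Un_absorb2)
  also have "\<dots> = divides_first_minors Y (frag_extend w ` L)"
  proof (rule divides_first_minors_union)
    show "Poly_Mapping.keys r \<subseteq> Y" if "r \<in> frag_extend w ` L" for r
      using that keys_frag_extend[of w] L w by fast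
  qed (use X w in \<open>auto simp: finite_subset\<close>)
  finally show ?thesis .
qed

lemma lookup_frag_extend_rename:
  assumes "Poly_Mapping.keys r \<subseteq> X" "inj_on f X" "x \<in> X"
  shows "Poly_Mapping.lookup (frag_extend (frag_of \<circ> f) r) (f x) = Poly_Mapping.lookup r x"
  using assms(1)
proof (induction r rule: frag_induction)
  case zero
  then show ?case by simp
next
  case (one y)
  then show ?case using assms by (auto simp: inj_on_def)
next
  case (diff a b)
  then show ?case by (simp add: frag_extend_diff lookup_minus)
qed

lemma minor_rename:
  assumes "length rs = length cs" "\<And>r. r \<in> set rs \<Longrightarrow> Poly_Mapping.keys r \<subseteq> X" "inj_on f X" "set cs \<subseteq> X"
  shows "minor (map (frag_extend (frag_of \<circ> f)) rs) (map f cs) = minor rs cs"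
proof -
  have "mat (length cs) (length cs)
      (\<lambda>(p, q). Poly_Mapping.lookup (map (frag_extend (frag_of \<circ> f)) rs ! p) (map f cs ! q))
    = mat (length cs) (length cs) (\<lambda>(p, q). Poly_Mapping.lookup (rs ! p) (cs ! q))"
  proof (intro eq_matI)
    fix i j assume "i < dim_row (mat (length cs) (length cs) (\<lambda>(p, q). Poly_Mapping.lookup (rs ! p) (cs ! q)))"
      "j < dim_col (mat (length cs) (length cs) (\<lambda>(p, q). Poly_Mapping.lookup (rs ! p) (cs ! q)))"
    then have ij: "i < length cs" "j < length cs" by auto
    then have "rs ! i \<in> set rs" "cs ! j \<in> set cs" using assms(1) by auto
    then have "Poly_Mapping.lookup (frag_extend (frag_of \<circ> f) (rs ! i)) (f (cs ! j)) = Poly_Mapping.lookup (rs ! i) (cs ! j)"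
      using assms by (intro lookup_frag_extend_rename[where X = X]) auto
    with ij assms(1) show "mat (length cs) (length cs)
      (\<lambda>(p, q). Poly_Mapping.lookup (map (frag_extend (frag_of \<circ> f)) rs ! p) (map f cs ! q)) $$ (i, j)
      = mat (length cs) (length cs) (\<lambda>(p, q). Poly_Mapping.lookup (rs ! p) (cs ! q)) $$ (i, j)"
      by simp
  qed auto
  then show ?thesis by (simp add: minor_def)
qed

lemma divides_first_minors_rename:
  assumes L: "\<And>r. r \<in> L \<Longrightarrow> Poly_Mapping.keys r \<subseteq> X" and f: "inj_on f X"
  shows "divides_first_minors (f ` X) (frag_extend (frag_of \<circ> f) ` L) = divides_first_minors X L"
proof (intro ext iffI)
  fix d
  assume *: "divides_first_minors (f ` X) (frag_extend (frag_of \<circ> f) ` L) d"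
  show "divides_first_minors X L d" unfolding divides_first_minors_def
  proof (rule divides_minorsI)
    fix rs cs
    assume rs: "length rs = card X - 1" "length cs = card X - 1" "set rs \<subseteq> L" "set cs \<subseteq> X"
    have "d dvd minor (map (frag_extend (frag_of \<circ> f)) rs) (map f cs)"
      using * unfolding divides_first_minors_def
      by (rule divides_minorsD) (use rs card_image[OF f] in auto)
    also have "minor (map (frag_extend (frag_of \<circ> f)) rs) (map f cs) = minor rs cs"
      by (rule minor_rename[where X = X]) (use rs L f in auto)
    finally show "d dvd minor rs cs" .
  qed
next
  fix d
  assume *: "divides_first_minors X L d"
  show "divides_first_minors (f ` X) (frag_extend (frag_of \<circ> f) ` L) d" unfolding divides_first_minors_def
  proof (rule divides_minorsI)
    fix rs' cs'
    assume rs': "length rs' = card (f ` X) - 1" "length cs' = card (f ` X) - 1"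
      "set rs' \<subseteq> frag_extend (frag_of \<circ> f) ` L" "set cs' \<subseteq> f ` X"
    have "rs' \<in> map (frag_extend (frag_of \<circ> f)) ` lists L" "cs' \<in> map f ` lists X"
      using rs'(3,4) by (auto simp flip: lists_image)
    then obtain rs cs where rs: "rs' = map (frag_extend (frag_of \<circ> f)) rs" "set rs \<subseteq> L"
      "cs' = map f cs" "set cs \<subseteq> X"
      by (auto simp: lists_eq_set)
    have keys: "Poly_Mapping.keys r \<subseteq> X" if "r \<in> set rs" for r
      using that rs(2) L by blast
    have "d dvd minor rs cs"
      using * unfolding divides_first_minors_def
      by (rule divides_minorsD) (use rs rs' card_image[OF f] in auto)
    also have "minor rs cs = minor rs' cs'"
      unfolding rs(1,3)
      by (rule minor_rename[where X = X, symmetric]) (use rs rs' keys f in auto)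
    finally show "d dvd minor rs' cs'" .
  qed
qed

section \<open>The colouring group of a diagram\<close>

fun vertex_relations :: "vertex \<Rightarrow> (nat \<Rightarrow>\<^sub>0 int) set" where
  "vertex_relations (Crossing a b c d) =
     {frag_of b - frag_of d, frag_cmul 2 (frag_of b) - frag_of a - frag_of c}"
| "vertex_relations (Point a b) = {frag_of a - frag_of b}"

definition relations :: "diagram \<Rightarrow> (nat \<Rightarrow>\<^sub>0 int) set" where
  "relations D = (\<Union>v\<in>set D. vertex_relations v)"

lemma relations_Cons [simp]: "relations (v # T) = vertex_relations v \<union> relations T"
  by (simp add: relations_def)

lemma edges_Cons [simp]: "edges (v # T) = set (ends v) \<union> edges T"
  by (simp add: edges_def edge_ends_def)

lemma edges_Nil [simp]: "edges [] = {}"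
  by (simp add: edges_def edge_ends_def)

lemma edges_conv: "edges D = (\<Union>v\<in>set D. set (ends v))"
  by (simp add: edges_def edge_ends_def)

lemma finite_edges [simp]: "finite (edges D)"
  by (simp add: edges_def)

lemma keys_vertex_relations:
  assumes "r \<in> vertex_relations v"
  shows "Poly_Mapping.keys r \<subseteq> set (ends v)"
proof
  fix x assume "x \<in> Poly_Mapping.keys r"
  then show "x \<in> set (ends v)"
    using assms by (cases v) (auto simp: in_keys_iff lookup_minus split: if_splits)
qed

lemma keys_relations: "r \<in> relations D \<Longrightarrow> Poly_Mapping.keys r \<subseteq> edges D"
proof -
  assume "r \<in> relations D"
  then obtain v where "v \<in> set D" "r \<in> vertex_relations v" by (auto simp: relations_def)
  then show "Poly_Mapping.keys r \<subseteq> edges D"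
    using keys_vertex_relations[of r v] by (auto simp: edges_conv)
qed

definition divides_colouring_minors :: "diagram \<Rightarrow> int \<Rightarrow> bool" where
  "divides_colouring_minors D = divides_first_minors (edges D) (relations D)"

subsection \<open>Colours of edges and colours of arcs\<close>

lemma generated_class_eq_iff:
  "(r \<union> r\<inverse>)\<^sup>* `` {x} = (r \<union> r\<inverse>)\<^sup>* `` {y} \<longleftrightarrow> (x, y) \<in> (r \<union> r\<inverse>)\<^sup>*"
proof -
  have "sym ((r \<union> r\<inverse>)\<^sup>*)" by (intro sym_rtrancl) (auto simp: sym_def)
  then have "equiv UNIV ((r \<union> r\<inverse>)\<^sup>*)"
    by (simp add: equiv_def refl_rtrancl trans_rtrancl)
  then show ?thesis by (simp add: eq_equiv_class_iff)
qed

text \<open>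
  Selections of rows by position in the diagram and selections of rows as vectors give the same non-zero minors: a vector
  chosen twice makes the minor vanish.
\<close>

lemma minors_of_arcs_divides_iff:
  fixes row :: "nat \<Rightarrow> nat set \<Rightarrow>\<^sub>0 int"
  assumes row: "\<And>i A. i \<in> crossings D \<Longrightarrow> A \<in> arcs D \<Longrightarrow> Poly_Mapping.lookup (row i) A = colouring_entry D i A"
  shows "divides_first_minors (arcs D) (row ` crossings D) (int m) \<longleftrightarrow> m dvd diagram_determinant D"
proof -
  let ?n = "card (arcs D) - 1"
  let ?det = "\<lambda>rs As. det (mat ?n ?n (\<lambda>(p, q). colouring_entry D (rs ! p) (As ! q)))"
  have minor: "minor (map row rs) As = ?det rs As"
    if "length rs = ?n" "set rs \<subseteq> crossings D" "length As = ?n" "set As \<subseteq> arcs D" for rs As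
  proof -
    have "Poly_Mapping.lookup (row (rs ! p)) (As ! q) = colouring_entry D (rs ! p) (As ! q)"
      if "p < ?n" "q < ?n" for p q
    proof (rule row)
      show "rs ! p \<in> crossings D" using \<open>length rs = _\<close> \<open>set rs \<subseteq> _\<close> \<open>p < ?n\<close> nth_mem[of p rs] by auto
      show "As ! q \<in> arcs D" using \<open>length As = _\<close> \<open>set As \<subseteq> _\<close> \<open>q < ?n\<close> nth_mem[of q As] by auto
    qed
    then have "mat ?n ?n (\<lambda>(p, q). Poly_Mapping.lookup (map row rs ! p) (As ! q))
        = mat ?n ?n (\<lambda>(p, q). colouring_entry D (rs ! p) (As ! q))"
      using that(1) by (intro eq_matI) auto
    then show ?thesis using that(3) by (simp add: minor_def)
  qed
  have "m dvd diagram_determinant D \<longleftrightarrow> (\<forall>x\<in>first_minors D. m dvd x)"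
    by (simp add: diagram_determinant_def dvd_Gcd_iff)
  also have "\<dots> \<longleftrightarrow> (\<forall>rs As. distinct rs \<and> length rs = ?n \<and> set rs \<subseteq> crossings D \<and>
        distinct As \<and> length As = ?n \<and> set As \<subseteq> arcs D \<longrightarrow> int m dvd ?det rs As)"
  proof -
    have "m dvd nat \<bar>z\<bar> \<longleftrightarrow> int m dvd z" for z by (simp flip: int_dvd_int_iff)
    moreover have "first_minors D = (\<lambda>(rs, As). nat \<bar>?det rs As\<bar>) `
        {(rs, As). distinct rs \<and> length rs = ?n \<and> set rs \<subseteq> crossings D \<and>
           distinct As \<and> length As = ?n \<and> set As \<subseteq> arcs D}"
      by (auto simp: first_minors_def)
    ultimately show ?thesis by (simp only: ball_simps mem_Collect_eq split_paired_all split_conv) simp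
  qed
  also have "\<dots> \<longleftrightarrow> divides_first_minors (arcs D) (row ` crossings D) (int m)"
  proof
    assume *: "divides_first_minors (arcs D) (row ` crossings D) (int m)"
    show "\<forall>rs As. distinct rs \<and> length rs = ?n \<and> set rs \<subseteq> crossings D \<and>
        distinct As \<and> length As = ?n \<and> set As \<subseteq> arcs D \<longrightarrow> int m dvd ?det rs As"
    proof safe
      fix rs As assume rs: "length rs = ?n" "set rs \<subseteq> crossings D" "length As = ?n" "set As \<subseteq> arcs D"
      have "int m dvd minor (map row rs) As"
        using * unfolding divides_first_minors_def by (rule divides_minorsD) (use rs in auto)
      then show "int m dvd ?det rs As" using minor[OF rs] by simp
    qed
  next
    assume *: "\<forall>rs As. distinct rs \<and> length rs = ?n \<and> set rs \<subseteq> crossings D \<and>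
        distinct As \<and> length As = ?n \<and> set As \<subseteq> arcs D \<longrightarrow> int m dvd ?det rs As"
    show "divides_first_minors (arcs D) (row ` crossings D) (int m)"
      unfolding divides_first_minors_def
    proof (rule divides_minorsI)
      fix rs' As assume rs': "length rs' = ?n" "length As = ?n" "set rs' \<subseteq> row ` crossings D" "set As \<subseteq> arcs D"
      have "rs' \<in> map row ` lists (crossings D)" using rs'(3) by (auto simp flip: lists_image)
      then obtain rs where rs: "rs' = map row rs" "set rs \<subseteq> crossings D" by (auto simp: lists_eq_set)
      show "int m dvd minor rs' As"
      proof (cases "distinct rs \<and> distinct As")
        case True
        then have "int m dvd ?det rs As" using * rs rs' by simp
        then show ?thesis using minor[of rs As] rs rs' by simp
      next
        case False
        then have "\<not> distinct rs' \<or> \<not> distinct As" using rs by (auto simp: distinct_map)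
        then have "minor rs' As = 0"
          using minor_repeated_row[of rs' As] minor_repeated_column[of As rs'] rs' by auto
        then show ?thesis by simp
      qed
    qed
  qed
  finally show ?thesis ..
qed

text \<open>
  An arc is a class of edges that are identified by the relations \<open>b = d\<close> at crossings and \<open>a = b\<close> at
  points. Eliminating all edges except for one representative of each arc leaves Fox's colouring matrix.
\<close>

theorem divides_diagram_determinant_iff:
  "m dvd diagram_determinant D \<longleftrightarrow> divides_colouring_minors D (int m)"
proof -
  define r where "r = {(b, d). \<exists>a c. Crossing a b c d \<in> set D} \<union> {(a, b). Point a b \<in> set D}"
  define cl where "cl x = (r \<union> r\<inverse>)\<^sup>* `` {x}" for x
  define rep where "rep x = (SOME y. y \<in> cl x)" for x
  have arcs: "arcs D = cl ` edges D"
    by (auto simp: arcs_def generated_classes_def r_def cl_def quotient_def)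
  have r: "r \<subseteq> edges D \<times> edges D"
    by (auto simp: r_def edges_conv intro: bexI[rotated])
  have cl_edges: "cl x \<subseteq> edges D" if "x \<in> edges D" for x
  proof
    fix y assume "y \<in> cl x"
    then have "(x, y) \<in> (r \<union> r\<inverse>)\<^sup>*" by (simp add: cl_def)
    then show "y \<in> edges D" by induction (use that r in auto)
  qed
  have rep: "(x, rep x) \<in> (r \<union> r\<inverse>)\<^sup>*" for x
  proof -
    have "x \<in> cl x" by (simp add: cl_def)
    then have "rep x \<in> cl x" unfolding rep_def by (rule someI)
    then show ?thesis by (simp add: cl_def)
  qed
  have rep_edges: "rep x \<in> edges D" if "x \<in> edges D" for x
    using cl_edges[OF that] rep[of x] by (auto simp: cl_def)
  have cl_rep: "cl (rep x) = cl x" if "x \<in> edges D" for x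
    unfolding cl_def
    using generated_class_eq_iff[of r x "rep x"] rep[of x] by simp
  have rep_rep: "rep (rep x) = rep x" if "x \<in> edges D" for x
    using cl_rep[OF that] by (simp add: rep_def)
  have diff: "frag_of x - frag_of y \<in> group_closure (relations D)" if "(x, y) \<in> (r \<union> r\<inverse>)\<^sup>*" for x y
    using that
  proof induction
    case base
    then show ?case by simp
  next
    case (step y z)
    have *: "frag_of u - frag_of v \<in> group_closure (relations D)" if "(u, v) \<in> r" for u v
      using that by (auto simp: r_def relations_def intro!: group_closure.base bexI[rotated])
    have "frag_of y - frag_of z \<in> group_closure (relations D)"
    proof (cases "(y, z) \<in> r")
      case False
      then have "- (frag_of z - frag_of y) \<in> group_closure (relations D)"
        using step(2) *[of z y] group_closure_minus_iff by blast
      then show ?thesis by simp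
    qed (rule *)
    from group_closure_add[OF step.IH this] show ?case by simp
  qed
  have cong: "frag_extend (frag_of \<circ> cl \<circ> rep) x = frag_extend (frag_of \<circ> cl) x" if "x \<in> relations D" for x
    using keys_relations[OF that] cl_rep by (intro frag_extend_eq) auto
  have step1: "divides_colouring_minors D
     = divides_first_minors (arcs D) (frag_extend (frag_of \<circ> cl) ` relations D)"
  proof (cases "edges D = {}")
    case True
    then have "D = []" by (cases D) (auto elim: ends.elims)
    then have "arcs D = {}" "relations D = {}" using True arcs by (auto simp: relations_def)
    then show ?thesis using \<open>D = []\<close> by (simp add: divides_colouring_minors_def
          divides_first_minors_def divides_minors_def fun_eq_iff minor_def)
  next
    case False
    have "divides_colouring_minors D
       = divides_first_minors (rep ` edges D) (frag_extend (frag_of \<circ> rep) ` relations D)"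
      unfolding divides_colouring_minors_def
    proof (rule divides_first_minors_eliminate)
      show "frag_of x - (frag_of \<circ> rep) x \<in> group_closure (relations D)" for x
        using diff[OF rep] by simp
      show "Poly_Mapping.keys x \<subseteq> edges D" if "x \<in> relations D" for x
        using that by (rule keys_relations)
      show "(frag_of \<circ> rep) y = frag_of y" if "y \<in> rep ` edges D" for y
        using that rep_rep by auto
    qed (use False rep_edges in \<open>auto simp: keys_frag_of\<close>)
    also have "\<dots> = divides_first_minors (cl ` rep ` edges D)
           (frag_extend (frag_of \<circ> cl) ` frag_extend (frag_of \<circ> rep) ` relations D)"
    proof (rule divides_first_minors_rename[symmetric])
      show "inj_on cl (rep ` edges D)"
      proof (intro inj_onI; elim imageE; clarify)
        fix x y assume xy: "x \<in> edges D" "y \<in> edges D" "cl (rep x) = cl (rep y)"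
        then have "cl x = cl y" by (simp add: cl_rep)
        then show "rep x = rep y" by (simp add: rep_def)
      qed
      show "Poly_Mapping.keys x \<subseteq> rep ` edges D"
        if "x \<in> frag_extend (frag_of \<circ> rep) ` relations D" for x
      proof -
        obtain y where y: "y \<in> relations D" "x = frag_extend (frag_of \<circ> rep) y" using \<open>x \<in> _\<close> by auto
        have "Poly_Mapping.keys x \<subseteq> rep ` Poly_Mapping.keys y"
          using keys_frag_extend[of "frag_of \<circ> rep" y] y(2) by (auto simp: keys_frag_of)
        then show ?thesis using keys_relations[OF y(1)] by auto
      qed
    qed
    also have "frag_extend (frag_of \<circ> cl) ` frag_extend (frag_of \<circ> rep) ` relations D
        = frag_extend (frag_of \<circ> cl) ` relations D"
      unfolding image_image by (intro image_cong refl) (simp add: frag_extend_compose cong)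
    also have "cl ` rep ` edges D = arcs D"
      using cl_rep by (auto simp: arcs image_iff)
    finally show ?thesis .
  qed
  define row where "row i = (case D ! i of
      Crossing a b c d \<Rightarrow> frag_cmul 2 (frag_of (cl b)) - frag_of (cl a) - frag_of (cl c)
    | Point a b \<Rightarrow> 0)" for i
  have "divides_colouring_minors D = divides_first_minors (arcs D) (row ` crossings D)"
    unfolding step1
  proof (rule divides_first_minors_closure, rule group_closure_eqI)
    have cl_eq: "cl x = cl y" if "(x, y) \<in> r" for x y
      unfolding cl_def generated_class_eq_iff using that by (intro r_into_rtrancl) simp
    show "frag_extend (frag_of \<circ> cl) ` relations D \<subseteq> group_closure (row ` crossings D)"
    proof safe
      fix x assume "x \<in> relations D"
      then obtain i where i: "i < length D" "x \<in> vertex_relations (D ! i)"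
        by (auto simp: relations_def in_set_conv_nth)
      show "frag_extend (frag_of \<circ> cl) x \<in> group_closure (row ` crossings D)"
      proof (cases "D ! i")
        case (Crossing a b c d)
        then have "row i = frag_cmul 2 (frag_of (cl b)) - frag_of (cl a) - frag_of (cl c)" "i \<in> crossings D"
          using i by (auto simp: row_def crossings_def)
        moreover have "cl b = cl d"
          using Crossing i nth_mem[of i D] by (intro cl_eq) (auto simp: r_def)
        moreover have "row i \<in> group_closure (row ` crossings D)"
          using \<open>i \<in> crossings D\<close> by (auto intro: group_closure.base)
        ultimately show ?thesis using i(2) Crossing
          by (auto simp: frag_extend_diff frag_extend_cmul)
      next
        case (Point a b)
        then have "cl a = cl b" using i nth_mem[of i D] by (intro cl_eq) (auto simp: r_def)
        then show ?thesis using i(2) Point by (auto simp: frag_extend_diff)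
      qed
    qed
    show "row ` crossings D \<subseteq> group_closure (frag_extend (frag_of \<circ> cl) ` relations D)"
    proof safe
      fix i assume "i \<in> crossings D"
      then obtain a b c d where i: "i < length D" "D ! i = Crossing a b c d" by (auto simp: crossings_def)
      then have "frag_cmul 2 (frag_of b) - frag_of a - frag_of c \<in> relations D"
        unfolding relations_def using nth_mem[of i D] by (intro UN_I[of "D ! i"]) auto
      moreover have "row i = frag_extend (frag_of \<circ> cl) (frag_cmul 2 (frag_of b) - frag_of a - frag_of c)"
        using i by (simp add: row_def frag_extend_diff frag_extend_cmul)
      ultimately show "row i \<in> group_closure (frag_extend (frag_of \<circ> cl) ` relations D)"
        using group_closure_superset[of "frag_extend (frag_of \<circ> cl) ` relations D"] by auto
    qed
  qed
  moreover have "Poly_Mapping.lookup (row i) A = colouring_entry D i A"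
    if iA: "i \<in> crossings D" "A \<in> arcs D" for i A
  proof -
    obtain a b c d where i: "i < length D" "D ! i = Crossing a b c d" using iA by (auto simp: crossings_def)
    then have abc: "a \<in> edges D" "b \<in> edges D" "c \<in> edges D"
      using nth_mem[of i D] by (auto simp: edges_conv intro!: bexI[of _ "D ! i"])
    have mem: "A = cl x \<longleftrightarrow> x \<in> A" if "x \<in> edges D" for x
    proof -
      obtain y where y: "y \<in> edges D" "A = cl y" using iA arcs by auto
      show ?thesis unfolding y(2) cl_def generated_class_eq_iff by simp
    qed
    show ?thesis
      using i mem[OF abc(1)] mem[OF abc(2)] mem[OF abc(3)]
      by (simp add: row_def colouring_entry_def lookup_minus)
  qed
  ultimately show ?thesis using minors_of_arcs_divides_iff[of D row m] by simp
qed

section \<open>Invariance of the determinant\<close>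

text \<open>
  The part of being a link diagram on which invariance rests; planarity enters only later.
\<close>

definition edges_twice :: "diagram \<Rightarrow> bool" where
  "edges_twice D \<longleftrightarrow> (\<forall>a\<in>edges D. count_list (edge_ends D) a = 2)"

lemma link_diagram_edges_twice: "link_diagram D \<Longrightarrow> edges_twice D"
  by (simp add: link_diagram_def edges_twice_def)

lemma edge_ends_Cons [simp]: "edge_ends (v # T) = ends v @ edge_ends T"
  by (simp add: edge_ends_def)

lemma edges_twice_cong:
  assumes "mset (edge_ends D) = mset (edge_ends E)"
  shows "edges_twice D \<longleftrightarrow> edges_twice E"
  using assms unfolding edges_twice_def edges_def count_mset[symmetric] set_mset_mset[symmetric] by simp

text \<open>
  The inner edges of a Reidemeister move already occur twice in it, so they occur nowhere else.
\<close>

lemma edges_twice_other_ends: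
  assumes "edges_twice D" "mset (edge_ends D) = add_mset z (add_mset z M)"
  shows "z \<notin># M"
proof -
  have "z \<in> set_mset (mset (edge_ends D))" unfolding assms(2) by simp
  then have "z \<in> edges D" by (simp add: edges_def)
  then have "count (mset (edge_ends D)) z = 2"
    using assms(1) by (simp add: edges_twice_def count_mset)
  then show ?thesis unfolding assms(2) by (simp add: count_eq_zero_iff)
qed

lemma frag_extend_ident:
  assumes "Poly_Mapping.keys r \<subseteq> Y" "\<And>y. y \<in> Y \<Longrightarrow> w y = frag_of y"
  shows "frag_extend w r = r"
  using frag_extend_eq[of r w frag_of] assms frag_expansion[of r] by auto

lemma group_closure_mono: "S \<subseteq> T \<Longrightarrow> group_closure S \<subseteq> group_closure (T :: 'a::ab_group_add set)"
  by (meson group_closure_minimal group_closure_superset order_trans)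

lemma group_closure_union_cong:
  assumes "group_closure A = group_closure (B :: 'a::ab_group_add set)"
  shows "group_closure (A \<union> C) = group_closure (B \<union> C)"
proof (rule group_closure_eqI)
  have "A \<subseteq> group_closure B" "B \<subseteq> group_closure A"
    using group_closure_superset assms by blast+
  then show "A \<union> C \<subseteq> group_closure (B \<union> C)" "B \<union> C \<subseteq> group_closure (A \<union> C)"
    using group_closure_mono[of B "B \<union> C"] group_closure_mono[of A "A \<union> C"]
      group_closure_superset[of "B \<union> C"] group_closure_superset[of "A \<union> C"] by auto
qed

lemma divides_colouring_minors_cong:
  assumes "edges D = edges E" "group_closure (relations D) = group_closure (relations E)"
  shows "divides_colouring_minors D = divides_colouring_minors E"
  using divides_first_minors_closure[OF assms(2)] assms(1) by (simp add: divides_colouring_minors_def)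

text \<open>
  How a Reidemeister move acts on the colouring group: \<open>vs\<close> are the vertices that take part in the move, \<open>Z\<close> is the set
  of its inner edges, and \<open>w\<close> expresses the colours of the inner edges by those of the others.
\<close>

lemma eliminate_edges:
  assumes edges: "edges (vs @ T) = Z \<union> Y" and T: "edges T \<subseteq> Y" and "Y \<noteq> {}"
    and fixed: "\<And>y. y \<in> Y \<Longrightarrow> w y = frag_of y"
    and inner: "\<And>z. z \<in> Z \<Longrightarrow> Poly_Mapping.keys (w z) \<subseteq> Y"
      "\<And>z. z \<in> Z \<Longrightarrow> frag_of z - w z \<in> group_closure (relations (vs @ T))"
    and K: "group_closure (frag_extend w ` relations vs) = group_closure K"
  shows "divides_colouring_minors (vs @ T) = divides_first_minors Y (K \<union> relations T)"
proof -
  have "divides_colouring_minors (vs @ T)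
      = divides_first_minors Y (frag_extend w ` relations (vs @ T))"
    unfolding divides_colouring_minors_def
  proof (rule divides_first_minors_eliminate)
    show "Poly_Mapping.keys (w x) \<subseteq> Y" if "x \<in> edges (vs @ T)" for x
      using that fixed inner(1) by (cases "x \<in> Y") (auto simp: edges keys_frag_of)
    show "frag_of x - w x \<in> group_closure (relations (vs @ T))" if "x \<in> edges (vs @ T)" for x
      using that fixed inner(2) by (cases "x \<in> Y") (auto simp: edges)
    show "finite (edges (vs @ T))" by simp
    show "Poly_Mapping.keys r \<subseteq> edges (vs @ T)" if "r \<in> relations (vs @ T)" for r
      using that by (rule keys_relations)
  qed (use assms(3) fixed edges in auto)
  also have "frag_extend w ` relations (vs @ T) = frag_extend w ` relations vs \<union> relations T"
  proof -
    have "frag_extend w r = r" if "r \<in> relations T" for r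
      using keys_relations[OF that] T by (intro frag_extend_ident[of r Y] fixed) auto
    moreover have "relations (vs @ T) = relations vs \<union> relations T" by (simp add: relations_def)
    ultimately show ?thesis by (simp add: image_Un)
  qed
  also have "divides_first_minors Y (frag_extend w ` relations vs \<union> relations T)
      = divides_first_minors Y (K \<union> relations T)"
    by (intro divides_first_minors_closure group_closure_union_cong K)
  finally show ?thesis .
qed

lemma relations_Nil [simp]: "relations [] = {}"
  by (simp add: relations_def)

lemma frag_double: "frag_cmul 2 x = x + x"
  using frag_cmul_distrib[of 1 1 x] by simp

lemma colouring_rename:
  assumes "inj_on f (edges D)"
  shows "divides_colouring_minors (map (relabel f) D) = divides_colouring_minors D"
proof -
  have ends: "ends (relabel f v) = map f (ends v)" for v by (cases v) auto
  have "vertex_relations (relabel f v) = frag_extend (frag_of \<circ> f) ` vertex_relations v" for v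
    by (cases v) (auto simp: frag_extend_diff frag_extend_cmul)
  then have "relations (map (relabel f) D) = frag_extend (frag_of \<circ> f) ` relations D"
    by (simp add: relations_def image_UN)
  moreover have "edges (map (relabel f) D) = f ` edges D"
    by (simp add: edges_conv ends image_UN)
  ultimately show ?thesis
    using divides_first_minors_rename[OF keys_relations assms]
    by (simp add: divides_colouring_minors_def)
qed

lemma colouring_rotate_crossing:
  "divides_colouring_minors (Crossing a b c d # T) = divides_colouring_minors (Crossing c d a b # T)"
proof (rule divides_colouring_minors_cong)
  have half: "vertex_relations (Crossing a b c d) \<subseteq> group_closure (vertex_relations (Crossing c d a b))" for a b c d
  proof -
    let ?G = "group_closure (vertex_relations (Crossing c d a b))"
    have g: "frag_of d - frag_of b \<in> ?G" "frag_cmul 2 (frag_of d) - frag_of c - frag_of a \<in> ?G"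
      by (auto intro: group_closure.base)
    have 1: "frag_of b - frag_of d \<in> ?G" using group_closure.diff[OF _ g(1), of 0] by simp
    have "frag_cmul 2 (frag_of b) - frag_of a - frag_of c
      = (frag_cmul 2 (frag_of d) - frag_of c - frag_of a) - (frag_of d - frag_of b) - (frag_of d - frag_of b)"
      by (simp add: frag_double algebra_simps)
    moreover have "\<dots> \<in> ?G" by (intro group_closure.diff g)
    ultimately have "frag_cmul 2 (frag_of b) - frag_of a - frag_of c \<in> ?G" by (simp only:)
    then show ?thesis using 1 by simp
  qed
  show "group_closure (relations (Crossing a b c d # T)) = group_closure (relations (Crossing c d a b # T))"
    unfolding relations_Cons by (intro group_closure_union_cong group_closure_eqI half)
qed auto

text \<open>
  Since \<open>b = d\<close>, the relation \<open>2 b = a + c\<close> does not depend on the orientation of the plane.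
  This reduces the mirrored third move to the third move.
\<close>

lemma group_closure_mirror:
  "group_closure (vertex_relations (Crossing a b c d)) = group_closure (vertex_relations (Crossing a d c b))"
proof (rule group_closure_eqI)
  have half: "vertex_relations (Crossing a b c d) \<subseteq> group_closure (vertex_relations (Crossing a d c b))" for a b c d
  proof -
    let ?G = "group_closure (vertex_relations (Crossing a d c b))"
    have g: "frag_of d - frag_of b \<in> ?G" "frag_cmul 2 (frag_of d) - frag_of a - frag_of c \<in> ?G"
      by (auto intro: group_closure.base)
    have 1: "frag_of b - frag_of d \<in> ?G" using group_closure.diff[OF _ g(1), of 0] by simp
    have "frag_cmul 2 (frag_of b) - frag_of a - frag_of c
      = (frag_cmul 2 (frag_of d) - frag_of a - frag_of c) - (frag_of d - frag_of b) - (frag_of d - frag_of b)"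
      by (simp add: frag_double algebra_simps)
    moreover have "\<dots> \<in> ?G" by (intro group_closure.diff g)
    ultimately have "frag_cmul 2 (frag_of b) - frag_of a - frag_of c \<in> ?G" by (simp only:)
    then show ?thesis using 1 by simp
  qed
  then show "vertex_relations (Crossing a b c d) \<subseteq> group_closure (vertex_relations (Crossing a d c b))"
    "vertex_relations (Crossing a d c b) \<subseteq> group_closure (vertex_relations (Crossing a b c d))"
    by blast+
qed

lemma colouring_reorder: "mset D = mset E \<Longrightarrow> divides_colouring_minors D = divides_colouring_minors E"
  by (rule divides_colouring_minors_cong) (auto simp: edges_conv relations_def dest: mset_eq_setD)

lemma colouring_rotate_point:
  "divides_colouring_minors (Point a b # T) = divides_colouring_minors (Point b a # T)"
proof (rule divides_colouring_minors_cong)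
  have half: "{frag_of a - frag_of b} \<subseteq> group_closure {frag_of b - frag_of a}" for a b :: nat
    using group_closure_minus_iff[of "frag_of b - frag_of a" "{frag_of b - frag_of a}"]
    by (auto intro: group_closure.base)
  show "group_closure (relations (Point a b # T)) = group_closure (relations (Point b a # T))"
    unfolding relations_Cons vertex_relations.simps
    by (intro group_closure_union_cong group_closure_eqI half)
qed auto

lemma colouring_remove_point:
  assumes "a \<noteq> b" "edges_twice (Point a b # T)"
  shows "divides_colouring_minors (Point a b # T)
    = divides_colouring_minors (map (relabel (id(b := a))) T)"
proof -
  let ?f = "id(b := a)"
  let ?w = "frag_of \<circ> ?f"
  have "a \<in> edges T"
  proof (rule ccontr)
    assume "a \<notin> edges T"
    then have "count_list (edge_ends (Point a b # T)) a = 1"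
      using assms(1) by (simp add: edges_def)
    moreover have "count_list (edge_ends (Point a b # T)) a = 2"
      using assms(2) by (simp only: edges_twice_def edges_Cons) simp
    ultimately show False by simp
  qed
  have ends: "ends (relabel f v) = map f (ends v)" for f v by (cases v) auto
  have "vertex_relations (relabel ?f v) = frag_extend ?w ` vertex_relations v" for v
    by (cases v) (auto simp: frag_extend_diff frag_extend_cmul)
  then have T: "relations (map (relabel ?f) T) = frag_extend ?w ` relations T"
    by (simp add: relations_def image_UN)
  have edges: "edges (map (relabel ?f) T) = ?f ` edges T"
    unfolding edges_conv image_UN set_map UN_simps ends ..
  have "divides_colouring_minors (Point a b # T)
     = divides_first_minors (?f ` edges T) (frag_extend ?w ` relations (Point a b # T))"
    unfolding divides_colouring_minors_def
  proof (rule divides_first_minors_eliminate)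
    show "frag_of x - ?w x \<in> group_closure (relations (Point a b # T))" for x
    proof (cases "x = b")
      case True
      have "frag_of a - frag_of b \<in> group_closure (relations (Point a b # T))"
        by (rule group_closure.base) simp
      from group_closure.diff[OF zero_in_group_closure this] show ?thesis using True by simp
    qed simp
    show "Poly_Mapping.keys r \<subseteq> edges (Point a b # T)" if "r \<in> relations (Point a b # T)" for r
      using that by (rule keys_relations)
  qed (use \<open>a \<in> edges T\<close> assms(1) in \<open>auto simp: keys_frag_of\<close>)
  also have "\<dots> = divides_first_minors (?f ` edges T) (frag_extend ?w ` relations T)"
  proof (rule divides_first_minors_closure)
    have "frag_extend ?w ` relations (Point a b # T) = insert 0 (frag_extend ?w ` relations T)"
      using assms(1) by (simp add: frag_extend_diff)
    then show "group_closure (frag_extend ?w ` relations (Point a b # T))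
        = group_closure (frag_extend ?w ` relations T)" by simp
  qed
  finally show ?thesis by (simp add: divides_colouring_minors_def T edges)
qed

lemma colouring_R1:
  assumes "edges_twice (Crossing m m a b # T)"
  shows "divides_colouring_minors (Crossing m m a b # T) = divides_colouring_minors (Point a b # T)"
proof -
  have m: "m \<noteq> a" "m \<noteq> b" "m \<notin> edges T"
    using edges_twice_other_ends[OF assms, of m "add_mset a (add_mset b (mset (edge_ends T)))"]
    by (auto simp: edges_def)
  let ?w = "frag_of(m := frag_of b)"
  have "divides_colouring_minors ([Crossing m m a b] @ T)
      = divides_first_minors (edges (Point a b # T)) ({frag_of a - frag_of b} \<union> relations T)"
  proof (rule eliminate_edges[where Z = "{m}" and w = ?w])
    show "frag_of z - ?w z \<in> group_closure (relations ([Crossing m m a b] @ T))" if "z \<in> {m}" for z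
      using that by (auto intro: group_closure.base)
    have "frag_extend ?w ` relations [Crossing m m a b] = insert 0 {frag_of b - frag_of a}"
      using m by (simp add: frag_extend_diff frag_extend_cmul frag_double)
    moreover have half: "{frag_of a - frag_of b} \<subseteq> group_closure {frag_of b - frag_of a}" for a b :: nat
      using group_closure_minus_iff[of "frag_of b - frag_of a" "{frag_of b - frag_of a}"]
      by (auto intro: group_closure.base)
    ultimately show "group_closure (frag_extend ?w ` relations [Crossing m m a b])
        = group_closure {frag_of a - frag_of b}"
      using half by (simp add: group_closure_eqI)
  qed (use m in \<open>auto simp: keys_frag_of\<close>)
  then show ?thesis by (simp add: divides_colouring_minors_def)
qed

lemma colouring_R1_mirror:
  assumes "edges_twice (Crossing a m m b # T)"
  shows "divides_colouring_minors (Crossing a m m b # T) = divides_colouring_minors (Point a b # T)"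
proof -
  have m: "m \<noteq> a" "m \<noteq> b" "m \<notin> edges T"
    using edges_twice_other_ends[OF assms, of m "add_mset a (add_mset b (mset (edge_ends T)))"]
    by (auto simp: edges_def)
  let ?w = "frag_of(m := frag_of b)"
  have "divides_colouring_minors ([Crossing a m m b] @ T)
      = divides_first_minors (edges (Point a b # T)) ({frag_of a - frag_of b} \<union> relations T)"
  proof (rule eliminate_edges[where Z = "{m}" and w = ?w])
    show "frag_of z - ?w z \<in> group_closure (relations ([Crossing a m m b] @ T))" if "z \<in> {m}" for z
      using that by (auto intro: group_closure.base)
    have "frag_extend ?w ` relations [Crossing a m m b] = insert 0 {frag_of b - frag_of a}"
      using m by (simp add: frag_extend_diff frag_extend_cmul frag_double)
    moreover have half: "{frag_of a - frag_of b} \<subseteq> group_closure {frag_of b - frag_of a}" for a b :: nat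
      using group_closure_minus_iff[of "frag_of b - frag_of a" "{frag_of b - frag_of a}"]
      by (auto intro: group_closure.base)
    ultimately show "group_closure (frag_extend ?w ` relations [Crossing a m m b])
        = group_closure {frag_of a - frag_of b}"
      using half by (simp add: group_closure_eqI)
  qed (use m in \<open>auto simp: keys_frag_of\<close>)
  then show ?thesis by (simp add: divides_colouring_minors_def)
qed

lemma colouring_R2:
  assumes "edges_twice (Crossing c m n a # Crossing n m d b # T)"
  shows "divides_colouring_minors (Crossing c m n a # Crossing n m d b # T)
    = divides_colouring_minors (Point a b # Point c d # T)"
proof -
  have m: "m \<notin># {#a, b, c, d, n, n#} + mset (edge_ends T)"
    by (rule edges_twice_other_ends[OF assms]) simp
  have n: "n \<notin># {#a, b, c, d, m, m#} + mset (edge_ends T)"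
    by (rule edges_twice_other_ends[OF assms]) simp
  let ?vs = "[Crossing c m n a, Crossing n m d b]"
  let ?Y = "{a, b, c, d} \<union> edges T"
  let ?k1 = "frag_of a - frag_of b" and ?k2 = "frag_of c - frag_of d"
  define w where "w = frag_of(m := frag_of a, n := frag_cmul 2 (frag_of a) - frag_of c)"
  have fixed: "w y = frag_of y" if "y \<in> ?Y" for y
    using m n that by (auto simp: w_def edges_def)
  have w: "w a = frag_of a" "w b = frag_of b" "w c = frag_of c" "w d = frag_of d"
    by (simp_all add: fixed)
  have wmn: "w m = frag_of a" "w n = frag_cmul 2 (frag_of a) - frag_of c"
    using n by (auto simp: w_def)
  have "divides_colouring_minors (?vs @ T) = divides_first_minors ?Y ({?k1, ?k2} \<union> relations T)"
  proof (rule eliminate_edges[where Z = "{m, n}" and w = w])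
    let ?G = "group_closure (relations (?vs @ T))"
    have g: "frag_of m - frag_of a \<in> ?G" "frag_cmul 2 (frag_of m) - frag_of c - frag_of n \<in> ?G"
      by (auto intro: group_closure.base)
    have "frag_of n - w n = (frag_of m - frag_of a) + (frag_of m - frag_of a)
        - (frag_cmul 2 (frag_of m) - frag_of c - frag_of n)"
      by (simp add: wmn frag_double algebra_simps)
    moreover have "\<dots> \<in> ?G" by (rule group_closure.diff group_closure_add g)+
    ultimately have "frag_of n - w n \<in> ?G" by (simp only:)
    moreover have "frag_of m - w m \<in> ?G" using g(1) by (simp only: wmn)
    ultimately show "frag_of z - w z \<in> ?G" if "z \<in> {m, n}" for z
      using that by (elim insertE emptyE) (simp_all only:)
    have "relations ?vs = {frag_of m - frag_of a, frag_cmul 2 (frag_of m) - frag_of c - frag_of n,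
        frag_of m - frag_of b, frag_cmul 2 (frag_of m) - frag_of n - frag_of d}"
      by (simp only: relations_Cons relations_Nil vertex_relations.simps) blast
    moreover have "frag_extend w (frag_of m - frag_of a) = 0"
      "frag_extend w (frag_cmul 2 (frag_of m) - frag_of c - frag_of n) = 0"
      "frag_extend w (frag_of m - frag_of b) = ?k1"
      "frag_extend w (frag_cmul 2 (frag_of m) - frag_of n - frag_of d) = ?k2"
      by (simp_all add: frag_extend_diff frag_extend_cmul w wmn)
    ultimately have "frag_extend w ` relations ?vs = insert 0 {?k1, ?k2}"
      by (simp only: image_insert image_empty) blast
    then show "group_closure (frag_extend w ` relations ?vs) = group_closure {?k1, ?k2}"
      by (simp only: group_closure_insert_zero)
    show "Poly_Mapping.keys (w z) \<subseteq> ?Y" if "z \<in> {m, n}" for z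
      using that wmn by (auto simp: in_keys_iff lookup_minus split: if_splits)
  qed (use fixed in auto)
  moreover have "{?k1, ?k2} \<union> relations T = relations (Point a b # Point c d # T)"
    by (simp only: relations_Cons vertex_relations.simps) blast
  moreover have "?Y = edges (Point a b # Point c d # T)" by auto
  ultimately show ?thesis by (simp only: divides_colouring_minors_def append_Cons append_Nil)
qed

text \<open>
  After eliminating the inner edges \<open>m2\<close>, \<open>b2\<close> and \<open>t2\<close>, both sides say that \<open>t1 = t3\<close>,
  \<open>m1 + m3 = 2 t1\<close> and \<open>b3 = b1 + 2 m3 - 2 t3\<close>.
\<close>

lemma colouring_R3:
  assumes D: "edges_twice (Crossing b1 m2 b2 m1 # Crossing b2 t2 b3 t1 # Crossing m2 t3 m3 t2 # T)"
  shows "divides_colouring_minors (Crossing b1 m2 b2 m1 # Crossing b2 t2 b3 t1 # Crossing m2 t3 m3 t2 # T)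
     = divides_colouring_minors (Crossing b2 m3 b3 m2 # Crossing m1 t2 m2 t1 # Crossing b1 t3 b2 t2 # T)"
proof -
  have m: "m2 \<notin># {#b1, b2, b2, b3, m1, m3, t1, t2, t2, t3#} + mset (edge_ends T)"
    by (rule edges_twice_other_ends[OF D]) simp
  have b: "b2 \<notin># {#b1, b3, m1, m2, m2, m3, t1, t2, t2, t3#} + mset (edge_ends T)"
    by (rule edges_twice_other_ends[OF D]) simp
  have t: "t2 \<notin># {#b1, b2, b2, b3, m1, m2, m2, m3, t1, t3#} + mset (edge_ends T)"
    by (rule edges_twice_other_ends[OF D]) simp
  let ?L = "[Crossing b1 m2 b2 m1, Crossing b2 t2 b3 t1, Crossing m2 t3 m3 t2]"
  let ?R = "[Crossing b2 m3 b3 m2, Crossing m1 t2 m2 t1, Crossing b1 t3 b2 t2]"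
  let ?Y = "{b1, b3, m1, m3, t1, t3} \<union> edges T"
  let ?k1 = "frag_of t3 - frag_of t1"
  let ?k2 = "frag_cmul 2 (frag_of t1) - frag_of m1 - frag_of m3"
  let ?k3 = "frag_cmul 2 (frag_of m3) - frag_cmul 2 (frag_of t3) + frag_of b1 - frag_of b3"
  have "divides_colouring_minors (?L @ T) = divides_first_minors ?Y ({?k1, ?k2, ?k3} \<union> relations T)"
  proof -
    define w where "w = frag_of(m2 := frag_of m1, t2 := frag_of t1, b2 := frag_cmul 2 (frag_of m1) - frag_of b1)"
    have fixed: "w y = frag_of y" if "y \<in> ?Y" for y
      using m b t that by (auto simp: w_def edges_def)
    have w: "w b1 = frag_of b1" "w b3 = frag_of b3" "w m1 = frag_of m1" "w m3 = frag_of m3"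
      "w t1 = frag_of t1" "w t3 = frag_of t3"
      by (simp_all add: fixed)
    have wi: "w m2 = frag_of m1" "w t2 = frag_of t1" "w b2 = frag_cmul 2 (frag_of m1) - frag_of b1"
      using m b t by (auto simp: w_def)
    show ?thesis
    proof (rule eliminate_edges[where Z = "{m2, b2, t2}" and w = w])
      let ?G = "group_closure (relations (?L @ T))"
      have g: "frag_of m2 - frag_of m1 \<in> ?G" "frag_cmul 2 (frag_of m2) - frag_of b1 - frag_of b2 \<in> ?G"
          "frag_of t2 - frag_of t1 \<in> ?G"
        by (auto intro: group_closure.base)
      have "frag_of b2 - w b2 = (frag_of m2 - frag_of m1) + (frag_of m2 - frag_of m1)
          - (frag_cmul 2 (frag_of m2) - frag_of b1 - frag_of b2)"
        by (simp add: wi frag_double algebra_simps)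
      moreover have "\<dots> \<in> ?G" by (rule group_closure.diff group_closure_add g)+
      ultimately have "frag_of b2 - w b2 \<in> ?G" by (simp only:)
      moreover have "frag_of m2 - w m2 \<in> ?G" "frag_of t2 - w t2 \<in> ?G" using g by (simp_all only: wi)
      ultimately show "frag_of z - w z \<in> ?G" if "z \<in> {m2, b2, t2}" for z
        using that by (elim insertE emptyE) (simp_all only:)
      let ?l = "frag_cmul 2 (frag_of t1) - (frag_cmul 2 (frag_of m1) - frag_of b1) - frag_of b3"
      let ?m = "frag_cmul 2 (frag_of t3) - frag_of m1 - frag_of m3"
      have "relations ?L = {frag_of m2 - frag_of m1, frag_cmul 2 (frag_of m2) - frag_of b1 - frag_of b2,
          frag_of t2 - frag_of t1, frag_cmul 2 (frag_of t2) - frag_of b2 - frag_of b3,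
          frag_of t3 - frag_of t2, frag_cmul 2 (frag_of t3) - frag_of m2 - frag_of m3}"
        by (simp only: relations_Cons relations_Nil vertex_relations.simps) blast
      moreover have "frag_extend w (frag_of m2 - frag_of m1) = 0"
        "frag_extend w (frag_cmul 2 (frag_of m2) - frag_of b1 - frag_of b2) = 0"
        "frag_extend w (frag_of t2 - frag_of t1) = 0"
        "frag_extend w (frag_cmul 2 (frag_of t2) - frag_of b2 - frag_of b3) = ?l"
        "frag_extend w (frag_of t3 - frag_of t2) = ?k1"
        "frag_extend w (frag_cmul 2 (frag_of t3) - frag_of m2 - frag_of m3) = ?m"
        by (simp_all add: frag_extend_diff frag_extend_cmul w wi)
      ultimately have "frag_extend w ` relations ?L = insert 0 {?k1, ?l, ?m}"
        by (simp only: image_insert image_empty) blast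
      moreover have "group_closure {?k1, ?l, ?m} = group_closure {?k1, ?k2, ?k3}"
      proof (rule group_closure_eqI)
        let ?K = "group_closure {?k1, ?k2, ?k3}" and ?M = "group_closure {?k1, ?l, ?m}"
        have k: "?k1 \<in> ?K" "?k2 \<in> ?K" "?k3 \<in> ?K" by (auto intro: group_closure.base)
        have "?k2 + (?k1 + ?k1) \<in> ?K" "?k3 + (?k2 + ?k2 + (?k1 + ?k1)) \<in> ?K"
          by (rule k group_closure_add)+
        moreover have "?k2 + (?k1 + ?k1) = ?m" "?k3 + (?k2 + ?k2 + (?k1 + ?k1)) = ?l"
          by (simp_all add: frag_double algebra_simps)
        ultimately have "?m \<in> ?K" "?l \<in> ?K" by (simp_all only:)
        with k(1) show "{?k1, ?l, ?m} \<subseteq> ?K" by blast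
        have m: "?k1 \<in> ?M" "?l \<in> ?M" "?m \<in> ?M" by (auto intro: group_closure.base)
        have "?m - (?k1 + ?k1) \<in> ?M" "?l - (?m + ?m) + (?k1 + ?k1) \<in> ?M"
          by (rule m group_closure_add group_closure.diff)+
        moreover have "?m - (?k1 + ?k1) = ?k2" "?l - (?m + ?m) + (?k1 + ?k1) = ?k3"
          by (simp_all add: frag_double algebra_simps)
        ultimately have "?k2 \<in> ?M" "?k3 \<in> ?M" by (simp_all only:)
        with m(1) show "{?k1, ?k2, ?k3} \<subseteq> ?M" by blast
      qed
      ultimately show "group_closure (frag_extend w ` relations ?L) = group_closure {?k1, ?k2, ?k3}"
        by (simp only: group_closure_insert_zero)
      show "Poly_Mapping.keys (w z) \<subseteq> ?Y" if "z \<in> {m2, b2, t2}" for z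
        using that wi by (auto simp: in_keys_iff lookup_minus split: if_splits)
    qed (use fixed in auto)
  qed
  moreover have "divides_colouring_minors (?R @ T) = divides_first_minors ?Y ({?k1, ?k2, ?k3} \<union> relations T)"
  proof -
    define w where "w = frag_of(m2 := frag_of m3, t2 := frag_of t1, b2 := frag_cmul 2 (frag_of t3) - frag_of b1)"
    have fixed: "w y = frag_of y" if "y \<in> ?Y" for y
      using m b t that by (auto simp: w_def edges_def)
    have w: "w b1 = frag_of b1" "w b3 = frag_of b3" "w m1 = frag_of m1" "w m3 = frag_of m3"
      "w t1 = frag_of t1" "w t3 = frag_of t3"
      by (simp_all add: fixed)
    have wi: "w m2 = frag_of m3" "w t2 = frag_of t1" "w b2 = frag_cmul 2 (frag_of t3) - frag_of b1"
      using m b t by (auto simp: w_def)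
    show ?thesis
    proof (rule eliminate_edges[where Z = "{m2, b2, t2}" and w = w])
      let ?G = "group_closure (relations (?R @ T))"
      have g: "frag_of m3 - frag_of m2 \<in> ?G" "frag_cmul 2 (frag_of t3) - frag_of b1 - frag_of b2 \<in> ?G"
          "frag_of t2 - frag_of t1 \<in> ?G"
        by (auto intro: group_closure.base)
      have "frag_of b2 - w b2 = 0 - (frag_cmul 2 (frag_of t3) - frag_of b1 - frag_of b2)"
        "frag_of m2 - w m2 = 0 - (frag_of m3 - frag_of m2)"
        by (simp_all add: wi)
      moreover have "0 - (frag_cmul 2 (frag_of t3) - frag_of b1 - frag_of b2) \<in> ?G"
        "0 - (frag_of m3 - frag_of m2) \<in> ?G"
        by (rule zero_in_group_closure g group_closure.diff)+
      ultimately have "frag_of b2 - w b2 \<in> ?G" "frag_of m2 - w m2 \<in> ?G" by (simp_all only:)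
      moreover have "frag_of t2 - w t2 \<in> ?G" using g by (simp only: wi)
      ultimately show "frag_of z - w z \<in> ?G" if "z \<in> {m2, b2, t2}" for z
        using that by (elim insertE emptyE) (simp_all only:)
      have "relations ?R = {frag_of m3 - frag_of m2, frag_cmul 2 (frag_of m3) - frag_of b2 - frag_of b3,
          frag_of t2 - frag_of t1, frag_cmul 2 (frag_of t2) - frag_of m1 - frag_of m2,
          frag_of t3 - frag_of t2, frag_cmul 2 (frag_of t3) - frag_of b1 - frag_of b2}"
        by (simp only: relations_Cons relations_Nil vertex_relations.simps) blast
      moreover have "frag_extend w (frag_of m3 - frag_of m2) = 0"
        "frag_extend w (frag_cmul 2 (frag_of m3) - frag_of b2 - frag_of b3) = ?k3"
        "frag_extend w (frag_of t2 - frag_of t1) = 0"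
        "frag_extend w (frag_cmul 2 (frag_of t2) - frag_of m1 - frag_of m2) = ?k2"
        "frag_extend w (frag_of t3 - frag_of t2) = ?k1"
        "frag_extend w (frag_cmul 2 (frag_of t3) - frag_of b1 - frag_of b2) = 0"
        by (simp_all add: frag_extend_diff frag_extend_cmul w wi)
      ultimately have "frag_extend w ` relations ?R = insert 0 {?k1, ?k2, ?k3}"
        by (simp only: image_insert image_empty) blast
      then show "group_closure (frag_extend w ` relations ?R) = group_closure {?k1, ?k2, ?k3}"
        by (simp only: group_closure_insert_zero)
      show "Poly_Mapping.keys (w z) \<subseteq> ?Y" if "z \<in> {m2, b2, t2}" for z
        using that wi by (auto simp: in_keys_iff lookup_minus split: if_splits)
    qed (use fixed in auto)
  qed
  ultimately show ?thesis by (simp only: append_Cons append_Nil)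
qed

lemma colouring_R3_mirror:
  assumes D: "edges_twice (Crossing b1 m1 b2 m2 # Crossing b2 t1 b3 t2 # Crossing m2 t2 m3 t3 # T)"
  shows "divides_colouring_minors (Crossing b1 m1 b2 m2 # Crossing b2 t1 b3 t2 # Crossing m2 t2 m3 t3 # T)
     = divides_colouring_minors (Crossing b2 m2 b3 m3 # Crossing m1 t1 m2 t2 # Crossing b1 t2 b2 t3 # T)"
proof -
  have mirror: "divides_colouring_minors (Crossing a b c d # Crossing e f g h # Crossing i j k l # T)
    = divides_colouring_minors (Crossing a d c b # Crossing e h g f # Crossing i l k j # T)" for a b c d e f g h i j k l
  proof (rule divides_colouring_minors_cong)
    show "group_closure (relations (Crossing a b c d # Crossing e f g h # Crossing i j k l # T))
      = group_closure (relations (Crossing a d c b # Crossing e h g f # Crossing i l k j # T))"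
    proof -
      have 1: "group_closure (relations (Crossing a b c d # U)) = group_closure (relations (Crossing a d c b # U))"
        for a b c d U
        unfolding relations_Cons by (intro group_closure_union_cong group_closure_mirror)
      have 2: "group_closure (relations (v # U)) = group_closure (relations (v # V))"
        if "group_closure (relations U) = group_closure (relations V)" for v U V
        using group_closure_union_cong[OF that, of "vertex_relations v"] by (simp only: relations_Cons Un_commute)
      show ?thesis
        by (rule trans[OF 1 2], rule trans[OF 1 2], rule 1)
    qed
  qed auto
  have "mset (edge_ends (Crossing b1 m1 b2 m2 # Crossing b2 t1 b3 t2 # Crossing m2 t2 m3 t3 # T))
    = mset (edge_ends (Crossing b1 m2 b2 m1 # Crossing b2 t2 b3 t1 # Crossing m2 t3 m3 t2 # T))"
    by simp
  then have "edges_twice (Crossing b1 m2 b2 m1 # Crossing b2 t2 b3 t1 # Crossing m2 t3 m3 t2 # T)"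
    using D edges_twice_cong by blast
  from colouring_R3[OF this] show ?thesis
    unfolding mirror[of b1 m1] mirror[of b2 m2] by simp
qed

theorem divides_colouring_minors_move:
  "move D E \<Longrightarrow> edges_twice D \<Longrightarrow> divides_colouring_minors D = divides_colouring_minors E"
proof (induction rule: move.induct)
  case (reorder D E)
  then show ?case by (blast intro: colouring_reorder)
next
  case (rename f D)
  then show ?case by (simp add: colouring_rename)
next
  case (rotate_crossing a b c d T)
  then show ?case by (blast intro: colouring_rotate_crossing)
next
  case (rotate_point a b T)
  then show ?case by (blast intro: colouring_rotate_point)
next
  case (remove_point a b T)
  then show ?case by (blast intro: colouring_remove_point)
next
  case (R1 m a b T)
  then show ?case by (blast intro: colouring_R1)
next
  case (R1_mirror a m b T)
  then show ?case by (blast intro: colouring_R1_mirror)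
next
  case (R2 c m n a d b T)
  then show ?case by (blast intro: colouring_R2)
next
  case (R3 b1 m2 b2 m1 t2 b3 t1 t3 m3 T)
  then show ?case by (blast intro: colouring_R3)
next
  case (R3_mirror b1 m1 b2 m2 t1 b3 t2 m3 t3 T)
  then show ?case by (blast intro: colouring_R3_mirror)
qed

lemma same_link_determinant:
  assumes "same_link D E"
  shows "diagram_determinant D = diagram_determinant E"
proof -
  have *: "diagram_determinant D = diagram_determinant E" if "divides_colouring_minors D = divides_colouring_minors E" for D E
  proof (rule dvd_antisym)
    show "diagram_determinant D dvd diagram_determinant E"
      by (simp only: divides_diagram_determinant_iff that[symmetric])
        (simp flip: divides_diagram_determinant_iff)
    show "diagram_determinant E dvd diagram_determinant D"
      by (simp only: divides_diagram_determinant_iff that) (simp flip: divides_diagram_determinant_iff)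
  qed
  show ?thesis
    using assms unfolding same_link_def
  proof (induction rule: equivclp_induct)
    case base
    show ?case ..
  next
    case (step E F)
    have "divides_colouring_minors E = divides_colouring_minors F"
      using step.hyps(2)
    proof
      assume "link_diagram E \<and> link_diagram F \<and> move E F"
      then show ?thesis by (intro divides_colouring_minors_move link_diagram_edges_twice) auto
    next
      assume "link_diagram F \<and> link_diagram E \<and> move F E"
      then show ?thesis by (intro divides_colouring_minors_move[symmetric] link_diagram_edges_twice) auto
    qed
    from *[OF this] step.IH show ?case by simp
  qed
qed

theorem link_determinant_eq:
  assumes "is_link R" "S \<in> R"
  shows "link_determinant R = diagram_determinant S"
proof -
  obtain D where D: "R = link_of D" using assms(1) by (auto simp: is_link_def)
  show ?thesis unfolding link_determinant_def
  proof (rule the_equality)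
    show "\<exists>E\<in>R. diagram_determinant S = diagram_determinant E" using assms(2) by blast
    fix d assume "\<exists>E\<in>R. d = diagram_determinant E"
    then obtain E where E: "E \<in> R" "d = diagram_determinant E" by blast
    have "same_link D E" "same_link D S" using D E(1) assms(2) by (simp_all add: link_of_def)
    then have "diagram_determinant D = diagram_determinant E" "diagram_determinant D = diagram_determinant S"
      using same_link_determinant by blast+
    with E(2) show "d = diagram_determinant S" by simp
  qed
qed

section \<open>Planarity and face colourings\<close>

lemma card_symmetric_difference_parity:
  assumes "finite A" "finite B"
  shows "odd (card (sym_diff A B)) \<longleftrightarrow> odd (card A) \<noteq> odd (card B)"
proof -
  have "card (sym_diff A B) = card (A - B) + card (B - A)"
    using assms by (intro card_Un_disjoint) auto
  moreover have "card A = card (A - B) + card (A \<inter> B)" "card B = card (B - A) + card (A \<inter> B)"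
    using card_Int_Diff[OF assms(1), of B] card_Int_Diff[OF assms(2), of A] by (simp_all add: Int_commute)
  ultimately show ?thesis by auto
qed

text \<open>
  The homomorphism theorem for the group of subsets of \<open>A\<close> under symmetric difference, which is a
  vector space over the field with two elements.
\<close>

lemma card_kernel_times_image:
  assumes "finite A"
    and hom: "\<And>X Y. X \<subseteq> A \<Longrightarrow> Y \<subseteq> A \<Longrightarrow> f (sym_diff X Y) = sym_diff (f X) (f Y)"
  shows "2 ^ card A = card {X \<in> Pow A. f X = {}} * card (f ` Pow A)"
proof -
  have fibre: "card {X \<in> Pow A. f X = y} = card {X \<in> Pow A. f X = {}}" if y: "y \<in> f ` Pow A" for y
  proof -
    obtain X0 where X0: "X0 \<subseteq> A" "y = f X0"
      using y by auto
    define g where "g X = sym_diff X X0" for X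
    have g: "g X \<in> Pow A" "f (g X) = sym_diff (f X) y" if "X \<in> Pow A" for X
    proof -
      have "X \<subseteq> A" using that by (rule PowD)
      then show "g X \<in> Pow A" using X0(1) unfolding g_def by blast
      show "f (g X) = sym_diff (f X) y"
        unfolding g_def X0(2) by (rule hom[OF \<open>X \<subseteq> A\<close> X0(1)])
    qed
    have gg: "g (g X) = X" for X unfolding g_def by blast
    have "bij_betw g {X \<in> Pow A. f X = y} {X \<in> Pow A. f X = {}}"
    proof (rule bij_betw_byWitness[where f' = g])
      show "g ` {X \<in> Pow A. f X = y} \<subseteq> {X \<in> Pow A. f X = {}}"
      proof (intro image_subsetI)
        fix X assume "X \<in> {X \<in> Pow A. f X = y}"
        then show "g X \<in> {X \<in> Pow A. f X = {}}"
          using g[of X] by (simp only: mem_Collect_eq Diff_cancel Un_empty simp_thms)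
      qed
      show "g ` {X \<in> Pow A. f X = {}} \<subseteq> {X \<in> Pow A. f X = y}"
      proof (intro image_subsetI)
        fix X assume "X \<in> {X \<in> Pow A. f X = {}}"
        then show "g X \<in> {X \<in> Pow A. f X = y}"
          using g[of X] by (simp only: mem_Collect_eq Diff_empty empty_Diff Un_empty_left simp_thms)
      qed
    qed (simp_all add: gg)
    then show ?thesis by (rule bij_betw_same_card)
  qed
  have "2 ^ card A = (\<Sum>X\<in>Pow A. 1::nat)" using assms(1) by (simp add: card_Pow)
  also have "\<dots> = (\<Sum>y\<in>f ` Pow A. \<Sum>X\<in>{X. X \<in> Pow A \<and> f X = y}. 1)"
    by (rule sum.image_gen) (simp add: assms(1))
  also have "\<dots> = (\<Sum>y\<in>f ` Pow A. card {X \<in> Pow A. f X = {}})"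
  proof (rule sum.cong[OF refl])
    fix y assume y: "y \<in> f ` Pow A"
    have "(\<Sum>X\<in>{X. X \<in> Pow A \<and> f X = y}. 1) = card {X \<in> Pow A. f X = y}" by simp
    then show "(\<Sum>X\<in>{X. X \<in> Pow A \<and> f X = y}. 1) = card {X \<in> Pow A. f X = {}}"
      by (rule trans) (rule fibre[OF y])
  qed
  finally show ?thesis by simp
qed

lemma image_restrict: "f ` A = B \<Longrightarrow> f ` {x \<in> A. P (f x)} = {y \<in> B. P y}"
  by blast

lemma sym_diff_cancel: "sym_diff B (sym_diff A B) = A"
  by blast

lemma sym_diff_insert:
  "a \<notin> A \<Longrightarrow> sym_diff (sym_diff A B) (sym_diff {a} {b}) = sym_diff (insert a A) (sym_diff B {b})"
  by (rule Set.set_eqI) auto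

lemma Collect_xor: "{x \<in> A. P x \<noteq> Q x} = sym_diff {x \<in> A. P x} {x \<in> A. Q x}"
  by blast

lemma Collect_insert_restrict:
  "{x \<in> insert a A. P x} = (if P a then insert a {x \<in> A. P x} else {x \<in> A. P x})"
  by auto

lemma Collect_empty_restrict: "{x \<in> {}. P x} = {}"
  by simp

text \<open>
  The image of a chain modulo 2 under \<open>p\<close>. Both boundary maps below, from faces to edges and from edges
  to vertices, have this form.
\<close>

definition odd_fibres :: "('a \<Rightarrow> 'b) \<Rightarrow> 'a set \<Rightarrow> 'b set" where
  "odd_fibres p S = {y. odd (card {x \<in> S. p x = y})}"

lemma odd_fibres_sym_diff:
  assumes "finite S" "finite T"
  shows "odd_fibres p (sym_diff S T) = sym_diff (odd_fibres p S) (odd_fibres p T)"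
proof -
  have "odd (card {x \<in> sym_diff S T. p x = y}) \<longleftrightarrow>
      odd (card {x \<in> S. p x = y}) \<noteq> odd (card {x \<in> T. p x = y})" for y
  proof -
    have "{x \<in> sym_diff S T. p x = y} = sym_diff {x \<in> S. p x = y} {x \<in> T. p x = y}" by blast
    then show ?thesis
      using assms by (simp only: card_symmetric_difference_parity finite_Collect_conjI disjI1 simp_thms
          finite_subset[OF Collect_restrict])
  qed
  then show ?thesis unfolding odd_fibres_def by blast
qed

lemma odd_fibres_subset: "odd_fibres p S \<subseteq> p ` S"
proof
  fix y assume "y \<in> odd_fibres p S"
  then have "{x \<in> S. p x = y} \<noteq> {}" unfolding odd_fibres_def by force
  then show "y \<in> p ` S" by auto
qed

definition generated_class :: "('a \<times> 'a) set \<Rightarrow> 'a \<Rightarrow> 'a set" where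
  "generated_class r x = (r \<union> r\<inverse>)\<^sup>* `` {x}"

lemma generated_classes_conv: "generated_classes A r = generated_class r ` A"
  by (auto simp: generated_classes_def generated_class_def quotient_def)

lemma generated_class_eq: "generated_class r x = generated_class r y \<longleftrightarrow> (x, y) \<in> (r \<union> r\<inverse>)\<^sup>*"
  unfolding generated_class_def by (rule generated_class_eq_iff)

lemma card_positions: "card {k. k < length xs \<and> xs ! k = a} = count_list xs a"
proof -
  have "{k. k < length xs \<and> a = xs ! k} = {k. k < length xs \<and> xs ! k = a}" by blast
  then show ?thesis by (simp add: count_list_eq_length_filter length_filter_conv_card)
qed

lemma darts_conv: "darts D = (SIGMA i:{..<length D}. {..<length (ends (D ! i))})"
  by (auto simp: darts_def)

lemma finite_darts [simp]: "finite (darts D)"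
  by (simp add: darts_conv)

definition dart_edge :: "diagram \<Rightarrow> nat \<times> nat \<Rightarrow> nat" where
  "dart_edge D d = ends (D ! fst d) ! snd d"

definition next_dart :: "diagram \<Rightarrow> nat \<times> nat \<Rightarrow> nat \<times> nat" where
  "next_dart D d = (fst d, Suc (snd d) mod length (ends (D ! fst d)))"

lemma length_ends_pos: "0 < length (ends v)"
  by (cases v) auto

lemma next_dart_in_darts: "d \<in> darts D \<Longrightarrow> next_dart D d \<in> darts D"
  using length_ends_pos by (auto simp: darts_def next_dart_def)

lemma dart_edge_in_edges: "d \<in> darts D \<Longrightarrow> dart_edge D d \<in> edges D"
  by (auto simp: darts_def dart_edge_def edges_conv intro!: bexI[of _ "D ! fst d"])

lemma card_darts_of_edge: "card {d \<in> darts D. dart_edge D d = a} = count_list (edge_ends D) a"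
proof -
  have "{d \<in> darts D. dart_edge D d = a}
      = (SIGMA i:{..<length D}. {k. k < length (ends (D ! i)) \<and> ends (D ! i) ! k = a})"
    by (auto simp: darts_def dart_edge_def)
  then have "card {d \<in> darts D. dart_edge D d = a} = (\<Sum>i<length D. count_list (ends (D ! i)) a)"
    by (simp add: card_SigmaI card_positions)
  also have "\<dots> = sum_list (map (\<lambda>v. count_list (ends v) a) D)"
    by (simp add: sum_list_sum_nth atLeast0LessThan)
  also have "\<dots> = count_list (edge_ends D) a"
    by (induction D) (auto simp: edge_ends_def)
  finally show ?thesis .
qed

lemma inj_on_next_dart: "inj_on (next_dart D) (darts D)"
proof (rule inj_onI)
  fix d d' assume d: "d \<in> darts D" "d' \<in> darts D" "next_dart D d = next_dart D d'"
  let ?n = "length (ends (D ! fst d))"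
  have "fst d = fst d'" "snd d < ?n" "snd d' < ?n"
    and m: "Suc (snd d) mod ?n = Suc (snd d') mod ?n"
    using d by (auto simp: next_dart_def darts_def)
  moreover from this have "snd d = snd d'"
    by (auto simp: mod_Suc split: if_splits)
  ultimately show "d = d'" by (simp add: prod_eq_iff)
qed

locale planar_diagram =
  fixes D :: diagram
  assumes link_diagram: "link_diagram D"
begin

abbreviation "edge \<equiv> dart_edge D"
abbreviation "rot \<equiv> next_dart D"
abbreviation "face \<equiv> generated_class (face_step D)"

lemma ex_opposite:
  assumes "d \<in> darts D"
  shows "\<exists>d'. d' \<noteq> d \<and> {x \<in> darts D. edge x = edge d} = {d, d'}"
proof -
  have "card {x \<in> darts D. edge x = edge d} = 2"
    using link_diagram dart_edge_in_edges[OF assms]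
    by (simp add: card_darts_of_edge link_diagram_def)
  then obtain x y where xy: "{x \<in> darts D. edge x = edge d} = {x, y}" "x \<noteq> y"
    unfolding card_2_iff by (elim exE conjE)
  have "d \<in> {x \<in> darts D. edge x = edge d}" using assms by simp
  then have "d = x \<or> d = y" unfolding xy(1) by simp
  then show ?thesis
  proof
    assume "d = x"
    then show ?thesis using xy by (intro exI[of _ y]) simp
  next
    assume "d = y"
    then show ?thesis using xy by (intro exI[of _ x]) (simp add: insert_commute)
  qed
qed

definition opp :: "nat \<times> nat \<Rightarrow> nat \<times> nat" where
  "opp d = (SOME d'. d' \<noteq> d \<and> {x \<in> darts D. edge x = edge d} = {d, d'})"

lemma opp:
  assumes "d \<in> darts D"
  shows "opp d \<noteq> d" "{x \<in> darts D. edge x = edge d} = {d, opp d}"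
  using someI_ex[OF ex_opposite[OF assms]] by (simp_all add: opp_def)

lemma
  assumes "d \<in> darts D"
  shows opp_in_darts: "opp d \<in> darts D" and edge_opp: "edge (opp d) = edge d"
proof -
  have "opp d \<in> {x \<in> darts D. edge x = edge d}" unfolding opp(2)[OF assms] by simp
  then show "opp d \<in> darts D" "edge (opp d) = edge d" by simp_all
qed

lemma opp_eqI:
  assumes "d \<in> darts D" "d' \<in> darts D" "d \<noteq> d'" "edge d = edge d'"
  shows "opp d = d'"
proof -
  have "d' \<in> {x \<in> darts D. edge x = edge d}" using assms by simp
  then show ?thesis using assms(3) unfolding opp(2)[OF assms(1)] by simp
qed

lemma opp_opp: "d \<in> darts D \<Longrightarrow> opp (opp d) = d"
  using opp(1) by (intro opp_eqI) (auto simp: opp_in_darts edge_opp)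

lemma face_rot_opp:
  assumes "d \<in> darts D"
  shows "face (rot (opp d)) = face d"
proof -
  have "(d, rot (opp d)) \<in> face_step D"
    using assms opp(1)[OF assms] opp_in_darts[OF assms] edge_opp[OF assms]
    unfolding face_step_def
    by (intro CollectI exI[of _ "fst d"] exI[of _ "snd d"] exI[of _ "fst (opp d)"] exI[of _ "snd (opp d)"])
      (auto simp: next_dart_def dart_edge_def)
  then show ?thesis unfolding generated_class_eq by (intro r_into_rtrancl) simp
qed

lemma faces_conv: "faces D = face ` darts D"
  by (simp add: faces_def generated_classes_conv)

definition darts_in :: "(nat \<times> nat) set set \<Rightarrow> (nat \<times> nat) set" where
  "darts_in U = {d \<in> darts D. face d \<in> U}"

lemma darts_in_subset: "darts_in U \<subseteq> darts D"
  by (auto simp: darts_in_def)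

lemma finite_darts_in [simp]: "finite (darts_in U)"
  by (simp add: darts_in_def)

definition boundary :: "(nat \<times> nat) set set \<Rightarrow> nat set" where
  "boundary U = odd_fibres edge (darts_in U)"

definition odd_vertices :: "nat set \<Rightarrow> nat set" where
  "odd_vertices X = odd_fibres fst {d \<in> darts D. edge d \<in> X}"

lemma boundary_sym_diff: "boundary (sym_diff U W) = sym_diff (boundary U) (boundary W)"
proof -
  have "darts_in (sym_diff U W) = sym_diff (darts_in U) (darts_in W)"
    by (auto simp: darts_in_def)
  then show ?thesis
    using odd_fibres_sym_diff[OF finite_darts_in[of U] finite_darts_in[of W], of edge]
    by (simp only: boundary_def)
qed

lemma odd_vertices_sym_diff: "odd_vertices (sym_diff X Y) = sym_diff (odd_vertices X) (odd_vertices Y)"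
proof -
  have "{d \<in> darts D. edge d \<in> sym_diff X Y}
    = sym_diff {d \<in> darts D. edge d \<in> X} {d \<in> darts D. edge d \<in> Y}" by auto
  moreover have "finite {d \<in> darts D. edge d \<in> X}" for X by simp
  ultimately show ?thesis
    unfolding odd_vertices_def by (simp only: odd_fibres_sym_diff)
qed

lemma edge_in_boundary:
  assumes "d \<in> darts D"
  shows "edge d \<in> boundary U \<longleftrightarrow> (d \<in> darts_in U) \<noteq> (opp d \<in> darts_in U)"
proof -
  have "{x \<in> darts_in U. edge x = edge d} = {d, opp d} \<inter> darts_in U"
  proof -
    have "{x \<in> darts_in U. edge x = edge d} = {x \<in> darts D. edge x = edge d} \<inter> darts_in U"
      using darts_in_subset[of U] by auto
    then show ?thesis unfolding opp(2)[OF assms] .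
  qed
  then have "edge d \<in> boundary U \<longleftrightarrow> odd (card ({d, opp d} \<inter> darts_in U))"
    by (simp add: boundary_def odd_fibres_def)
  then show ?thesis using opp(1)[OF assms]
    by (cases "d \<in> darts_in U"; cases "opp d \<in> darts_in U") auto
qed

lemma rot_in_faces:
  assumes "d \<in> darts D"
  shows "rot d \<in> darts_in U \<longleftrightarrow> opp d \<in> darts_in U"
  using face_rot_opp[OF opp_in_darts[OF assms]] opp_opp[OF assms]
    next_dart_in_darts[OF assms] opp_in_darts[OF assms]
  by (simp add: darts_in_def)

text \<open>
  Around a vertex, the edge of a dart bounds the union of the faces in \<open>U\<close> iff exactly one of this dart
  and the next one belongs to \<open>U\<close>, and walking once around the vertex the membership changes an even number of times.
\<close>

lemma odd_vertices_boundary: "odd_vertices (boundary U) = {}"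
proof -
  have "even (card {d \<in> darts D. edge d \<in> boundary U \<and> fst d = i})" for i
  proof -
    let ?A = "{d \<in> darts D. fst d = i}"
    have fin: "finite ?A" by simp
    have inj: "inj_on rot ?A" using inj_on_next_dart by (rule inj_on_subset) auto
    have "fst (rot d) = fst d" for d by (simp add: next_dart_def)
    then have "rot ` ?A \<subseteq> ?A" using next_dart_in_darts by auto
    then have "rot ` ?A = ?A" using inj by (intro endo_inj_surj[OF fin])
    then have rot: "rot ` {d \<in> ?A. rot d \<in> darts_in U} = {d \<in> ?A. d \<in> darts_in U}"
      by (rule image_restrict)
    have "inj_on rot {d \<in> ?A. rot d \<in> darts_in U}" by (rule inj_on_subset[OF inj]) (rule Collect_restrict)
    from card_image[OF this]
    have card: "card {d \<in> ?A. rot d \<in> darts_in U} = card {d \<in> ?A. d \<in> darts_in U}"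
      by (simp only: rot)
    have "edge d \<in> boundary U \<longleftrightarrow> (d \<in> darts_in U) \<noteq> (rot d \<in> darts_in U)" if "d \<in> darts D" for d
      unfolding edge_in_boundary[OF that] rot_in_faces[OF that] ..
    then have "{d \<in> darts D. edge d \<in> boundary U \<and> fst d = i}
      = {d \<in> ?A. (d \<in> darts_in U) \<noteq> (rot d \<in> darts_in U)}" by (intro Collect_cong) auto
    also have "\<dots> = sym_diff {d \<in> ?A. d \<in> darts_in U} {d \<in> ?A. rot d \<in> darts_in U}"
      by (rule Collect_xor)
    finally have eq: "{d \<in> darts D. edge d \<in> boundary U \<and> fst d = i} = \<dots>" .
    have "finite {d \<in> ?A. P d}" for P by simp
    then have "odd (card (sym_diff {d \<in> ?A. d \<in> darts_in U} {d \<in> ?A. rot d \<in> darts_in U}))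
      \<longleftrightarrow> odd (card {d \<in> ?A. d \<in> darts_in U}) \<noteq> odd (card {d \<in> ?A. rot d \<in> darts_in U})"
      by (intro card_symmetric_difference_parity)
    then show ?thesis unfolding eq card by blast
  qed
  then show ?thesis by (simp add: odd_vertices_def odd_fibres_def)
qed

definition adjacency :: "(nat \<times> nat) set" where
  "adjacency = {(a, b). \<exists>v\<in>set D. a \<in> set (ends v) \<and> b \<in> set (ends v)}"

abbreviation "component \<equiv> generated_class adjacency"

lemma graph_components_conv: "graph_components D = component ` edges D"
  by (simp add: graph_components_def generated_classes_conv adjacency_def)

lemma adjacency_sym: "adjacency \<union> adjacency\<inverse> = adjacency"
  by (auto simp: adjacency_def)

lemma adjacentE:
  assumes "(a, b) \<in> adjacency"
  obtains d d' where "d \<in> darts D" "d' \<in> darts D" "fst d = fst d'" "edge d = a" "edge d' = b"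
proof -
  obtain v where v: "v \<in> set D" "a \<in> set (ends v)" "b \<in> set (ends v)"
    using assms by (auto simp: adjacency_def)
  then obtain i k l where "i < length D" "v = D ! i" "k < length (ends v)" "l < length (ends v)"
      "a = ends v ! k" "b = ends v ! l"
    by (metis in_set_conv_nth)
  then show thesis by (intro that[of "(i, k)" "(i, l)"]) (auto simp: darts_def dart_edge_def)
qed

text \<open>
  If no edge separates \<open>U\<close> from its complement, then neither crossing an edge nor turning around a vertex
  leaves \<open>U\<close>.
\<close>

lemma boundary_empty_component:
  assumes "boundary U = {}" and d: "d \<in> darts D" "d' \<in> darts D"
    and comp: "component (edge d) = component (edge d')"
  shows "d \<in> darts_in U \<longleftrightarrow> d' \<in> darts_in U"
proof -
  have opp: "opp x \<in> darts_in U \<longleftrightarrow> x \<in> darts_in U" if "x \<in> darts D" for x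
    using edge_in_boundary[OF that, of U] assms(1) by auto
  have rot: "rot x \<in> darts_in U \<longleftrightarrow> x \<in> darts_in U" if "x \<in> darts D" for x
    using rot_in_faces[OF that, of U] opp[OF that] by simp
  have first: "(i, k) \<in> darts_in U \<longleftrightarrow> (i, 0) \<in> darts_in U" if "(i, k) \<in> darts D" for i k
    using that
  proof (induction k)
    case (Suc k)
    then have "(i, k) \<in> darts D" "rot (i, k) = (i, Suc k)"
      by (auto simp: darts_def next_dart_def)
    then show ?case using rot[of "(i, k)"] Suc.IH by simp
  qed simp
  have vertex: "x \<in> darts_in U \<longleftrightarrow> y \<in> darts_in U" if "x \<in> darts D" "y \<in> darts D" "fst x = fst y" for x y
  proof -
    have "z \<in> darts_in U \<longleftrightarrow> (fst z, 0) \<in> darts_in U" if "z \<in> darts D" for z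
      using first[of "fst z" "snd z"] that by simp
    from this[OF that(1)] this[OF that(2)] that(3) show ?thesis by simp
  qed
  have same: "x \<in> darts_in U \<longleftrightarrow> y \<in> darts_in U" if "x \<in> darts D" "y \<in> darts D" "edge x = edge y" for x y
  proof (cases "x = y")
    case False
    then show ?thesis using opp_eqI[of x y] opp[of x] that by simp
  qed simp
  have "(edge d, edge d') \<in> adjacency\<^sup>*"
    using comp by (simp add: generated_class_eq adjacency_sym)
  then have "\<forall>x\<in>darts D. edge x = edge d' \<longrightarrow> (d \<in> darts_in U \<longleftrightarrow> x \<in> darts_in U)"
  proof induction
    case base
    then show ?case using same[OF d(1)] by auto
  next
    case (step b c)
    obtain x y where xy: "x \<in> darts D" "y \<in> darts D" "fst x = fst y" "edge x = b" "edge y = c"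
      using adjacentE[OF step(2)] .
    have "d \<in> darts_in U \<longleftrightarrow> x \<in> darts_in U" using step.IH xy by blast
    also have "\<dots> \<longleftrightarrow> y \<in> darts_in U" using vertex xy by blast
    finally show ?case using same[OF xy(2)] xy(5) by auto
  qed
  then show ?thesis using d(2) by blast
qed

lemma card_kernel_boundary: "card {U \<in> Pow (faces D). boundary U = {}} \<le> 2 ^ card (graph_components D)"
proof -
  let ?f = "\<lambda>U. (component \<circ> edge) ` darts_in U"
  have "inj_on ?f {U \<in> Pow (faces D). boundary U = {}}"
  proof (rule inj_onI)
    have half: "U \<subseteq> W" if U: "U \<subseteq> faces D" and W: "boundary W = {}"
      and eq: "?f U = ?f W" for U W
    proof
      fix A assume A: "A \<in> U"
      then obtain d where d: "d \<in> darts D" "A = face d" using U by (auto simp: faces_conv)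
      then have "d \<in> darts_in U" using A by (simp add: darts_in_def)
      then have "component (edge d) \<in> ?f W" unfolding eq[symmetric] by simp
      then obtain d' where d': "d' \<in> darts_in W" "component (edge d) = component (edge d')" by auto
      then have "d' \<in> darts D" using darts_in_subset by auto
      then have "d \<in> darts_in W" using boundary_empty_component[OF W d(1)] d' by simp
      then show "A \<in> W" using d by (simp add: darts_in_def)
    qed
    fix U W assume "U \<in> {U \<in> Pow (faces D). boundary U = {}}" "W \<in> {U \<in> Pow (faces D). boundary U = {}}"
      and eq: "?f U = ?f W"
    then have "U \<subseteq> faces D" "boundary U = {}" "W \<subseteq> faces D" "boundary W = {}" by simp_all
    then show "U = W" using half[of U W] half[of W U] eq by (metis subset_antisym)
  qed
  moreover have "?f ` {U \<in> Pow (faces D). boundary U = {}} \<subseteq> Pow (graph_components D)"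
  proof (rule image_subsetI, rule PowI, rule subsetI)
    fix U A assume "A \<in> ?f U"
    then show "A \<in> graph_components D"
      using dart_edge_in_edges by (auto simp: graph_components_conv darts_in_def)
  qed
  moreover have "finite (graph_components D)" by (simp add: graph_components_conv)
  ultimately have "card {U \<in> Pow (faces D). boundary U = {}} \<le> card (Pow (graph_components D))"
    by (intro card_inj_on_le[of ?f]) auto
  also have "\<dots> = 2 ^ card (graph_components D)"
    by (intro card_Pow) (simp add: graph_components_conv)
  finally show ?thesis .
qed

lemma odd_vertices_edge:
  assumes "d \<in> darts D"
  shows "odd_vertices {edge d} = sym_diff {fst d} {fst (opp d)}"
proof -
  have "{x \<in> darts D. edge x \<in> {edge d}} = {d, opp d}" unfolding opp(2)[OF assms, symmetric] by simp
  then have "odd_vertices {edge d} = {y. odd (card {x \<in> {d, opp d}. fst x = y})}"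
    by (simp only: odd_vertices_def odd_fibres_def)
  also have "\<dots> = sym_diff {fst d} {fst (opp d)}"
  proof (rule Set.set_eqI)
    fix y
    have "{x \<in> {d, opp d}. fst x = y}
      = (if fst d = y then {d} else {}) \<union> (if fst (opp d) = y then {opp d} else {})"
      by (simp only: Collect_insert_restrict Collect_empty_restrict) simp
    then show "y \<in> {y. odd (card {x \<in> {d, opp d}. fst x = y})} \<longleftrightarrow> y \<in> sym_diff {fst d} {fst (opp d)}"
      using opp(1)[OF assms] by auto
  qed
  finally show ?thesis .
qed

text \<open>
  The sets of vertices that are boundaries of sets of edges.
\<close>

definition cuts :: "nat set set" where
  "cuts = odd_vertices ` Pow (edges D)"

lemma finite_cuts: "finite cuts"
  by (simp add: cuts_def)

lemma odd_vertices_in_cuts: "X \<subseteq> edges D \<Longrightarrow> odd_vertices X \<in> cuts"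
  by (simp add: cuts_def)

lemma empty_in_cuts: "{} \<in> cuts"
  using odd_vertices_in_cuts[of "{}"] by (simp add: odd_vertices_def odd_fibres_def)

lemma cuts_sym_diff:
  assumes "X \<in> cuts" "Y \<in> cuts"
  shows "sym_diff X Y \<in> cuts"
proof -
  obtain A where A: "A \<in> Pow (edges D)" "X = odd_vertices A"
    using assms(1) unfolding cuts_def by blast
  obtain B where B: "B \<in> Pow (edges D)" "Y = odd_vertices B"
    using assms(2) unfolding cuts_def by blast
  have "sym_diff A B \<subseteq> edges D" using A(1) B(1) by auto
  from odd_vertices_in_cuts[OF this] show ?thesis
    unfolding A(2) B(2) by (simp only: odd_vertices_sym_diff)
qed

definition linked :: "nat \<Rightarrow> nat \<Rightarrow> bool" where
  "linked i j \<longleftrightarrow> sym_diff {i} {j} \<in> cuts"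

lemma linked_trans:
  assumes "linked i j" "linked j k"
  shows "linked i k"
proof -
  have "sym_diff (sym_diff {i} {j}) (sym_diff {j} {k}) = sym_diff {i} {k}" by auto
  then show ?thesis using cuts_sym_diff[OF assms[unfolded linked_def]] by (simp only: linked_def)
qed

lemma linked_edge:
  assumes "d \<in> darts D" "d' \<in> darts D" "edge d = edge d'"
  shows "linked (fst d) (fst d')"
proof (cases "d = d'")
  case True
  then show ?thesis using empty_in_cuts by (simp add: linked_def)
next
  case False
  then have "opp d = d'" using assms by (intro opp_eqI)
  then have "odd_vertices {edge d} = sym_diff {fst d} {fst d'}"
    using odd_vertices_edge[OF assms(1)] by (simp only:)
  moreover have "odd_vertices {edge d} \<in> cuts"
    using dart_edge_in_edges[OF assms(1)] by (intro odd_vertices_in_cuts) simp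
  ultimately show ?thesis by (simp only: linked_def)
qed

lemma linked_component:
  assumes d: "d \<in> darts D" "d' \<in> darts D" and comp: "component (edge d) = component (edge d')"
  shows "linked (fst d) (fst d')"
proof -
  have "(edge d, edge d') \<in> adjacency\<^sup>*"
    using comp by (simp add: generated_class_eq adjacency_sym)
  then have "\<forall>x\<in>darts D. edge x = edge d' \<longrightarrow> linked (fst d) (fst x)"
  proof induction
    case base
    then show ?case using linked_edge[OF d(1)] by auto
  next
    case (step b c)
    obtain x y where xy: "x \<in> darts D" "y \<in> darts D" "fst x = fst y" "edge x = b" "edge y = c"
      using adjacentE[OF step(2)] .
    have "linked (fst d) (fst y)" using step.IH xy by metis
    then show ?case using linked_trans linked_edge[OF xy(2)] xy(5) by metis
  qed
  then show ?thesis using d(2) by blast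
qed

text \<open>
  Modulo \<open>cuts\<close> every vertex can be moved to a chosen vertex of its connected component.
\<close>

lemma card_cuts: "2 ^ length D \<le> 2 ^ card (graph_components D) * card cuts"
proof -
  define K where "K i = component (edge (i, 0))" for i
  define rep where "rep A = (SOME i. i < length D \<and> K i = A)" for A
  define R where "R = rep ` K ` {..<length D}"
  have dart0: "(i, 0) \<in> darts D" if "i < length D" for i
    using that length_ends_pos by (simp add: darts_def)
  have rep: "rep (K i) < length D \<and> K (rep (K i)) = K i" if "i < length D" for i
    using someI[of "\<lambda>j. j < length D \<and> K j = K i" i] that by (simp only: rep_def simp_thms)
  have pair: "linked i (rep (K i))" if "i < length D" for i
  proof -
    have "linked (fst (i, 0::nat)) (fst (rep (K i), 0::nat))"
      using rep[OF that] by (intro linked_component dart0 that) (simp_all only: K_def)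
    then show ?thesis by simp
  qed
  have move: "\<exists>W'\<subseteq>R. sym_diff W W' \<in> cuts" if "finite W" "W \<subseteq> {..<length D}" for W
    using that
  proof (induction W)
    case empty
    show ?case using empty_in_cuts by (intro exI[of _ "{}"]) simp
  next
    case (insert i W)
    have "\<exists>W'\<subseteq>R. sym_diff W W' \<in> cuts" using insert.prems by (intro insert.IH) simp
    then obtain W' where W': "W' \<subseteq> R" "sym_diff W W' \<in> cuts" by (elim exE conjE)
    let ?W = "sym_diff W' {rep (K i)}"
    have i: "i < length D" using insert.prems by simp
    have "sym_diff (sym_diff W W') (sym_diff {i} {rep (K i)}) \<in> cuts"
      using cuts_sym_diff[OF W'(2)] pair[OF i] by (simp only: linked_def)
    moreover have "sym_diff (sym_diff W W') (sym_diff {i} {rep (K i)}) = sym_diff (insert i W) ?W"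
      using insert.hyps(2) by (rule sym_diff_insert)
    ultimately have "sym_diff (insert i W) ?W \<in> cuts" by (simp only:)
    moreover have "rep (K i) \<in> R" using i by (simp add: R_def)
    then have "?W \<subseteq> R" using W'(1) by blast
    ultimately show ?case by (intro exI[of _ ?W] conjI)
  qed
  have "Pow {..<length D} \<subseteq> (\<lambda>(X, Y). sym_diff X Y) ` (Pow R \<times> cuts)"
  proof
    fix W assume "W \<in> Pow {..<length D}"
    then have "finite W" "W \<subseteq> {..<length D}" using finite_subset[of W "{..<length D}"] by auto
    from move[OF this] obtain W' where W': "W' \<subseteq> R" "sym_diff W W' \<in> cuts" by (elim exE conjE)
    have "W = (\<lambda>(X, Y). sym_diff X Y) (W', sym_diff W W')"
      unfolding split_conv by (rule sym_diff_cancel[symmetric])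
    moreover have "(W', sym_diff W W') \<in> Pow R \<times> cuts" using W' by simp
    ultimately show "W \<in> (\<lambda>(X, Y). sym_diff X Y) ` (Pow R \<times> cuts)" by (rule image_eqI)
  qed
  moreover have finR: "finite R" by (simp add: R_def)
  ultimately have "card (Pow {..<length D}) \<le> card (Pow R \<times> cuts)"
    using finite_cuts by (intro surj_card_le) auto
  also have "\<dots> = 2 ^ card R * card cuts"
    using finR by (simp add: card_cartesian_product card_Pow)
  finally have le: "2 ^ length D \<le> 2 ^ card R * card cuts" by (simp add: card_Pow)
  have "K ` {..<length D} \<subseteq> graph_components D"
    using dart0 dart_edge_in_edges by (auto simp: K_def graph_components_conv)
  moreover have "finite (graph_components D)" by (simp add: graph_components_conv)
  ultimately have "card (K ` {..<length D}) \<le> card (graph_components D)" by (intro card_mono)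
  moreover have "card R \<le> card (K ` {..<length D})" unfolding R_def by (intro card_image_le) simp
  ultimately have "card R \<le> card (graph_components D)" by simp
  then have "(2::nat) ^ card R * card cuts \<le> 2 ^ card (graph_components D) * card cuts"
    by (intro mult_right_mono power_increasing) auto
  with le show ?thesis by (rule le_trans)
qed

text \<open>
  The boundaries of sets of faces are among the even sets of edges. By \<open>card_kernel_boundary\<close> there are at least
  \<open>2 ^ (F - C)\<close> of them, and by \<open>card_cuts\<close> at most \<open>2 ^ (E - V + C)\<close> even sets. By Euler's formula these
  numbers agree.
\<close>

theorem even_edge_set_bounds_faces:
  assumes "X \<subseteq> edges D" "odd_vertices X = {}"
  obtains U where "U \<subseteq> faces D" "boundary U = X"
proof -
  have finF: "finite (faces D)" by (simp add: faces_conv)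
  let ?Z = "{X \<in> Pow (edges D). odd_vertices X = {}}"
  let ?B = "boundary ` Pow (faces D)"
  let ?C = "card (graph_components D)"
  have euler: "length D + card (faces D) = card (edges D) + 2 * ?C"
    using link_diagram by (simp add: link_diagram_def)
  have 1: "2 ^ card (faces D) = card {U \<in> Pow (faces D). boundary U = {}} * card ?B"
    by (rule card_kernel_times_image[OF finF]) (rule boundary_sym_diff)
  have 2: "2 ^ card (edges D) = card ?Z * card cuts"
    unfolding cuts_def by (rule card_kernel_times_image) (simp, rule odd_vertices_sym_diff)
  have "card ?Z * 2 ^ ?C * 2 ^ length D \<le> card ?Z * 2 ^ ?C * (2 ^ ?C * card cuts)"
    by (rule mult_left_mono[OF card_cuts]) simp
  also have "\<dots> = (card ?Z * card cuts) * 2 ^ (2 * ?C)"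
    by (simp add: power_mult power2_eq_square mult.commute mult.left_commute)
  also have "\<dots> = 2 ^ length D * 2 ^ card (faces D)"
    unfolding 2[symmetric] power_add[symmetric] euler ..
  also have "\<dots> \<le> 2 ^ length D * (2 ^ ?C * card ?B)"
    unfolding 1 by (rule mult_left_mono[OF mult_right_mono[OF card_kernel_boundary]]) simp_all
  finally have "(2 ^ ?C * 2 ^ length D) * card ?Z \<le> (2 ^ ?C * 2 ^ length D) * card ?B"
    by (simp only: ac_simps)
  then have "card ?Z \<le> card ?B" by (simp only: mult_le_cancel1) simp
  moreover have "?B \<subseteq> ?Z"
  proof
    fix X assume "X \<in> ?B"
    then obtain U where U: "X = boundary U" by blast
    have "boundary U \<subseteq> edge ` darts_in U" unfolding boundary_def by (rule odd_fibres_subset)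
    then have "X \<subseteq> edges D" unfolding U using dart_edge_in_edges by (auto simp: darts_in_def)
    then show "X \<in> ?Z" using odd_vertices_boundary U by simp
  qed
  moreover have "finite ?Z" by simp
  ultimately have "?B = ?Z" by (intro card_seteq)
  moreover have "X \<in> ?Z" using assms by simp
  ultimately have "X \<in> ?B" by (simp only:)
  then obtain U where U: "X = boundary U" "U \<in> Pow (faces D)" by (rule imageE)
  show thesis by (rule that[of U]) (use U in simp_all)
qed

text \<open>
  The colour of an edge outside \<open>X\<close> is that of the faces on both of its sides, which lie on the
  same side of the closed curves formed by \<open>X\<close>. It changes when one crosses these curves, and does
  not change when one turns into a neighbouring edge at a vertex.
\<close>

theorem face_colouring:
  assumes crossing: "\<And>a b c d. Crossing a b c d \<in> set D \<Longrightarrow> (a \<in> X \<longleftrightarrow> b \<in> X) \<longleftrightarrow> (c \<in> X \<longleftrightarrow> d \<in> X)"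
    and point: "\<And>a b. Point a b \<in> set D \<Longrightarrow> a \<in> X \<longleftrightarrow> b \<in> X"
  obtains col :: "nat \<Rightarrow> bool" where
    "\<And>a b c d. Crossing a b c d \<in> set D \<Longrightarrow> a \<notin> X \<Longrightarrow> c \<notin> X \<Longrightarrow> b \<in> X \<Longrightarrow> d \<in> X \<Longrightarrow> col a \<noteq> col c"
    "\<And>a b c d. Crossing a b c d \<in> set D \<Longrightarrow> a \<notin> X \<Longrightarrow> b \<notin> X \<Longrightarrow> col a = col b"
    "\<And>a b c d. Crossing a b c d \<in> set D \<Longrightarrow> b \<notin> X \<Longrightarrow> c \<notin> X \<Longrightarrow> col b = col c"
    "\<And>a b c d. Crossing a b c d \<in> set D \<Longrightarrow> c \<notin> X \<Longrightarrow> d \<notin> X \<Longrightarrow> col c = col d"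
    "\<And>a b c d. Crossing a b c d \<in> set D \<Longrightarrow> d \<notin> X \<Longrightarrow> a \<notin> X \<Longrightarrow> col d = col a"
    "\<And>a b. Point a b \<in> set D \<Longrightarrow> a \<notin> X \<Longrightarrow> b \<notin> X \<Longrightarrow> col a = col b"
proof -
  have "even (card {d \<in> darts D. edge d \<in> X \<inter> edges D \<and> fst d = i})" for i
  proof (cases "i < length D")
    case True
    have "{d \<in> darts D. edge d \<in> X \<inter> edges D \<and> fst d = i} = {d \<in> darts D. edge d \<in> X \<and> fst d = i}"
      using dart_edge_in_edges[of _ D] by (intro Collect_cong) blast
    also have "\<dots> = Pair i ` {k. k < length (ends (D ! i)) \<and> ends (D ! i) ! k \<in> X}"
      using True by (auto simp: darts_def dart_edge_def)
    also have "card \<dots> = card {k. k < length (ends (D ! i)) \<and> ends (D ! i) ! k \<in> X}"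
      by (intro card_image inj_onI) simp
    also have "\<dots> = length (filter (\<lambda>a. a \<in> X) (ends (D ! i)))"
      by (simp only: length_filter_conv_card)
    finally have "card {d \<in> darts D. edge d \<in> X \<inter> edges D \<and> fst d = i}
      = length (filter (\<lambda>a. a \<in> X) (ends (D ! i)))" .
    moreover have "even (length (filter (\<lambda>a. a \<in> X) (ends (D ! i))))"
    proof (cases "D ! i")
      case (Crossing a b c d)
      then have "(a \<in> X \<longleftrightarrow> b \<in> X) \<longleftrightarrow> (c \<in> X \<longleftrightarrow> d \<in> X)"
        using crossing[of a b c d] nth_mem[OF True] by simp
      then show ?thesis unfolding Crossing
        by (cases "a \<in> X"; cases "b \<in> X"; cases "c \<in> X"; cases "d \<in> X") simp_all
    next
      case (Point a b)
      then have "a \<in> X \<longleftrightarrow> b \<in> X" using point[of a b] nth_mem[OF True] by simp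
      then show ?thesis unfolding Point by simp
    qed
    ultimately show ?thesis by (simp only:)
  next
    case False
    then have "{d \<in> darts D. edge d \<in> X \<inter> edges D \<and> fst d = i} = {}" by (auto simp: darts_def)
    then show ?thesis by (simp only: card.empty even_zero)
  qed
  then have "odd_vertices (X \<inter> edges D) = {}"
    unfolding odd_vertices_def odd_fibres_def by (simp add: conj_assoc)
  then obtain U where U: "U \<subseteq> faces D" "boundary U = X \<inter> edges D"
    using even_edge_set_bounds_faces[of "X \<inter> edges D"] by auto
  have opp: "opp d \<in> darts_in U \<longleftrightarrow> d \<in> darts_in U" if "d \<in> darts D" "edge d \<notin> X" for d
    using edge_in_boundary[OF that(1)] that(2) U(2) by auto
  have rot: "rot d \<in> darts_in U \<longleftrightarrow> (d \<in> darts_in U) \<noteq> (edge d \<in> X)" if "d \<in> darts D" for d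
    using rot_in_faces[OF that] edge_in_boundary[OF that] U(2) dart_edge_in_edges[OF that] by auto
  define col where "col a \<longleftrightarrow> (\<exists>d\<in>darts D. edge d = a \<and> d \<in> darts_in U)" for a
  have col: "col (edge d) \<longleftrightarrow> d \<in> darts_in U" if "d \<in> darts D" "edge d \<notin> X" for d
  proof
    assume "col (edge d)"
    then obtain d' where d': "d' \<in> darts D" "edge d' = edge d" "d' \<in> darts_in U"
      unfolding col_def by (elim bexE conjE)
    show "d \<in> darts_in U"
    proof (cases "d = d'")
      case False
      then have "opp d = d'" using that(1) d' by (intro opp_eqI) simp_all
      then show ?thesis using opp[OF that] d'(3) by simp
    qed (use d' in simp)
  qed (use that(1) in \<open>auto simp: col_def\<close>)
  have vertex: "col (ends (D ! i) ! k) \<longleftrightarrow> (i, k) \<in> darts_in U"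
    if "i < length D" "k < length (ends (D ! i))" "ends (D ! i) ! k \<notin> X" for i k
    using col[of "(i, k)"] that by (simp add: darts_def dart_edge_def)
  have turn: "(i, Suc k mod length (ends (D ! i))) \<in> darts_in U \<longleftrightarrow> ((i, k) \<in> darts_in U) \<noteq> (ends (D ! i) ! k \<in> X)"
    if "i < length D" "k < length (ends (D ! i))" for i k
    using rot[of "(i, k)"] that by (simp add: darts_def dart_edge_def next_dart_def)
  show thesis
  proof (rule that[of col])
    fix a b c d assume "Crossing a b c d \<in> set D"
    then obtain i where i: "i < length D" "D ! i = Crossing a b c d" by (auto simp: in_set_conv_nth)
    have e: "ends (D ! i) ! 0 = a" "ends (D ! i) ! 1 = b" "ends (D ! i) ! 2 = c" "ends (D ! i) ! 3 = d"
      and len: "length (ends (D ! i)) = 4"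
      by (simp_all add: i(2))
    have lt: "(0::nat) < 4" "(1::nat) < 4" "(2::nat) < 4" "(3::nat) < 4"
      and m: "Suc 0 mod 4 = 1" "Suc 1 mod 4 = 2" "Suc 2 mod 4 = 3" "Suc 3 mod 4 = 0"
      by simp_all
    note v = vertex[OF i(1), unfolded len, OF lt(1), unfolded e] vertex[OF i(1), unfolded len, OF lt(2), unfolded e]
      vertex[OF i(1), unfolded len, OF lt(3), unfolded e] vertex[OF i(1), unfolded len, OF lt(4), unfolded e]
    note t = turn[OF i(1), unfolded len, OF lt(1), unfolded e m] turn[OF i(1), unfolded len, OF lt(2), unfolded e m]
      turn[OF i(1), unfolded len, OF lt(3), unfolded e m] turn[OF i(1), unfolded len, OF lt(4), unfolded e m]
    show "col a \<noteq> col c" if "a \<notin> X" "c \<notin> X" "b \<in> X" "d \<in> X"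
      unfolding v(1)[OF that(1)] v(3)[OF that(2)] t(2) t(1) using that by simp
    show "col a = col b" if "a \<notin> X" "b \<notin> X"
      unfolding v(1)[OF that(1)] v(2)[OF that(2)] t(1) using that by simp
    show "col b = col c" if "b \<notin> X" "c \<notin> X"
      unfolding v(2)[OF that(1)] v(3)[OF that(2)] t(2) using that by simp
    show "col c = col d" if "c \<notin> X" "d \<notin> X"
      unfolding v(3)[OF that(1)] v(4)[OF that(2)] t(3) using that by simp
    show "col d = col a" if "d \<notin> X" "a \<notin> X"
      unfolding v(4)[OF that(1)] v(1)[OF that(2)] t(4) using that by simp
  next
    fix a b assume "Point a b \<in> set D"
    then obtain i where i: "i < length D" "D ! i = Point a b" by (auto simp: in_set_conv_nth)
    show "a \<notin> X \<Longrightarrow> b \<notin> X \<Longrightarrow> col a = col b"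
      using vertex[OF i(1), of 0] vertex[OF i(1), of 1] turn[OF i(1), of 0] by (simp add: i(2))
  qed
qed

end

section \<open>Two circles with marked points\<close>

text \<open>
  Two maps with the same fibres have images of the same size.
\<close>

lemma card_image_eq_fibres:
  assumes eq: "\<And>x y. x \<in> A \<Longrightarrow> y \<in> A \<Longrightarrow> g x = g y \<longleftrightarrow> f x = f y"
  shows "card (g ` A) = card (f ` A)"
proof -
  define h where "h K = f (inv_into A g K)" for K
  have h: "h (g x) = f x" if "x \<in> A" for x
  proof -
    have "inv_into A g (g x) \<in> A" "g (inv_into A g (g x)) = g x"
      using that by (simp_all add: inv_into_into f_inv_into_f)
    then show ?thesis using eq[OF _ that, of "inv_into A g (g x)"] by (simp add: h_def)
  qed
  have "inj_on h (g ` A)"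
  proof (rule inj_onI, elim imageE)
    fix K L x y assume "h K = h L" "K = g x" "x \<in> A" "L = g y" "y \<in> A"
    then show "K = L" using h[of x] h[of y] eq[of x y] by simp
  qed
  moreover have "h ` g ` A = f ` A" unfolding image_image by (intro image_cong refl h)
  ultimately show ?thesis using card_image[of h "g ` A"] by simp
qed

lemma generated_classes_fibres:
  assumes "\<And>x y. (x, y) \<in> r \<Longrightarrow> f x = f y"
    and "\<And>x y. x \<in> A \<Longrightarrow> y \<in> A \<Longrightarrow> f x = f y \<Longrightarrow> x = y \<or> (x, y) \<in> r \<or> (y, x) \<in> r"
  shows "card (generated_classes A r) = card (f ` A)"
proof -
  have respects: "f y = f z" if "(y, z) \<in> r \<union> r\<inverse>" for y z
  proof (cases "(y, z) \<in> r")
    case True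
    then show ?thesis by (rule assms(1))
  next
    case False
    then have "(z, y) \<in> r" using that by simp
    from assms(1)[OF this] show ?thesis by (rule sym)
  qed
  have forward: "f x = f y" if "(x, y) \<in> (r \<union> r\<inverse>)\<^sup>*" for x y
    using that
  proof induction
    case (step y z)
    from step.IH respects[OF step.hyps(2)] show ?case by (rule trans)
  qed simp
  have eq: "generated_class r x = generated_class r y \<longleftrightarrow> f x = f y" if xy: "x \<in> A" "y \<in> A" for x y
  proof
    assume "generated_class r x = generated_class r y"
    then show "f x = f y" unfolding generated_class_eq by (rule forward)
  next
    assume "f x = f y"
    from assms(2)[OF xy this] show "generated_class r x = generated_class r y"
      unfolding generated_class_eq by (elim disjE) (simp_all add: r_into_rtrancl)
  qed
  show ?thesis unfolding generated_classes_conv by (rule card_image_eq_fibres[OF eq])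
qed

text \<open>
  Diagrams without crossings: \<open>f\<close> tells the faces apart and \<open>g\<close> the connected components, so that
  Euler's formula can be checked. From the dart \<open>(i, k)\<close> the boundary of a face goes along its edge to the
  dart \<open>(j, 1 - l)\<close> at the other end, and on to the other dart \<open>(j, l)\<close> of that point.
\<close>

lemma link_diagram_by_fibres:
  assumes points: "\<And>i. i < length D \<Longrightarrow> length (ends (D ! i)) = 2"
    and count: "\<And>e. e \<in> edges D \<Longrightarrow> count_list (edge_ends D) e = 2"
    and face: "\<And>i k j l. i < length D \<Longrightarrow> k < 2 \<Longrightarrow> j < length D \<Longrightarrow> l < 2 \<Longrightarrow>
      f (i, k) = f (j, l) \<longleftrightarrow> (i, k) = (j, l) \<or>
        (i, k) \<noteq> (j, 1 - l) \<and> ends (D ! i) ! k = ends (D ! j) ! (1 - l)"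
    and comp: "\<And>x y. x \<in> edges D \<Longrightarrow> y \<in> edges D \<Longrightarrow> g x = g y \<longleftrightarrow> (\<exists>v\<in>set D. x \<in> set (ends v) \<and> y \<in> set (ends v))"
    and euler: "length D + card (f ` darts D) = card (edges D) + 2 * card (g ` edges D)"
  shows "link_diagram D"
proof -
  have darts: "(i, k) \<in> darts D \<longleftrightarrow> i < length D \<and> k < 2" for i k
    using points[of i] by (auto simp: darts_def)
  have flip: "m < 2 \<Longrightarrow> l = Suc m mod 2 \<longleftrightarrow> l < 2 \<and> m = 1 - l" for m l :: nat
    by (cases "m = 0") (auto simp: less_2_cases_iff)
  have step: "((i, k), (j, l)) \<in> face_step D \<longleftrightarrow> i < length D \<and> k < 2 \<and> j < length D \<and> l < 2 \<and>
      (i, k) \<noteq> (j, 1 - l) \<and> ends (D ! i) ! k = ends (D ! j) ! (1 - l)" for i k j l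
  proof -
    have "((i, k), (j, l)) \<in> face_step D \<longleftrightarrow> (i, k) \<in> darts D \<and>
      (\<exists>m. (j, m) \<in> darts D \<and> (i, k) \<noteq> (j, m) \<and> ends (D ! i) ! k = ends (D ! j) ! m \<and>
         l = Suc m mod length (ends (D ! j)))"
      unfolding face_step_def by auto
    also have "\<dots> \<longleftrightarrow> i < length D \<and> k < 2 \<and>
      (\<exists>m. j < length D \<and> m < 2 \<and> (i, k) \<noteq> (j, m) \<and> ends (D ! i) ! k = ends (D ! j) ! m \<and>
         l < 2 \<and> m = 1 - l)"
      unfolding darts using points[of j] flip[of _ l] by (simp cong: conj_cong)
    also have "\<dots> \<longleftrightarrow> i < length D \<and> k < 2 \<and> j < length D \<and> l < 2 \<and>
      (i, k) \<noteq> (j, 1 - l) \<and> ends (D ! i) ! k = ends (D ! j) ! (1 - l)"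
      by (auto simp: less_2_cases_iff)
    finally show ?thesis .
  qed
  have "card (faces D) = card (f ` darts D)" unfolding faces_def
  proof (rule generated_classes_fibres)
    fix x y assume xy: "(x, y) \<in> face_step D"
    obtain i k j l where ij: "x = (i, k)" "y = (j, l)" by (cases x, cases y)
    show "f x = f y" using xy face[of i k j l] unfolding ij step by blast
  next
    fix x y assume xy: "x \<in> darts D" "y \<in> darts D" "f x = f y"
    obtain i k j l where ij: "x = (i, k)" "y = (j, l)" by (cases x, cases y)
    have *: "i < length D" "k < 2" "j < length D" "l < 2"
      using xy(1,2) unfolding ij darts by simp_all
    have "(i, k) = (j, l) \<or> (i, k) \<noteq> (j, 1 - l) \<and> ends (D ! i) ! k = ends (D ! j) ! (1 - l)"
      using xy(3) unfolding ij by (rule iffD1[OF face[OF *]])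
    then show "x = y \<or> (x, y) \<in> face_step D \<or> (y, x) \<in> face_step D"
      using * unfolding ij step by blast
  qed
  moreover have "card (graph_components D) = card (g ` edges D)" unfolding graph_components_def
  proof (rule generated_classes_fibres)
    fix x y assume "(x, y) \<in> {(a, b). \<exists>v\<in>set D. a \<in> set (ends v) \<and> b \<in> set (ends v)}"
    then have *: "\<exists>v\<in>set D. x \<in> set (ends v) \<and> y \<in> set (ends v)" by simp
    then have "x \<in> edges D" "y \<in> edges D" by (auto simp: edges_conv)
    from comp[OF this] * show "g x = g y" by simp
  next
    fix x y assume xy: "x \<in> edges D" "y \<in> edges D" "g x = g y"
    from comp[OF xy(1,2)] xy(3) have "\<exists>v\<in>set D. x \<in> set (ends v) \<and> y \<in> set (ends v)" by simp
    then show "x = y \<or> (x, y) \<in> {(a, b). \<exists>v\<in>set D. a \<in> set (ends v) \<and> b \<in> set (ends v)} \<or>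
        (y, x) \<in> {(a, b). \<exists>v\<in>set D. a \<in> set (ends v) \<and> b \<in> set (ends v)}"
      by simp
  qed
  ultimately show ?thesis using count euler unfolding link_diagram_def by simp
qed

lemma link_diagram_circles_2_2:
  assumes ne: "a \<noteq> b" "a \<noteq> c" "a \<noteq> d" "b \<noteq> c" "b \<noteq> d" "c \<noteq> d"
    and qs: "q = Point a b \<or> q = Point b a" "s = Point c d \<or> s = Point d c"
  shows "link_diagram [Point a b, q, Point c d, s]"
proof -
  let ?D = "[Point a b, q, Point c d, s]"
  define f where "f d' = (fst d' < 2, (ends (?D ! fst d') ! snd d' \<in> {a, c}) = even (fst d'))" for d'
  define g where "g x = (x \<in> {a, b})" for x
  note ne' = ne ne[symmetric]
  have edges: "edges ?D = {a, b, c, d}" using qs by auto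
  have len: "length (ends (?D ! i)) = 2" if "i < length ?D" for i
  proof -
    have "i = 0 \<or> i = 1 \<or> i = 2 \<or> i = 3" using that by auto
    then show ?thesis using qs by (elim disjE) simp_all
  qed
  have darts: "darts ?D = {0, 1, 2, 3} \<times> {0, 1}"
  proof -
    have "darts ?D = {..<4} \<times> {..<2}" using len by (auto simp: darts_def)
    also have "{..<4::nat} = {0, 1, 2, 3}" by auto
    also have "{..<2::nat} = {0, 1}" by auto
    finally show ?thesis .
  qed
  show ?thesis
  proof (rule link_diagram_by_fibres[where f = f and g = g])
    show "count_list (edge_ends ?D) e = 2" if "e \<in> edges ?D" for e
    proof -
      have e: "e = a \<or> e = b \<or> e = c \<or> e = d" using that unfolding edges by simp
      have "count_list (ends q) e = of_bool (e = a \<or> e = b)" "count_list (ends s) e = of_bool (e = c \<or> e = d)"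
        using qs e by (elim disjE; simp add: ne')+
      then show ?thesis using e by (elim disjE) (simp_all add: edge_ends_def ne')
    qed
    show "f (i, k) = f (j, l) \<longleftrightarrow> (i, k) = (j, l) \<or>
        (i, k) \<noteq> (j, 1 - l) \<and> ends (?D ! i) ! k = ends (?D ! j) ! (1 - l)"
      if "i < length ?D" "k < 2" "j < length ?D" "l < 2" for i k j l
    proof -
      have "i = 0 \<or> i = 1 \<or> i = 2 \<or> i = 3" "j = 0 \<or> j = 1 \<or> j = 2 \<or> j = 3"
        "k = 0 \<or> k = 1" "l = 0 \<or> l = 1" using that by auto
      then show ?thesis using qs by (elim disjE) (simp_all add: f_def ne')
    qed
    show "g x = g y \<longleftrightarrow> (\<exists>v\<in>set ?D. x \<in> set (ends v) \<and> y \<in> set (ends v))"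
      if "x \<in> edges ?D" "y \<in> edges ?D" for x y
    proof -
      have "set (ends q) = {a, b}" "set (ends s) = {c, d}" using qs by auto
      then have "(\<exists>v\<in>set ?D. x \<in> set (ends v) \<and> y \<in> set (ends v)) \<longleftrightarrow>
          x \<in> {a, b} \<and> y \<in> {a, b} \<or> x \<in> {c, d} \<and> y \<in> {c, d}" by simp
      then show ?thesis using that unfolding edges g_def by (elim insertE emptyE) (simp_all add: ne')
    qed
    have vals: "f (0, 0) = (True, True)" "f (0, 1) = (True, False)" "f (2, 0) = (False, True)" "f (2, 1) = (False, False)"
      by (simp_all add: f_def ne')
    have "f (0, 0) \<in> f ` darts ?D" "f (0, 1) \<in> f ` darts ?D" "f (2, 0) \<in> f ` darts ?D" "f (2, 1) \<in> f ` darts ?D"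
      unfolding darts by (rule imageI, simp)+
    then have "{(True, True), (True, False), (False, True), (False, False)} \<subseteq> f ` darts ?D"
      unfolding vals by (simp only: insert_subset empty_subsetI simp_thms)
    moreover have all: "p \<in> {(True, True), (True, False), (False, True), (False, False)}" for p :: "bool \<times> bool"
      by (cases p) auto
    have "f ` darts ?D \<subseteq> {(True, True), (True, False), (False, True), (False, False)}"
      by (rule subsetI) (rule all)
    ultimately have fd: "f ` darts ?D = {(True, True), (True, False), (False, True), (False, False)}"
      by (intro subset_antisym)
    have gd: "g ` edges ?D = {True, False}"
    proof -
      have "g a = True" "g b = True" "g c = False" "g d = False" by (simp_all add: g_def ne')
      then show ?thesis unfolding edges by (simp only: image_insert image_empty) blast
    qed
    have c1: "card (f ` darts ?D) = 4" unfolding fd by simp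
    have c2: "card (g ` edges ?D) = 2" unfolding gd by simp
    have c3: "card (edges ?D) = 4" unfolding edges using ne' by simp
    show "length ?D + card (f ` darts ?D) = card (edges ?D) + 2 * card (g ` edges ?D)"
      unfolding c1 c2 c3 by simp
  qed (rule len)
qed

lemma link_diagram_circles_1_2:
  assumes ne: "a \<noteq> c" "a \<noteq> d" "c \<noteq> d" and s: "s = Point c d \<or> s = Point d c"
  shows "link_diagram [Point a a, Point c d, s]"
proof -
  let ?D = "[Point a a, Point c d, s]"
  define f where "f d' = (fst d' = 0, if fst d' = 0 then snd d' = 0 else (ends (?D ! fst d') ! snd d' = c) = (fst d' = 1))" for d'
  define g where "g x = (x = a)" for x
  note ne' = ne ne[symmetric]
  have edges: "edges ?D = {a, c, d}" using s by auto
  have len: "length (ends (?D ! i)) = 2" if "i < length ?D" for i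
  proof -
    have "i = 0 \<or> i = 1 \<or> i = 2" using that by auto
    then show ?thesis using s by (elim disjE) simp_all
  qed
  have darts: "darts ?D = {0, 1, 2} \<times> {0, 1}"
  proof -
    have "darts ?D = {..<3} \<times> {..<2}" using len by (auto simp: darts_def)
    also have "{..<3::nat} = {0, 1, 2}" by auto
    also have "{..<2::nat} = {0, 1}" by auto
    finally show ?thesis .
  qed
  show ?thesis
  proof (rule link_diagram_by_fibres[where f = f and g = g])
    show "count_list (edge_ends ?D) e = 2" if "e \<in> edges ?D" for e
      using that s ne' unfolding edges by (elim insertE emptyE disjE) (simp_all add: edge_ends_def)
    show "f (i, k) = f (j, l) \<longleftrightarrow> (i, k) = (j, l) \<or>
        (i, k) \<noteq> (j, 1 - l) \<and> ends (?D ! i) ! k = ends (?D ! j) ! (1 - l)"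
      if "i < length ?D" "k < 2" "j < length ?D" "l < 2" for i k j l
    proof -
      have "i = 0 \<or> i = 1 \<or> i = 2" "j = 0 \<or> j = 1 \<or> j = 2"
        "k = 0 \<or> k = 1" "l = 0 \<or> l = 1" using that by auto
      then show ?thesis using s by (elim disjE) (simp_all add: f_def ne')
    qed
    show "g x = g y \<longleftrightarrow> (\<exists>v\<in>set ?D. x \<in> set (ends v) \<and> y \<in> set (ends v))"
      if "x \<in> edges ?D" "y \<in> edges ?D" for x y
    proof -
      have "set (ends s) = {c, d}" using s by auto
      then have "(\<exists>v\<in>set ?D. x \<in> set (ends v) \<and> y \<in> set (ends v)) \<longleftrightarrow>
          x \<in> {a} \<and> y \<in> {a} \<or> x \<in> {c, d} \<and> y \<in> {c, d}" by auto
      then show ?thesis using that unfolding edges g_def by (elim insertE emptyE) (simp_all add: ne')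
    qed
    have vals: "f (0, 0) = (True, True)" "f (0, 1) = (True, False)" "f (1, 0) = (False, True)" "f (1, 1) = (False, False)"
      by (simp_all add: f_def ne')
    have "f (0, 0) \<in> f ` darts ?D" "f (0, 1) \<in> f ` darts ?D" "f (1, 0) \<in> f ` darts ?D" "f (1, 1) \<in> f ` darts ?D"
      unfolding darts by (rule imageI, simp)+
    then have "{(True, True), (True, False), (False, True), (False, False)} \<subseteq> f ` darts ?D"
      unfolding vals by (simp only: insert_subset empty_subsetI simp_thms)
    moreover have all: "p \<in> {(True, True), (True, False), (False, True), (False, False)}" for p :: "bool \<times> bool"
      by (cases p) auto
    have "f ` darts ?D \<subseteq> {(True, True), (True, False), (False, True), (False, False)}"
      by (rule subsetI) (rule all)
    ultimately have fd: "f ` darts ?D = {(True, True), (True, False), (False, True), (False, False)}"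
      by (intro subset_antisym)
    have gd: "g ` edges ?D = {True, False}"
    proof -
      have "g a = True" "g c = False" "g d = False" by (simp_all add: g_def ne')
      then show ?thesis unfolding edges by (simp only: image_insert image_empty) blast
    qed
    have c1: "card (f ` darts ?D) = 4" unfolding fd by simp
    have c2: "card (g ` edges ?D) = 2" unfolding gd by simp
    have c3: "card (edges ?D) = 3" unfolding edges using ne' by simp
    show "length ?D + card (f ` darts ?D) = card (edges ?D) + 2 * card (g ` edges ?D)"
      unfolding c1 c2 c3 by simp
  qed (rule len)
qed

lemma link_diagram_circles_2_1:
  assumes ne: "a \<noteq> c" "a \<noteq> d" "c \<noteq> d" and s: "s = Point c d \<or> s = Point d c"
  shows "link_diagram [Point c d, s, Point a a]"
proof -
  let ?D = "[Point c d, s, Point a a]"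
  define f where "f d' = (fst d' = 2, if fst d' = 2 then snd d' = 0 else (ends (?D ! fst d') ! snd d' = c) = (fst d' = 0))" for d'
  define g where "g x = (x = a)" for x
  note ne' = ne ne[symmetric]
  have edges: "edges ?D = {a, c, d}" using s by auto
  have len: "length (ends (?D ! i)) = 2" if "i < length ?D" for i
  proof -
    have "i = 0 \<or> i = 1 \<or> i = 2" using that by auto
    then show ?thesis using s by (elim disjE) simp_all
  qed
  have darts: "darts ?D = {0, 1, 2} \<times> {0, 1}"
  proof -
    have "darts ?D = {..<3} \<times> {..<2}" using len by (auto simp: darts_def)
    also have "{..<3::nat} = {0, 1, 2}" by auto
    also have "{..<2::nat} = {0, 1}" by auto
    finally show ?thesis .
  qed
  show ?thesis
  proof (rule link_diagram_by_fibres[where f = f and g = g])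
    show "count_list (edge_ends ?D) e = 2" if "e \<in> edges ?D" for e
      using that s ne' unfolding edges by (elim insertE emptyE disjE) (simp_all add: edge_ends_def)
    show "f (i, k) = f (j, l) \<longleftrightarrow> (i, k) = (j, l) \<or>
        (i, k) \<noteq> (j, 1 - l) \<and> ends (?D ! i) ! k = ends (?D ! j) ! (1 - l)"
      if "i < length ?D" "k < 2" "j < length ?D" "l < 2" for i k j l
    proof -
      have "i = 0 \<or> i = 1 \<or> i = 2" "j = 0 \<or> j = 1 \<or> j = 2"
        "k = 0 \<or> k = 1" "l = 0 \<or> l = 1" using that by auto
      then show ?thesis using s by (elim disjE) (simp_all add: f_def ne')
    qed
    show "g x = g y \<longleftrightarrow> (\<exists>v\<in>set ?D. x \<in> set (ends v) \<and> y \<in> set (ends v))"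
      if "x \<in> edges ?D" "y \<in> edges ?D" for x y
    proof -
      have "set (ends s) = {c, d}" using s by auto
      then have "(\<exists>v\<in>set ?D. x \<in> set (ends v) \<and> y \<in> set (ends v)) \<longleftrightarrow>
          x \<in> {a} \<and> y \<in> {a} \<or> x \<in> {c, d} \<and> y \<in> {c, d}" by auto
      then show ?thesis using that unfolding edges g_def by (elim insertE emptyE) (simp_all add: ne')
    qed
    have vals: "f (2, 0) = (True, True)" "f (2, 1) = (True, False)" "f (0, 0) = (False, True)" "f (0, 1) = (False, False)"
      by (simp_all add: f_def ne')
    have "f (2, 0) \<in> f ` darts ?D" "f (2, 1) \<in> f ` darts ?D" "f (0, 0) \<in> f ` darts ?D" "f (0, 1) \<in> f ` darts ?D"
      unfolding darts by (rule imageI, simp)+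
    then have "{(True, True), (True, False), (False, True), (False, False)} \<subseteq> f ` darts ?D"
      unfolding vals by (simp only: insert_subset empty_subsetI simp_thms)
    moreover have all: "p \<in> {(True, True), (True, False), (False, True), (False, False)}" for p :: "bool \<times> bool"
      by (cases p) auto
    have "f ` darts ?D \<subseteq> {(True, True), (True, False), (False, True), (False, False)}"
      by (rule subsetI) (rule all)
    ultimately have fd: "f ` darts ?D = {(True, True), (True, False), (False, True), (False, False)}"
      by (intro subset_antisym)
    have gd: "g ` edges ?D = {True, False}"
    proof -
      have "g a = True" "g c = False" "g d = False" by (simp_all add: g_def ne')
      then show ?thesis unfolding edges by (simp only: image_insert image_empty) blast
    qed
    have c1: "card (f ` darts ?D) = 4" unfolding fd by simp
    have c2: "card (g ` edges ?D) = 2" unfolding gd by simp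
    have c3: "card (edges ?D) = 3" unfolding edges using ne' by simp
    show "length ?D + card (f ` darts ?D) = card (edges ?D) + 2 * card (g ` edges ?D)"
      unfolding c1 c2 c3 by simp
  qed (rule len)
qed

lemma link_diagram_circles_1_1:
  assumes ne: "a \<noteq> c"
  shows "link_diagram [Point c c, Point a a]"
proof -
  let ?D = "[Point c c, Point a a]"
  define f :: "nat \<times> nat \<Rightarrow> nat \<times> nat" where "f = id"
  define g where "g x = (x = a)" for x
  note ne' = ne ne[symmetric]
  have edges: "edges ?D = {a, c}" by auto
  have len: "length (ends (?D ! i)) = 2" if "i < length ?D" for i
  proof -
    have "i = 0 \<or> i = 1" using that by auto
    then show ?thesis by (elim disjE) simp_all
  qed
  have darts: "darts ?D = {..<2} \<times> {..<2}" using len by (auto simp: darts_def)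
  show ?thesis
  proof (rule link_diagram_by_fibres[where f = f and g = g])
    show "count_list (edge_ends ?D) e = 2" if "e \<in> edges ?D" for e
      using that ne' unfolding edges by (elim insertE emptyE disjE) (simp_all add: edge_ends_def)
    show "f (i, k) = f (j, l) \<longleftrightarrow> (i, k) = (j, l) \<or>
        (i, k) \<noteq> (j, 1 - l) \<and> ends (?D ! i) ! k = ends (?D ! j) ! (1 - l)"
      if "i < length ?D" "k < 2" "j < length ?D" "l < 2" for i k j l
    proof -
      have "i = 0 \<or> i = 1" "j = 0 \<or> j = 1" "k = 0 \<or> k = 1" "l = 0 \<or> l = 1" using that by auto
      then show ?thesis by (elim disjE) (simp_all add: f_def ne')
    qed
    show "g x = g y \<longleftrightarrow> (\<exists>v\<in>set ?D. x \<in> set (ends v) \<and> y \<in> set (ends v))"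
      if "x \<in> edges ?D" "y \<in> edges ?D" for x y
      using that unfolding edges by (elim insertE emptyE) (simp_all add: g_def ne')
    have c1: "card (f ` darts ?D) = 4" unfolding darts by (simp add: f_def)
    have gd: "g ` edges ?D = {True, False}"
    proof -
      have "g a = True" "g c = False" by (simp_all add: g_def ne')
      then show ?thesis unfolding edges by (simp only: image_insert image_empty)
    qed
    have c2: "card (g ` edges ?D) = 2" unfolding gd by simp
    have c3: "card (edges ?D) = 2" unfolding edges using ne' by simp
    show "length ?D + card (f ` darts ?D) = card (edges ?D) + 2 * card (g ` edges ?D)"
      unfolding c1 c2 c3 by simp
  qed (rule len)
qed

lemma same_link_move: "link_diagram D \<Longrightarrow> link_diagram E \<Longrightarrow> move D E \<Longrightarrow> same_link D E"
  unfolding same_link_def by (rule r_into_equivclp) simp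

lemma same_link_trans: "same_link D E \<Longrightarrow> same_link E F \<Longrightarrow> same_link D F"
  unfolding same_link_def by (rule equivclp_trans)

text \<open>
  One point is removed from each circle. The orientations of \<open>q\<close> and \<open>s\<close> do not matter, since both
  become a point with twice the same edge.
\<close>

lemma two_circles_trivial:
  assumes ne: "a \<noteq> b" "a \<noteq> c" "a \<noteq> d" "b \<noteq> c" "b \<noteq> d" "c \<noteq> d"
    and qs: "q = Point a b \<or> q = Point b a" "s = Point c d \<or> s = Point d c"
    and S: "link_diagram S" "mset S = {#Point a b, q, Point c d, s#}"
  shows "same_link S [Point 0 0, Point 1 1]"
proof -
  note ne' = ne ne[symmetric]
  let ?S1 = "[Point a b, q, Point c d, s]" and ?S2 = "[Point a a, Point c d, s]"
  let ?S3 = "[Point c d, s, Point a a]" and ?S4 = "[Point c c, Point a a]"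
  have "(1::nat) \<noteq> 0" by simp
  note l = link_diagram_circles_2_2[OF ne qs] link_diagram_circles_1_2[OF ne(2,3,6) qs(2)]
    link_diagram_circles_2_1[OF ne(2,3,6) qs(2)] link_diagram_circles_1_1[OF ne(2)]
    link_diagram_circles_1_1[OF this]
  have "move S ?S1" by (rule move.reorder) (simp add: S(2))
  then have 1: "same_link S ?S1" by (rule same_link_move[OF S(1) l(1)])
  have "map (relabel (id(b := a))) [q, Point c d, s] = ?S2"
    using qs by (elim disjE) (simp_all add: ne')
  then have "move ?S1 ?S2" using move.remove_point[OF ne(1), of "[q, Point c d, s]"] by (simp only:)
  then have 2: "same_link ?S1 ?S2" by (rule same_link_move[OF l(1,2)])
  have "move ?S2 ?S3" by (rule move.reorder) simp
  then have 3: "same_link ?S2 ?S3" by (rule same_link_move[OF l(2,3)])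
  have "map (relabel (id(d := c))) [s, Point a a] = ?S4"
    using qs(2) by (elim disjE) (simp_all add: ne')
  then have "move ?S3 ?S4" using move.remove_point[OF ne(6), of "[s, Point a a]"] by (simp only:)
  then have 4: "same_link ?S3 ?S4" by (rule same_link_move[OF l(3,4)])
  let ?f = "\<lambda>x. if x = c then 0 else 1 :: nat"
  have "move ?S4 (map (relabel ?f) ?S4)" by (rule move.rename) (simp add: ne')
  also have "map (relabel ?f) ?S4 = [Point 0 0, Point 1 1]" by (simp add: ne')
  finally have 5: "same_link ?S4 [Point 0 0, Point 1 1]" by (rule same_link_move[OF l(4,5)])
  show ?thesis
    by (rule same_link_trans[OF 1 same_link_trans[OF 2 same_link_trans[OF 3 same_link_trans[OF 4 5]]]])
qed

section \<open>Combinatorics of Schubert normal forms\<close>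

lemma mset_butlast_tl:
  "xs \<noteq> [] \<Longrightarrow> mset xs + mset xs = mset (butlast xs) + mset (tl xs) + {#hd xs, last xs#}"
proof -
  assume xs: "xs \<noteq> []"
  have 1: "mset xs = add_mset (hd xs) (mset (tl xs))" using xs by (cases xs) simp_all
  have "mset (butlast xs @ [last xs]) = mset xs" unfolding append_butlast_last_id[OF xs] ..
  then have 2: "mset xs = add_mset (last xs) (mset (butlast xs))" by simp
  have "mset xs + mset xs = add_mset (hd xs) (mset (tl xs)) + add_mset (last xs) (mset (butlast xs))"
    by (rule arg_cong2[OF 1 2])
  also have "\<dots> = mset (butlast xs) + mset (tl xs) + {#hd xs, last xs#}" by simp
  finally show ?thesis .
qed

lemma sum_mset_consecutive:
  "length xs = Suc n \<Longrightarrow> (\<Sum>k<n. {#xs ! k, xs ! Suc k#}) = mset (butlast xs) + mset (tl xs)"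
proof -
  assume n: "length xs = Suc n"
  have "mset ys = (\<Sum>k<length ys. {#ys ! k#})" for ys :: "'a list"
  proof (induction ys rule: rev_induct)
    case (snoc y ys)
    then show ?case by (simp add: nth_append)
  qed simp
  from this[of "butlast xs"] this[of "tl xs"]
  have "mset (butlast xs) = (\<Sum>k<n. {#xs ! k#})" "mset (tl xs) = (\<Sum>k<n. {#xs ! Suc k#})"
    using n by (auto simp: nth_butlast nth_tl intro!: sum.cong)
  then have "mset (butlast xs) + mset (tl xs) = (\<Sum>k<n. {#xs ! k#} + {#xs ! Suc k#})"
    by (simp only: sum.distrib)
  also have "\<dots> = (\<Sum>k<n. {#xs ! k, xs ! Suc k#})" by (intro sum.cong refl) simp
  finally show ?thesis ..
qed

lemma mset_doubleton:
  assumes "x \<noteq> y" "{a, b} = {x, y}"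
  shows "{#a, b#} = {#x, y#}"
proof -
  have "a = x \<and> b = y \<or> a = y \<and> b = x" using assms by (auto simp: doubleton_eq_iff)
  then show ?thesis by (elim disjE conjE) (simp_all add: add_mset_commute[of x y])
qed

lemma image_mset_eq_pairD:
  assumes "image_mset f M = {#a, b, c, d#}"
  obtains p q r s where "M = {#p, q, r, s#}" "f p = a" "f q = b" "f r = c" "f s = d"
proof -
  obtain p M1 where 1: "M = add_mset p M1" "f p = a" "image_mset f M1 = {#b, c, d#}"
    using msed_map_invR[OF assms] by blast
  obtain q M2 where 2: "M1 = add_mset q M2" "f q = b" "image_mset f M2 = {#c, d#}"
    using msed_map_invR[OF 1(3)] by blast
  obtain r M3 where 3: "M2 = add_mset r M3" "f r = c" "image_mset f M3 = {#d#}"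
    using msed_map_invR[OF 2(3)] by blast
  obtain s M4 where 4: "M3 = add_mset s M4" "f s = d" "image_mset f M4 = {#}"
    using msed_map_invR[OF 3(3)] by blast
  show thesis using 1 2 3 4 by (intro that[of p q r s]) simp_all
qed

lemma card_even_below: "card {k. k < n \<and> even k} = (n + 1) div 2"
  and card_odd_below: "card {k. k < n \<and> odd k} = n div 2" for n :: nat
proof -
  have "card {k. k < n \<and> even k} = (n + 1) div 2 \<and> card {k. k < n \<and> odd k} = n div 2"
  proof (induction n)
    case (Suc n)
    have "{k. k < Suc n \<and> even k} = (if even n then insert n {k. k < n \<and> even k} else {k. k < n \<and> even k})"
      "{k. k < Suc n \<and> odd k} = (if odd n then insert n {k. k < n \<and> odd k} else {k. k < n \<and> odd k})"
      by (auto simp: less_Suc_eq)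
    then show ?case using Suc.IH by (auto elim!: evenE oddE)
  qed simp
  then show "card {k. k < n \<and> even k} = (n + 1) div 2" "card {k. k < n \<and> odd k} = n div 2" by simp_all
qed

lemma card_positions_in:
  assumes "distinct xs"
  shows "card {k. k < length xs \<and> xs ! k \<in> A} = card (set xs \<inter> A)"
proof -
  have "bij_betw ((!) xs) {k. k < length xs \<and> xs ! k \<in> A} (set xs \<inter> A)"
    unfolding bij_betw_def
  proof
    show "inj_on ((!) xs) {k. k < length xs \<and> xs ! k \<in> A}"
      using assms by (auto intro!: inj_onI simp: nth_eq_iff_index_eq)
    show "(!) xs ` {k. k < length xs \<and> xs ! k \<in> A} = set xs \<inter> A"
      by (auto simp: in_set_conv_nth image_iff)
  qed
  then show ?thesis by (rule bij_betw_same_card)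
qed

text \<open>
  Diagrams with two bridges and two under-strands. The edges and crossings of the bridge \<open>i\<close> are
  \<open>be i\<close> and \<open>bc i\<close>, those of the under-strand \<open>j\<close> are \<open>ue j\<close> and \<open>uc j\<close>.
\<close>

locale bridge_diagram =
  fixes S :: diagram and br us :: "bool \<Rightarrow> path"
  assumes link_diagram: "link_diagram S"
    and presentation: "bridge_presentation S br us"
begin

abbreviation "be i \<equiv> path_edges (br i)"
abbreviation "bc i \<equiv> path_crossings (br i)"
abbreviation "ue j \<equiv> path_edges (us j)"
abbreviation "uc j \<equiv> path_crossings (us j)"

lemma over_path: "over_path S (br i)" and under_path: "under_path S (us j)"
  and distinct_edges: "distinct (be False @ be True @ ue False @ ue True)"
  and set_edges: "set (be False @ be True @ ue False @ ue True) = edges S"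
  and distinct_bc: "distinct (bc False @ bc True)"
  and set_bc: "set (bc False @ bc True) = crossings S"
  and distinct_uc: "distinct (uc False @ uc True)"
  and set_uc: "set (uc False @ uc True) = crossings S"
  using presentation unfolding bridge_presentation_def by simp_all

lemma length_be: "length (be i) = Suc (length (bc i))"
  using over_path[of i] unfolding over_path_def by (rule conjunct1)

lemma length_ue: "length (ue j) = Suc (length (uc j))"
  using under_path[of j] unfolding under_path_def by (rule conjunct1)

lemma over_crossing:
  assumes "k < length (bc i)"
  obtains a b c d where "S ! (bc i ! k) = Crossing a b c d" "{b, d} = {be i ! k, be i ! Suc k}"
proof -
  have "\<exists>a b c d. S ! (bc i ! k) = Crossing a b c d \<and> {b, d} = {be i ! k, be i ! Suc k}"
    using over_path[of i] assms unfolding over_path_def by simp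
  then show thesis by (elim exE conjE) (rule that)
qed

lemma under_crossing:
  assumes "k < length (uc j)"
  obtains a b c d where "S ! (uc j ! k) = Crossing a b c d" "{a, c} = {ue j ! k, ue j ! Suc k}"
proof -
  have "\<exists>a b c d. S ! (uc j ! k) = Crossing a b c d \<and> {a, c} = {ue j ! k, ue j ! Suc k}"
    using under_path[of j] assms unfolding under_path_def by simp
  then show thesis by (elim exE conjE) (rule that)
qed

lemma distinct_be: "distinct (be i)" and distinct_bc_single: "distinct (bc i)"
  using distinct_edges distinct_bc by (cases i; simp)+

lemma distinct_ue: "distinct (ue j)" and distinct_uc_single: "distinct (uc j)"
  using distinct_edges distinct_uc by (cases j; simp)+

lemma be_disjoint: "i \<noteq> i' \<Longrightarrow> set (be i) \<inter> set (be i') = {}"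
  using distinct_edges by (cases i; cases i') (simp_all add: Int_commute Int_Un_distrib)

lemma ue_disjoint: "j \<noteq> j' \<Longrightarrow> set (ue j) \<inter> set (ue j') = {}"
  using distinct_edges by (cases j; cases j') (simp_all add: Int_commute)

lemma be_ue_disjoint: "set (be i) \<inter> set (ue j) = {}"
  using distinct_edges by (cases i; cases j) (simp_all add: Int_Un_distrib)

lemma bc_disjoint: "i \<noteq> i' \<Longrightarrow> set (bc i) \<inter> set (bc i') = {}"
  using distinct_bc by (cases i; cases i') (simp_all add: Int_commute)

lemma uc_disjoint: "j \<noteq> j' \<Longrightarrow> set (uc j) \<inter> set (uc j') = {}"
  using distinct_uc by (cases j; cases j') (simp_all add: Int_commute)

lemma nonempty: "be i \<noteq> []" "ue j \<noteq> []"
  using length_be[of i] length_ue[of j] by auto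

definition bridge_edges :: "nat set" where
  "bridge_edges = (\<Union>i. set (be i))"

definition under_edges :: "nat set" where
  "under_edges = (\<Union>j. set (ue j))"

lemma bridge_edges_conv: "bridge_edges = set (be False) \<union> set (be True)"
  by (auto simp: bridge_edges_def UNIV_bool)

lemma under_edges_conv: "under_edges = set (ue False) \<union> set (ue True)"
  by (auto simp: under_edges_def UNIV_bool)

lemma bridge_under_disjoint: "bridge_edges \<inter> under_edges = {}"
  using be_ue_disjoint by (auto simp: bridge_edges_def under_edges_def)

lemma edges_union: "edges S = bridge_edges \<union> under_edges"
  using set_edges by (auto simp: bridge_edges_conv under_edges_conv)

lemma point_ends:
  "Point x y \<in> set S \<Longrightarrow> x \<in> bridge_edges \<longleftrightarrow> y \<in> under_edges"
  using presentation unfolding bridge_presentation_def bridge_edges_def under_edges_def by simp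

lemma point_cases:
  assumes "Point x y \<in> set S"
  shows "x \<in> bridge_edges \<and> y \<in> under_edges \<or> x \<in> under_edges \<and> y \<in> bridge_edges"
proof -
  have "x \<in> edges S" "y \<in> edges S" using assms by (force simp: edges_conv)+
  then show ?thesis using point_ends[OF assms] edges_union bridge_under_disjoint by blast
qed

text \<open>
  The edges of a point, the one on a bridge first. The value at a crossing is arbitrary.
\<close>

definition bridge_end :: "vertex \<Rightarrow> nat \<times> nat" where
  "bridge_end v = (case v of Point x y \<Rightarrow> if x \<in> bridge_edges then (x, y) else (y, x)
     | Crossing a b c d \<Rightarrow> (a, a))"

definition points :: "vertex list" where
  "points = filter (\<lambda>v. case v of Point x y \<Rightarrow> True | Crossing a b c d \<Rightarrow> False) S"

lemma points_conv: "v \<in> set points \<longleftrightarrow> v \<in> set S \<and> (\<exists>x y. v = Point x y)"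
  by (auto simp: points_def split: vertex.splits)

lemma mset_edge_ends_split:
  "mset (edge_ends S) = (\<Sum>i\<in>crossings S. mset (ends (S ! i))) + mset (edge_ends points)"
proof -
  have "mset (edge_ends T) = (\<Sum>i\<in>crossings T. mset (ends (T ! i)))
     + mset (edge_ends (filter (\<lambda>v. case v of Point x y \<Rightarrow> True | Crossing a b c d \<Rightarrow> False) T))" for T
  proof (induction T rule: rev_induct)
    case Nil
    show ?case by (simp add: crossings_def edge_ends_def)
  next
    case (snoc v T)
    have fin: "finite (crossings T)" by (simp add: crossings_def)
    have old: "(\<Sum>i\<in>crossings T. mset (ends ((T @ [v]) ! i))) = (\<Sum>i\<in>crossings T. mset (ends (T ! i)))"
      by (intro sum.cong) (auto simp: crossings_def nth_append)
    show ?case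
    proof (cases v)
      case (Crossing a b c d)
      then have "crossings (T @ [v]) = insert (length T) (crossings T)" "length T \<notin> crossings T"
        by (auto simp: crossings_def nth_append less_Suc_eq)
      then show ?thesis using snoc old fin Crossing by (simp add: edge_ends_def)
    next
      case (Point x y)
      then have "crossings (T @ [v]) = crossings T"
        by (auto simp: crossings_def nth_append less_Suc_eq)
      then show ?thesis using snoc old Point by (simp add: edge_ends_def)
    qed
  qed
  then show ?thesis unfolding points_def .
qed

definition over_ends :: "nat \<Rightarrow> nat multiset" where
  "over_ends i = (case S ! i of Crossing a b c d \<Rightarrow> {#b, d#} | Point x y \<Rightarrow> {#})"

definition under_ends :: "nat \<Rightarrow> nat multiset" where
  "under_ends i = (case S ! i of Crossing a b c d \<Rightarrow> {#a, c#} | Point x y \<Rightarrow> {#})"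

lemma over_ends_bc:
  assumes "k < length (bc i)"
  shows "over_ends (bc i ! k) = {#be i ! k, be i ! Suc k#}"
proof -
  obtain a b c d where S: "S ! (bc i ! k) = Crossing a b c d" "{b, d} = {be i ! k, be i ! Suc k}"
    using over_crossing[OF assms] .
  have "be i ! k \<noteq> be i ! Suc k" using assms distinct_be[of i] length_be[of i] by (simp add: nth_eq_iff_index_eq)
  then have "{#b, d#} = {#be i ! k, be i ! Suc k#}"
    using S(2) by (rule mset_doubleton)
  then show ?thesis using S(1) by (simp add: over_ends_def)
qed

lemma under_ends_uc:
  assumes "k < length (uc j)"
  shows "under_ends (uc j ! k) = {#ue j ! k, ue j ! Suc k#}"
proof -
  obtain a b c d where S: "S ! (uc j ! k) = Crossing a b c d" "{a, c} = {ue j ! k, ue j ! Suc k}"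
    using under_crossing[OF assms] .
  have "ue j ! k \<noteq> ue j ! Suc k" using assms distinct_ue[of j] length_ue[of j] by (simp add: nth_eq_iff_index_eq)
  then have "{#a, c#} = {#ue j ! k, ue j ! Suc k#}"
    using S(2) by (rule mset_doubleton)
  then show ?thesis using S(1) by (simp add: under_ends_def)
qed

lemma sum_over_ends:
  "(\<Sum>c\<in>crossings S. over_ends c) = (\<Sum>i\<in>UNIV. mset (butlast (be i)) + mset (tl (be i)))"
proof -
  have one: "(\<Sum>c\<in>set (bc i). over_ends c) = mset (butlast (be i)) + mset (tl (be i))" for i
  proof -
    have "(\<Sum>c\<in>set (bc i). over_ends c) = (\<Sum>k<length (bc i). over_ends (bc i ! k))"
      using distinct_bc_single[of i] by (simp add: sum.distinct_set_conv_list sum_list_sum_nth atLeast0LessThan)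
    also have "\<dots> = (\<Sum>k<length (bc i). {#be i ! k, be i ! Suc k#})"
      by (intro sum.cong refl over_ends_bc) simp
    also have "\<dots> = mset (butlast (be i)) + mset (tl (be i))"
      by (rule sum_mset_consecutive) (rule length_be)
    finally show ?thesis .
  qed
  have "crossings S = set (bc False) \<union> set (bc True)" using set_bc by simp
  then have "(\<Sum>c\<in>crossings S. over_ends c) = (\<Sum>c\<in>set (bc False). over_ends c) + (\<Sum>c\<in>set (bc True). over_ends c)"
    using bc_disjoint[of False True] by (simp add: sum.union_disjoint)
  then show ?thesis unfolding one by (simp add: UNIV_bool)
qed

lemma sum_under_ends:
  "(\<Sum>c\<in>crossings S. under_ends c) = (\<Sum>j\<in>UNIV. mset (butlast (ue j)) + mset (tl (ue j)))"
proof -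
  have one: "(\<Sum>c\<in>set (uc j). under_ends c) = mset (butlast (ue j)) + mset (tl (ue j))" for j
  proof -
    have "(\<Sum>c\<in>set (uc j). under_ends c) = (\<Sum>k<length (uc j). under_ends (uc j ! k))"
      using distinct_uc_single[of j] by (simp add: sum.distinct_set_conv_list sum_list_sum_nth atLeast0LessThan)
    also have "\<dots> = (\<Sum>k<length (uc j). {#ue j ! k, ue j ! Suc k#})"
      by (intro sum.cong refl under_ends_uc) simp
    also have "\<dots> = mset (butlast (ue j)) + mset (tl (ue j))"
      by (rule sum_mset_consecutive) (rule length_ue)
    finally show ?thesis .
  qed
  have "crossings S = set (uc False) \<union> set (uc True)" using set_uc by simp
  then have "(\<Sum>c\<in>crossings S. under_ends c) = (\<Sum>c\<in>set (uc False). under_ends c) + (\<Sum>c\<in>set (uc True). under_ends c)"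
    using uc_disjoint[of False True] by (simp add: sum.union_disjoint)
  then show ?thesis unfolding one by (simp add: UNIV_bool)
qed

text \<open>
  Every edge has two ends. The crossings on a path use up both ends of its inner edges and one end of its
  first and of its last edge, and the points have what remains.
\<close>

lemma mset_point_ends:
  "mset (edge_ends points) = (\<Sum>i\<in>UNIV. {#hd (be i), last (be i)#}) + (\<Sum>j\<in>UNIV. {#hd (ue j), last (ue j)#})"
proof -
  let ?E = "mset (be False @ be True @ ue False @ ue True)"
  have "mset (edge_ends S) = ?E + ?E"
  proof (rule multiset_eqI)
    fix a
    have "count ?E a = (if a \<in> edges S then 1 else 0)"
      using distinct_edges unfolding set_edges[symmetric] distinct_count_atmost_1 by blast
    moreover have "count (mset (edge_ends S)) a = (if a \<in> edges S then 2 else 0)"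
      using link_diagram by (simp add: link_diagram_def count_mset edges_def)
    ultimately show "count (mset (edge_ends S)) a = count (?E + ?E) a" by simp
  qed
  also have "\<dots> = (\<Sum>i\<in>UNIV. mset (be i) + mset (be i)) + (\<Sum>j\<in>UNIV. mset (ue j) + mset (ue j))"
    by (simp add: UNIV_bool)
  also have "\<dots> = (\<Sum>i\<in>UNIV. mset (butlast (be i)) + mset (tl (be i))) + (\<Sum>j\<in>UNIV. mset (butlast (ue j)) + mset (tl (ue j)))
     + ((\<Sum>i\<in>UNIV. {#hd (be i), last (be i)#}) + (\<Sum>j\<in>UNIV. {#hd (ue j), last (ue j)#}))"
    unfolding mset_butlast_tl[OF nonempty(1)] mset_butlast_tl[OF nonempty(2)] by (simp only: sum.distrib ac_simps)
  also have "(\<Sum>i\<in>UNIV. mset (butlast (be i)) + mset (tl (be i))) + (\<Sum>j\<in>UNIV. mset (butlast (ue j)) + mset (tl (ue j)))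
     = (\<Sum>c\<in>crossings S. over_ends c + under_ends c)"
    unfolding sum.distrib[of over_ends] sum_over_ends sum_under_ends ..
  also have "\<dots> = (\<Sum>c\<in>crossings S. mset (ends (S ! c)))"
    by (rule sum.cong) (auto simp: crossings_def over_ends_def under_ends_def)
  finally show ?thesis unfolding mset_edge_ends_split by (simp only: add_left_cancel)
qed

lemma mset_bridge_ends:
  "image_mset fst (mset (map bridge_end points)) = {#hd (be False), last (be False), hd (be True), last (be True)#}"
  "image_mset snd (mset (map bridge_end points)) = {#hd (ue False), last (ue False), hd (ue True), last (ue True)#}"
proof -
  have split: "filter_mset (\<lambda>x. x \<in> bridge_edges) (mset (edge_ends T)) = image_mset fst (mset (map bridge_end T))
     \<and> filter_mset (\<lambda>x. x \<in> under_edges) (mset (edge_ends T)) = image_mset snd (mset (map bridge_end T))"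
    if "set T \<subseteq> set points" for T
    using that
  proof (induction T)
    case (Cons v T)
    then obtain x y where v: "v = Point x y" "Point x y \<in> set S" by (auto simp: points_conv)
    have IH: "filter_mset (\<lambda>x. x \<in> bridge_edges) (mset (edge_ends T)) = image_mset fst (mset (map bridge_end T))"
     "filter_mset (\<lambda>x. x \<in> under_edges) (mset (edge_ends T)) = image_mset snd (mset (map bridge_end T))"
      using Cons by auto
    from point_cases[OF v(2)] show ?case
    proof
      assume "x \<in> bridge_edges \<and> y \<in> under_edges"
      moreover from this have "x \<notin> under_edges" "y \<notin> bridge_edges" using bridge_under_disjoint by auto
      ultimately have "bridge_end v = (x, y)" "x \<in> bridge_edges" "y \<notin> bridge_edges"
        "x \<notin> under_edges" "y \<in> under_edges"
        by (simp_all add: v(1) bridge_end_def)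
      then show ?thesis using IH by (simp add: v(1))
    next
      assume "x \<in> under_edges \<and> y \<in> bridge_edges"
      moreover from this have "y \<notin> under_edges" "x \<notin> bridge_edges" using bridge_under_disjoint by auto
      ultimately have "bridge_end v = (y, x)" "x \<notin> bridge_edges" "y \<in> bridge_edges"
        "x \<in> under_edges" "y \<notin> under_edges"
        by (simp_all add: v(1) bridge_end_def)
      then show ?thesis using IH by (simp add: v(1))
    qed
  qed (simp add: edge_ends_def)
  have b: "hd (be i) \<in> bridge_edges" "last (be i) \<in> bridge_edges" "hd (ue i) \<in> under_edges" "last (ue i) \<in> under_edges" for i
    using nonempty(1)[of i] nonempty(2)[of i]
    by (auto simp: bridge_edges_def under_edges_def intro!: exI[of _ i])
  then have nb: "hd (be i) \<notin> under_edges" "last (be i) \<notin> under_edges" "hd (ue i) \<notin> bridge_edges" "last (ue i) \<notin> bridge_edges" for i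
    using bridge_under_disjoint by blast+
  show "image_mset fst (mset (map bridge_end points)) = {#hd (be False), last (be False), hd (be True), last (be True)#}"
    using split[OF order_refl] b nb unfolding mset_point_ends by (simp add: UNIV_bool add_mset_commute)
  show "image_mset snd (mset (map bridge_end points)) = {#hd (ue False), last (ue False), hd (ue True), last (ue True)#}"
    using split[OF order_refl] b nb unfolding mset_point_ends by (simp add: UNIV_bool add_mset_commute)
qed

text \<open>
  The start of the under-strand \<open>j\<close> is joined to the bridge end \<open>st j\<close>, its finish to \<open>en j\<close>.
\<close>

lemma ex_strand_ends:
  "\<exists>st en. mset (map bridge_end points) = {#(st False, hd (ue False)), (en False, last (ue False)),
     (st True, hd (ue True)), (en True, last (ue True))#} \<and>
   {#st False, en False, st True, en True#} = {#hd (be False), last (be False), hd (be True), last (be True)#}"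
proof -
  obtain p q r s where M: "mset (map bridge_end points) = {#p, q, r, s#}" "snd p = hd (ue False)"
    "snd q = last (ue False)" "snd r = hd (ue True)" "snd s = last (ue True)"
    using image_mset_eq_pairD[OF mset_bridge_ends(2)] .
  define st en where "st j = (if j then fst r else fst p)" and "en j = (if j then fst s else fst q)" for j :: bool
  have pairs: "p = (st False, hd (ue False))" "q = (en False, last (ue False))"
    "r = (st True, hd (ue True))" "s = (en True, last (ue True))"
    using M(2-5) by (simp_all add: st_def en_def prod_eq_iff)
  have "{#st False, en False, st True, en True#} = image_mset fst {#p, q, r, s#}"
    by (simp add: st_def en_def)
  also have "\<dots> = {#hd (be False), last (be False), hd (be True), last (be True)#}"
    using mset_bridge_ends(1) unfolding M(1) .
  finally show ?thesis using M(1) unfolding pairs by (intro exI conjI)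
qed

end

section \<open>How the under-strands join the bridges\<close>

locale strand_diagram = bridge_diagram +
  fixes st en :: "bool \<Rightarrow> nat"
  assumes strand_ends: "mset (map bridge_end points) = {#(st False, hd (ue False)), (en False, last (ue False)),
     (st True, hd (ue True)), (en True, last (ue True))#}"
    and all_bridge_ends: "{#st False, en False, st True, en True#}
     = {#hd (be False), last (be False), hd (be True), last (be True)#}"
begin

definition side :: "nat \<Rightarrow> bool" where
  "side x \<longleftrightarrow> x \<in> set (be True)"

lemma strand_end_in_bridge_ends:
  assumes "x \<in> {st j, en j}"
  shows "x \<in> {hd (be (side x)), last (be (side x))}"
proof -
  have "x \<in># {#st False, en False, st True, en True#}" using assms by (cases j) auto
  then have "x \<in># {#hd (be False), last (be False), hd (be True), last (be True)#}"
    unfolding all_bridge_ends .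
  then consider "x \<in> {hd (be False), last (be False)}" | "x \<in> {hd (be True), last (be True)}" by auto
  then show ?thesis
  proof cases
    case 1
    then have "x \<in> set (be False)" using nonempty(1)[of False] by auto
    then have "\<not> side x" using be_disjoint[of False True] by (auto simp: side_def)
    then show ?thesis using 1 by simp
  next
    case 2
    then have "side x" using nonempty(1)[of True] by (auto simp: side_def)
    then show ?thesis using 2 by simp
  qed
qed

lemma strand_end_in_bridge: "x \<in> {st j, en j} \<Longrightarrow> x \<in> set (be (side x))"
  using strand_end_in_bridge_ends[of x j] hd_in_set[OF nonempty(1)[of "side x"]]
    last_in_set[OF nonempty(1)[of "side x"]] by (metis empty_iff insert_iff)

lemma side_be: "x \<in> set (be i) \<Longrightarrow> side x = i"
  using be_disjoint[of True False] by (cases i) (auto simp: side_def)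

lemma sides: "{#side (st False), side (en False), side (st True), side (en True)#} = {#False, False, True, True#}"
proof -
  have "side (hd (be i)) = i" "side (last (be i)) = i" for i
    using nonempty(1)[of i] by (simp_all add: side_be)
  then have "image_mset side {#hd (be False), last (be False), hd (be True), last (be True)#}
      = {#False, False, True, True#}" by simp
  then show ?thesis unfolding all_bridge_ends[symmetric] by simp
qed

lemma sides_count: "of_bool (side (st False)) + of_bool (side (en False))
    + of_bool (side (st True)) + of_bool (side (en True)) = (2 :: nat)"
  using arg_cong[OF sides, of "\<lambda>M. count M True"] by (simp add: of_bool_def split: if_splits)

text \<open>
  The two bridges have two ends each, so the under-strands either both join different bridges or both return
  to the bridge where they start.
\<close>

lemma closed_strands: "side (st j) = side (en j) \<longleftrightarrow> side (st (\<not> j)) = side (en (\<not> j))"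
  using sides_count by (cases j) (auto simp: of_bool_def split: if_splits)

lemma closed_strands_sides: "side (st j) = side (en j) \<Longrightarrow> side (st (\<not> j)) = (\<not> side (st j))"
  using sides_count by (cases j) (auto simp: of_bool_def split: if_splits)

lemma strand_end_unique:
  assumes "bc (side (st j)) \<noteq> []"
  shows "st (\<not> j) \<noteq> st j" "en j' \<noteq> st j"
proof -
  let ?x = "st j" and ?i = "side (st j)"
  have x: "?x \<in> set (be ?i)" using strand_end_in_bridge[of "st j" j] by simp
  have ne: "hd (be ?i) \<noteq> last (be ?i)"
  proof -
    have "length (be ?i) > 1" using assms length_be[of ?i] by simp
    then show ?thesis using distinct_be[of ?i] nonempty(1)[of ?i]
      by (simp add: hd_conv_nth last_conv_nth nth_eq_iff_index_eq)
  qed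
  have "hd (be (\<not> ?i)) \<in> set (be (\<not> ?i))" "last (be (\<not> ?i)) \<in> set (be (\<not> ?i))"
    using nonempty(1) by simp_all
  then have other: "hd (be (\<not> ?i)) \<noteq> ?x" "last (be (\<not> ?i)) \<noteq> ?x"
    using x be_disjoint[of "\<not> ?i" ?i] by auto
  have "count {#hd (be False), last (be False), hd (be True), last (be True)#} ?x \<le> 1"
    using ne other by (cases ?i) auto
  then have "count {#st False, en False, st True, en True#} ?x \<le> 1" unfolding all_bridge_ends .
  then show "st (\<not> j) \<noteq> st j" "en j' \<noteq> st j"
    by (cases j; cases j'; auto split: if_splits)+
qed

lemma point_of_strand:
  assumes "(x, y) \<in># mset (map bridge_end points)"
  shows "Point x y \<in> set S \<or> Point y x \<in> set S"
proof -
  obtain v where v: "v \<in> set points" "bridge_end v = (x, y)" using assms by auto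
  then obtain p q where "v = Point p q" "Point p q \<in> set S" by (auto simp: points_conv)
  then show ?thesis using v(2) by (auto simp: bridge_end_def split: if_splits)
qed

lemma point_start: "Point (st j) (hd (ue j)) \<in> set S \<or> Point (hd (ue j)) (st j) \<in> set S"
  by (rule point_of_strand, unfold strand_ends) (cases j, simp_all)

lemma point_finish: "Point (en j) (last (ue j)) \<in> set S \<or> Point (last (ue j)) (en j) \<in> set S"
  by (rule point_of_strand, unfold strand_ends) (cases j, simp_all)

lemma pointE:
  assumes "Point x y \<in> set S"
  obtains j where "(x, y) = (st j, hd (ue j)) \<or> (x, y) = (en j, last (ue j))
    \<or> (y, x) = (st j, hd (ue j)) \<or> (y, x) = (en j, last (ue j))"
proof -
  have "bridge_end (Point x y) \<in># mset (map bridge_end points)"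
    using assms by (auto simp: points_conv)
  then have "\<exists>j. bridge_end (Point x y) = (st j, hd (ue j)) \<or> bridge_end (Point x y) = (en j, last (ue j))"
    unfolding strand_ends by auto
  then show thesis
    using that by (auto simp: bridge_end_def split: if_splits)
qed

lemma crossing_location:
  assumes "Crossing a b c d \<in> set S"
  obtains i m j l where "m < length (bc i)" "l < length (uc j)" "bc i ! m = uc j ! l"
    "{b, d} = {be i ! m, be i ! Suc m}" "{a, c} = {ue j ! l, ue j ! Suc l}"
proof -
  obtain p where p: "p < length S" "S ! p = Crossing a b c d" using assms by (auto simp: in_set_conv_nth)
  then have cr: "p \<in> crossings S" by (auto simp: crossings_def)
  have "\<exists>i. p \<in> set (bc i)" using cr unfolding set_bc[symmetric] set_append Un_iff by (elim disjE; intro exI)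
  then obtain i m where im: "m < length (bc i)" "bc i ! m = p" by (auto simp: in_set_conv_nth)
  have "\<exists>j. p \<in> set (uc j)" using cr unfolding set_uc[symmetric] set_append Un_iff by (elim disjE; intro exI)
  then obtain j l where jl: "l < length (uc j)" "uc j ! l = p" by (auto simp: in_set_conv_nth)
  obtain a' b' c' d' where o: "S ! (bc i ! m) = Crossing a' b' c' d'" "{b', d'} = {be i ! m, be i ! Suc m}"
    using over_crossing[OF im(1)] .
  obtain a'' b'' c'' d'' where u: "S ! (uc j ! l) = Crossing a'' b'' c'' d''" "{a'', c''} = {ue j ! l, ue j ! Suc l}"
    using under_crossing[OF jl(1)] .
  show thesis
    using im jl o u p(2) by (intro that[of m i l j]) simp_all
qed

lemma nth_eq_not_disjoint:
  "m < length xs \<Longrightarrow> m' < length ys \<Longrightarrow> xs ! m = ys ! m' \<Longrightarrow> set xs \<inter> set ys \<noteq> {}"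
  by (metis disjoint_iff nth_mem)

lemma same_bc:
  assumes "m < length (bc i)" "m' < length (bc i')" "bc i ! m = bc i' ! m'"
  shows "i = i'" "m = m'"
proof -
  show "i = i'" using nth_eq_not_disjoint[OF assms] bc_disjoint[of i i'] by blast
  then show "m = m'" using assms distinct_bc_single[of i] by (simp add: nth_eq_iff_index_eq)
qed

lemma same_uc:
  assumes "l < length (uc j)" "l' < length (uc j')" "uc j ! l = uc j' ! l'"
  shows "j = j'" "l = l'"
proof -
  show "j = j'" using nth_eq_not_disjoint[OF assms] uc_disjoint[of j j'] by blast
  then show "l = l'" using assms distinct_uc_single[of j] by (simp add: nth_eq_iff_index_eq)
qed

lemma same_ue:
  assumes "l < length (ue j)" "l' < length (ue j')" "ue j ! l = ue j' ! l'"
  shows "j = j'" "l = l'"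
proof -
  show "j = j'" using nth_eq_not_disjoint[OF assms] ue_disjoint[of j j'] by blast
  then show "l = l'" using assms distinct_ue[of j] by (simp add: nth_eq_iff_index_eq)
qed

lemma same_be:
  assumes "m < length (be i)" "m' < length (be i')" "be i ! m = be i' ! m'"
  shows "i = i'" "m = m'"
proof -
  show "i = i'" using nth_eq_not_disjoint[OF assms] be_disjoint[of i i'] by blast
  then show "m = m'" using assms distinct_be[of i] by (simp add: nth_eq_iff_index_eq)
qed

lemma be_neq_ue: "m < length (be i) \<Longrightarrow> l < length (ue j) \<Longrightarrow> be i ! m \<noteq> ue j ! l"
  using be_ue_disjoint[of i j] nth_eq_not_disjoint[of m "be i" l "ue j"] by blast

lemma uc_subset: "set (uc j) \<subseteq> crossings S"
  unfolding set_uc[symmetric] by (cases j) simp_all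

lemma bc_subset: "set (bc i) \<subseteq> crossings S"
  unfolding set_bc[symmetric] by (cases i) simp_all

lemma under_crossing_in_S:
  assumes "l < length (uc j)" "S ! (uc j ! l) = Crossing a b c d"
  shows "Crossing a b c d \<in> set S"
proof -
  have "uc j ! l \<in> crossings S" using uc_subset nth_mem[OF assms(1)] by blast
  then have "uc j ! l < length S" by (simp add: crossings_def)
  from nth_mem[OF this] show ?thesis unfolding assms(2) .
qed

lemma under_crossing_on_bridge:
  assumes "l < length (uc j)"
  obtains i m where "m < length (bc i)" "bc i ! m = uc j ! l"
proof -
  have "uc j ! l \<in> set (bc False) \<union> set (bc True)"
    using uc_subset nth_mem[OF assms] unfolding set_bc[symmetric] set_append by blast
  then consider "uc j ! l \<in> set (bc False)" | "uc j ! l \<in> set (bc True)" by blast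
  then show thesis
    by cases (use that in \<open>auto simp: in_set_conv_nth\<close>)
qed

sublocale planar_diagram S
  by unfold_locales (rule link_diagram)

section \<open>Closed curves in a diagram with two bridges\<close>

lemma doubleton_xor: "{b, d} = {x, y} \<Longrightarrow> (P b \<longleftrightarrow> P d) \<longleftrightarrow> (P x \<longleftrightarrow> P y)"
  by (auto simp: doubleton_eq_iff)

text \<open>
  The loop \<open>Q\<close> leaves the bridge \<open>i\<close> at its end \<open>st j\<close>, follows the under-strand \<open>j\<close> up to the crossing
  next to this end and returns along the bridge. The colour of its edges with respect to the rest of the
  diagram changes at each of the \<open>l\<close> crossings passed before, and does not change at the corners.
\<close>

lemma even_position_of_adjacent_crossing:
  assumes m: "m < length (bc i)" and l: "l < length (uc j)" and same: "bc i ! m = uc j ! l"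
    and f: "m = 0 \<and> st j = be i ! 0 \<or> Suc m = length (bc i) \<and> st j = be i ! Suc m"
  shows "even l"
proof -
  \<comment> \<open>The position of the end \<open>st j\<close> on the bridge.\<close>
  define q where "q = (if m = 0 \<and> st j = be i ! 0 then 0 else Suc m)"
  have q: "q < length (be i)" "st j = be i ! q" "q = m \<or> q = Suc m"
    and q_end: "\<And>p. p < length (bc i) \<Longrightarrow> q = p \<or> q = Suc p \<Longrightarrow> p = m"
    using f m length_be[of i] by (auto simp: q_def split: if_splits)
  define Q where "Q = insert (st j) {ue j ! p | p. p \<le> l}"
  have U: "ue j' ! p \<in> Q \<longleftrightarrow> j' = j \<and> p \<le> l" if p: "p < length (ue j')" for j' p
  proof
    assume "ue j' ! p \<in> Q"
    then consider "ue j' ! p = be i ! q" | p' where "p' \<le> l" "ue j' ! p = ue j ! p'"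
      unfolding Q_def q(2) by blast
    then show "j' = j \<and> p \<le> l"
    proof cases
      case 1
      then show ?thesis using be_neq_ue[OF q(1) p] by simp
    next
      case 2
      have "p' < length (ue j)" using 2(1) l length_ue[of j] by simp
      from same_ue[OF p this 2(2)] show ?thesis using 2(1) by simp
    qed
  qed (auto simp: Q_def)
  have B: "be i' ! p \<in> Q \<longleftrightarrow> i' = i \<and> p = q" if p: "p < length (be i')" for i' p
  proof
    assume "be i' ! p \<in> Q"
    then consider "be i' ! p = be i ! q" | p' where "p' \<le> l" "be i' ! p = ue j ! p'"
      unfolding Q_def q(2) by blast
    then show "i' = i \<and> p = q"
    proof cases
      case 1
      from same_be[OF p q(1) 1] show ?thesis by simp
    next
      case 2
      have "p' < length (ue j)" using 2(1) l length_ue[of j] by simp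
      from be_neq_ue[OF p this] show ?thesis using 2(2) by simp
    qed
  qed (simp add: Q_def q(2))
  have ends_ne: "bc (side (st j)) \<noteq> []"
  proof -
    have "st j \<in> set (be i)" unfolding q(2) using q(1) by simp
    then have "side (st j) = i" by (rule side_be)
    then show ?thesis using m by auto
  qed
  have start: "st j' \<in> Q \<longleftrightarrow> j' = j" and fin: "en j' \<notin> Q" for j'
  proof -
    have under: "x \<in> Q \<longleftrightarrow> x = st j" if "x \<in> {st j', en j'}" for x
    proof -
      have "x \<in> set (be (side x))" using strand_end_in_bridge that by blast
      then obtain p where p: "p < length (be (side x))" "x = be (side x) ! p" by (auto simp: in_set_conv_nth)
      have "x \<noteq> ue j ! p'" if "p' \<le> l" for p'
        using be_neq_ue[OF p(1), of p' j] p(2) that l length_ue[of j] by simp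
      then show ?thesis by (auto simp: Q_def)
    qed
    show "st j' \<in> Q \<longleftrightarrow> j' = j"
      using under[of "st j'"] strand_end_unique(1)[OF ends_ne] by (cases "j' = j") auto
    show "en j' \<notin> Q"
      using under[of "en j'"] strand_end_unique(2)[OF ends_ne] by auto
  qed
  have first: "hd (ue j') \<in> Q \<longleftrightarrow> j' = j" and final: "last (ue j') \<notin> Q" for j'
  proof -
    show "hd (ue j') \<in> Q \<longleftrightarrow> j' = j"
      using U[of 0 j'] nonempty(2)[of j'] by (simp add: hd_conv_nth)
    have "last (ue j') = ue j' ! length (uc j')"
      using nonempty(2)[of j'] length_ue[of j'] by (simp add: last_conv_nth)
    then show "last (ue j') \<notin> Q" using U[of "length (uc j')" j'] l length_ue[of j'] by auto
  qed
  have loc: "(i' = i \<and> m' = m) \<longleftrightarrow> (j' = j \<and> l' = l)"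
    if "m' < length (bc i')" "l' < length (uc j')" "bc i' ! m' = uc j' ! l'" for i' m' j' l'
  proof
    assume "i' = i \<and> m' = m"
    then have "uc j' ! l' = uc j ! l" using that(3) same by simp
    from same_uc[OF that(2) l this] show "j' = j \<and> l' = l" by simp
  next
    assume "j' = j \<and> l' = l"
    then have "bc i' ! m' = bc i ! m" using that(3) same by simp
    from same_bc[OF that(1) m this] show "i' = i \<and> m' = m" by simp
  qed
  have over: "(be i' ! m' \<in> Q \<longleftrightarrow> be i' ! Suc m' \<in> Q) \<longleftrightarrow> \<not> (i' = i \<and> m' = m)"
    if "m' < length (bc i')" for i' m'
    using B[of m' i'] B[of "Suc m'" i'] that length_be[of i'] q(3) q_end[of m'] by auto
  have under: "(ue j' ! l' \<in> Q \<longleftrightarrow> ue j' ! Suc l' \<in> Q) \<longleftrightarrow> \<not> (j' = j \<and> l' = l)"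
    if "l' < length (uc j')" for j' l'
    using U[of l' j'] U[of "Suc l'" j'] that length_ue[of j'] by auto
  obtain col :: "nat \<Rightarrow> bool" where
    through: "\<And>a b c d. Crossing a b c d \<in> set S \<Longrightarrow> a \<notin> - Q \<Longrightarrow> c \<notin> - Q \<Longrightarrow> b \<in> - Q \<Longrightarrow> d \<in> - Q \<Longrightarrow> col a \<noteq> col c"
    and turn: "\<And>a b c d. Crossing a b c d \<in> set S \<Longrightarrow> a \<notin> - Q \<Longrightarrow> b \<notin> - Q \<Longrightarrow> col a = col b"
    "\<And>a b c d. Crossing a b c d \<in> set S \<Longrightarrow> b \<notin> - Q \<Longrightarrow> c \<notin> - Q \<Longrightarrow> col b = col c"
    "\<And>a b c d. Crossing a b c d \<in> set S \<Longrightarrow> c \<notin> - Q \<Longrightarrow> d \<notin> - Q \<Longrightarrow> col c = col d"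
    "\<And>a b c d. Crossing a b c d \<in> set S \<Longrightarrow> d \<notin> - Q \<Longrightarrow> a \<notin> - Q \<Longrightarrow> col d = col a"
    and pass: "\<And>a b. Point a b \<in> set S \<Longrightarrow> a \<notin> - Q \<Longrightarrow> b \<notin> - Q \<Longrightarrow> col a = col b"
  proof (rule face_colouring[of "- Q"])
    fix a b c d assume cr: "Crossing a b c d \<in> set S"
    obtain i' m' j' l' where L: "m' < length (bc i')" "l' < length (uc j')" "bc i' ! m' = uc j' ! l'"
      "{b, d} = {be i' ! m', be i' ! Suc m'}" "{a, c} = {ue j' ! l', ue j' ! Suc l'}"
      using crossing_location[OF cr] .
    have "(b \<in> Q \<longleftrightarrow> d \<in> Q) \<longleftrightarrow> \<not> (i' = i \<and> m' = m)"
      using doubleton_xor[OF L(4), of "\<lambda>x. x \<in> Q"] over[OF L(1)] by simp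
    moreover have "(a \<in> Q \<longleftrightarrow> c \<in> Q) \<longleftrightarrow> \<not> (j' = j \<and> l' = l)"
      using doubleton_xor[OF L(5), of "\<lambda>x. x \<in> Q"] under[OF L(2)] by simp
    ultimately have "(b \<in> Q \<longleftrightarrow> d \<in> Q) \<longleftrightarrow> (a \<in> Q \<longleftrightarrow> c \<in> Q)"
      using loc[OF L(1-3)] by simp
    then show "(a \<in> - Q \<longleftrightarrow> b \<in> - Q) \<longleftrightarrow> (c \<in> - Q \<longleftrightarrow> d \<in> - Q)"
      by (cases "a \<in> Q"; cases "b \<in> Q"; cases "c \<in> Q"; cases "d \<in> Q") simp_all
  next
    fix x y assume "Point x y \<in> set S"
    then obtain j' where "(x, y) = (st j', hd (ue j')) \<or> (x, y) = (en j', last (ue j'))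
      \<or> (y, x) = (st j', hd (ue j')) \<or> (y, x) = (en j', last (ue j'))" by (rule pointE)
    then show "x \<in> - Q \<longleftrightarrow> y \<in> - Q"
      using start[of j'] fin[of j'] first[of j'] final[of j'] by auto
  qed (rule that; assumption)
  have zero: "col (ue j ! 0) = col (st j)"
  proof -
    have Q: "hd (ue j) \<notin> - Q" "st j \<notin> - Q" using first start by simp_all
    have "col (st j) = col (hd (ue j))"
      using point_start[of j]
    proof
      assume "Point (st j) (hd (ue j)) \<in> set S"
      then show ?thesis by (rule pass[OF _ Q(2,1)])
    next
      assume "Point (hd (ue j)) (st j) \<in> set S"
      then show ?thesis by (rule pass[OF _ Q, symmetric])
    qed
    then show ?thesis using nonempty(2)[of j] by (simp add: hd_conv_nth)
  qed
  have step: "col (ue j ! p) \<noteq> col (ue j ! Suc p)" if p: "p < l" for p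
  proof -
    have pl: "p < length (uc j)" using p l by simp
    obtain a b c d where cr: "S ! (uc j ! p) = Crossing a b c d" "{a, c} = {ue j ! p, ue j ! Suc p}"
      using under_crossing[OF pl] .
    have mem: "Crossing a b c d \<in> set S" by (rule under_crossing_in_S[OF pl cr(1)])
    obtain i' m' where im: "m' < length (bc i')" "bc i' ! m' = uc j ! p"
      using under_crossing_on_bridge[OF pl] .
    obtain a' b' c' d' where o: "S ! (bc i' ! m') = Crossing a' b' c' d'" "{b', d'} = {be i' ! m', be i' ! Suc m'}"
      using over_crossing[OF im(1)] .
    have bd: "{b, d} = {be i' ! m', be i' ! Suc m'}" using o im(2) cr(1) by simp
    have ne: "\<not> (i' = i \<and> m' = m)" using loc[OF im(1) pl im(2)] p by simp
    then have "be i' ! m' \<notin> Q" "be i' ! Suc m' \<notin> Q"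
      using B[of m' i'] B[of "Suc m'" i'] im(1) length_be[of i'] q_end[of m'] by auto
    then have "b \<notin> Q" "d \<notin> Q" using bd by (auto simp: doubleton_eq_iff)
    moreover have "ue j ! p \<in> Q" "ue j ! Suc p \<in> Q" using U[of p j] U[of "Suc p" j] p pl length_ue[of j] by simp_all
    then have "a \<in> Q" "c \<in> Q" using cr(2) by (auto simp: doubleton_eq_iff)
    ultimately have "col a \<noteq> col c" using through[OF mem] by simp
    then show ?thesis using cr(2) by (auto simp: doubleton_eq_iff)
  qed
  have walk: "p \<le> l \<Longrightarrow> col (ue j ! p) \<longleftrightarrow> (col (st j) \<longleftrightarrow> even p)" for p
  proof (induction p)
    case 0
    then show ?case using zero by simp
  next
    case (Suc p)
    then show ?case using step[of p] by auto
  qed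
  obtain a b c d where cr: "S ! (uc j ! l) = Crossing a b c d" "{a, c} = {ue j ! l, ue j ! Suc l}"
    using under_crossing[OF l] .
  obtain a' b' c' d' where o: "S ! (bc i ! m) = Crossing a' b' c' d'" "{b', d'} = {be i ! m, be i ! Suc m}"
    using over_crossing[OF m] .
  have mem: "Crossing a b c d \<in> set S" by (rule under_crossing_in_S[OF l cr(1)])
  have "st j \<in> {be i ! m, be i ! Suc m}" using q by auto
  then have f_cases: "st j = b \<or> st j = d" using o cr(1) same by auto
  have u_cases: "ue j ! l = a \<or> ue j ! l = c" using cr(2) by (auto simp: doubleton_eq_iff)
  have "st j \<notin> - Q" "ue j ! l \<notin> - Q" using start U[of l j] l length_ue[of j] by simp_all
  then have "col (ue j ! l) = col (st j)"
    using f_cases u_cases turn(1)[OF mem] turn(2)[OF mem] turn(3)[OF mem] turn(4)[OF mem] by auto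
  then show ?thesis using walk[of l] by auto
qed

end

context strand_diagram
begin

text \<open>
  Such a strand forms, with its bridge, a closed curve which is crossed exactly once.
\<close>

lemma no_single_crossing_loop:
  assumes n: "length (uc j) = 1" and closed: "side (st j) = side (en j)" and "bc (side (st j)) = []"
  shows False
proof -
  let ?i = "side (st j)"
  obtain e where e: "be ?i = [e]"
    using length_be[of ?i] assms(3) by (auto simp: length_Suc_conv)
  obtain u v where uv: "ue j = [u, v]"
    using length_ue[of j] n by (auto simp: length_Suc_conv)
  have se: "st j = e" "en j = e"
    using strand_end_in_bridge[of "st j" j] strand_end_in_bridge[of "en j" j] e closed by simp_all
  define Q where "Q = {e, u, v}"
  have U: "set (ue j) \<subseteq> Q" "set (ue (\<not> j)) \<inter> Q = {}"
  proof -
    have "set (ue (\<not> j)) \<inter> {u, v} = {}" using ue_disjoint[of "\<not> j" j] unfolding uv by simp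
    moreover have "e \<notin> set (ue (\<not> j))" using be_ue_disjoint[of ?i "\<not> j"] unfolding e by simp
    ultimately show "set (ue (\<not> j)) \<inter> Q = {}" by (auto simp: Q_def)
  qed (simp add: uv Q_def)
  have B: "set (be (\<not> ?i)) \<inter> Q = {}"
  proof -
    have "e \<notin> set (be (\<not> ?i))" using be_disjoint[of "\<not> ?i" ?i] unfolding e by simp
    moreover have "{u, v} \<inter> set (be (\<not> ?i)) = {}" using be_ue_disjoint[of "\<not> ?i" j] unfolding uv by auto
    ultimately show ?thesis by (auto simp: Q_def)
  qed
  have over: "x \<notin> Q" if "m < length (bc i')" "x \<in> {be i' ! m, be i' ! Suc m}" for m i' x
  proof -
    have "i' = (\<not> ?i)" using that(1) assms(3) by (cases "i' = ?i") auto
    moreover have "x \<in> set (be i')" using that length_be[of i'] by (auto intro: nth_mem)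
    ultimately show ?thesis using B by auto
  qed
  have under: "x \<in> Q \<longleftrightarrow> j' = j" if "l < length (uc j')" "x \<in> {ue j' ! l, ue j' ! Suc l}" for l j' x
  proof -
    have "x \<in> set (ue j')" using that length_ue[of j'] by (auto intro: nth_mem)
    then show ?thesis using U by (cases "j' = j") auto
  qed
  have start: "st j' \<in> Q \<longleftrightarrow> j' = j" "en j' \<in> Q \<longleftrightarrow> j' = j" for j'
  proof -
    have "st (\<not> j) \<in> set (be (\<not> ?i))" "en (\<not> j) \<in> set (be (\<not> ?i))"
      using strand_end_in_bridge[of "st (\<not> j)" "\<not> j"] strand_end_in_bridge[of "en (\<not> j)" "\<not> j"]
        closed_strands[of j] closed_strands_sides[OF closed] closed by simp_all
    then have "st (\<not> j) \<notin> Q" "en (\<not> j) \<notin> Q" using B by auto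
    then show "st j' \<in> Q \<longleftrightarrow> j' = j" "en j' \<in> Q \<longleftrightarrow> j' = j"
      using se by (cases "j' = j"; auto simp: Q_def)+
  qed
  have first: "hd (ue j') \<in> Q \<longleftrightarrow> j' = j" "last (ue j') \<in> Q \<longleftrightarrow> j' = j" for j'
  proof -
    have "hd (ue j') \<in> set (ue j')" "last (ue j') \<in> set (ue j')" using nonempty(2)[of j'] by simp_all
    then show "hd (ue j') \<in> Q \<longleftrightarrow> j' = j" "last (ue j') \<in> Q \<longleftrightarrow> j' = j"
      using U by (cases "j' = j"; auto)+
  qed
  obtain col :: "nat \<Rightarrow> bool" where
    through: "\<And>a b c d. Crossing a b c d \<in> set S \<Longrightarrow> a \<notin> - Q \<Longrightarrow> c \<notin> - Q \<Longrightarrow> b \<in> - Q \<Longrightarrow> d \<in> - Q \<Longrightarrow> col a \<noteq> col c"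
    and pass: "\<And>a b. Point a b \<in> set S \<Longrightarrow> a \<notin> - Q \<Longrightarrow> b \<notin> - Q \<Longrightarrow> col a = col b"
  proof (rule face_colouring[of "- Q"])
    fix a b c d assume cr: "Crossing a b c d \<in> set S"
    obtain i' m' j' l' where L: "m' < length (bc i')" "l' < length (uc j')" "bc i' ! m' = uc j' ! l'"
      "{b, d} = {be i' ! m', be i' ! Suc m'}" "{a, c} = {ue j' ! l', ue j' ! Suc l'}"
      using crossing_location[OF cr] .
    have "b \<notin> Q" "d \<notin> Q" using over[OF L(1)] unfolding L(4)[symmetric] by simp_all
    moreover have "a \<in> Q \<longleftrightarrow> c \<in> Q" using under[OF L(2)] unfolding L(5)[symmetric] by simp
    ultimately show "(a \<in> - Q \<longleftrightarrow> b \<in> - Q) \<longleftrightarrow> (c \<in> - Q \<longleftrightarrow> d \<in> - Q)" by simp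
  next
    fix x y assume "Point x y \<in> set S"
    then obtain j' where "(x, y) = (st j', hd (ue j')) \<or> (x, y) = (en j', last (ue j'))
      \<or> (y, x) = (st j', hd (ue j')) \<or> (y, x) = (en j', last (ue j'))" by (rule pointE)
    then show "x \<in> - Q \<longleftrightarrow> y \<in> - Q"
      using start[of j'] first[of j'] by auto
  qed (rule that; assumption)
  have Q: "e \<notin> - Q" "u \<notin> - Q" "v \<notin> - Q" by (simp_all add: Q_def)
  have uv': "hd (ue j) = u" "last (ue j) = v" by (simp_all add: uv)
  have "col e = col u"
    using point_start[of j] unfolding se uv'
  proof
    assume "Point e u \<in> set S"
    then show ?thesis by (rule pass[OF _ Q(1,2)])
  next
    assume "Point u e \<in> set S"
    then show ?thesis by (rule pass[OF _ Q(2,1), symmetric])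
  qed
  moreover have "col e = col v"
    using point_finish[of j] unfolding se uv'
  proof
    assume "Point e v \<in> set S"
    then show ?thesis by (rule pass[OF _ Q(1,3)])
  next
    assume "Point v e \<in> set S"
    then show ?thesis by (rule pass[OF _ Q(3,1), symmetric])
  qed
  moreover have "col u \<noteq> col v"
  proof -
    have l: "0 < length (uc j)" using n by simp
    obtain a b c d where cr: "S ! (uc j ! 0) = Crossing a b c d" "{a, c} = {ue j ! 0, ue j ! Suc 0}"
      using under_crossing[OF l] .
    have mem: "Crossing a b c d \<in> set S" by (rule under_crossing_in_S[OF l cr(1)])
    obtain i m where im: "m < length (bc i)" "bc i ! m = uc j ! 0" using under_crossing_on_bridge[OF l] .
    obtain a' b' c' d' where o: "S ! (bc i ! m) = Crossing a' b' c' d'" "{b', d'} = {be i ! m, be i ! Suc m}"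
      using over_crossing[OF im(1)] .
    have bd: "{b, d} = {be i ! m, be i ! Suc m}" using o im(2) cr(1) by simp
    have "b \<in> - Q" "d \<in> - Q" using over[OF im(1)] unfolding bd[symmetric] by simp_all
    moreover have ac: "{a, c} = {u, v}" using cr(2) by (simp add: uv)
    then have "a = u \<and> c = v \<or> a = v \<and> c = u" by (simp add: doubleton_eq_iff)
    moreover from this have "a \<notin> - Q" "c \<notin> - Q" using Q by auto
    ultimately show ?thesis using through[OF mem] by auto
  qed
  ultimately show False by simp
qed

end

section \<open>Lengths of the under-strands\<close>

lemma alternating_list:
  assumes "\<And>k. Suc k < length xs \<Longrightarrow> P (xs ! Suc k) \<longleftrightarrow> \<not> P (xs ! k)" "k < length xs"
  shows "P (xs ! k) \<longleftrightarrow> (P (xs ! 0) \<longleftrightarrow> even k)"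
  using assms(2)
proof (induction k)
  case (Suc k)
  then show ?case using assms(1)[of k] by simp
qed simp

locale schubert_diagram = strand_diagram +
  assumes alternates_start: "\<And>j k. k < length (uc j) \<Longrightarrow>
      uc j ! k \<in> set (bc (if even k then \<not> side (st j) else side (st j)))"
    and alternates_end: "\<And>j k. k < length (uc j) \<Longrightarrow>
      rev (uc j) ! k \<in> set (bc (if even k then \<not> side (en j) else side (en j)))"
    and interlaced: "\<And>i j k. Suc k < length (bc i) \<Longrightarrow> \<not> {bc i ! k, bc i ! Suc k} \<subseteq> set (uc j)"
begin

lemma bridge_of_crossing:
  assumes "k < length (uc j)" "uc j ! k \<in> set (bc i)"
  shows "i = (if even k then \<not> side (st j) else side (st j))"
  using alternates_start[OF assms(1)] assms(2) bc_disjoint[of i "if even k then \<not> side (st j) else side (st j)"]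
  by (metis disjoint_iff)

text \<open>
  Alternation from the start and alternation from the finish have to agree at the first crossing.
\<close>

lemma parity_of_strand:
  assumes "uc j \<noteq> []"
  shows "odd (length (uc j)) \<longleftrightarrow> side (st j) = side (en j)"
proof -
  let ?n = "length (uc j)"
  have n: "0 < ?n" "?n - 1 < ?n" using assms by simp_all
  have "rev (uc j) ! (?n - 1) = uc j ! 0" using n by (simp add: rev_nth)
  then have "uc j ! 0 \<in> set (bc (if even (?n - 1) then \<not> side (en j) else side (en j)))"
    using alternates_end[OF n(2)] by simp
  from bridge_of_crossing[OF n(1) this] show ?thesis using n by (cases "even ?n") auto
qed

lemma card_strand_on_bridge:
  "card (set (uc j) \<inter> set (bc i)) = (if i = side (st j) then length (uc j) div 2 else (length (uc j) + 1) div 2)"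
proof -
  have *: "uc j ! k \<in> set (bc i) \<longleftrightarrow> i = (if even k then \<not> side (st j) else side (st j))" if "k < length (uc j)" for k
  proof
    assume "i = (if even k then \<not> side (st j) else side (st j))"
    then show "uc j ! k \<in> set (bc i)" using alternates_start[OF that] by (simp only:)
  qed (rule bridge_of_crossing[OF that])
  have "uc j ! k \<in> set (bc i) \<longleftrightarrow> (if i = side (st j) then odd k else even k)" if "k < length (uc j)" for k
    unfolding *[OF that] by (cases "even k"; cases i; cases "side (st j)") simp_all
  then have "{k. k < length (uc j) \<and> uc j ! k \<in> set (bc i)}
    = {k. k < length (uc j) \<and> (if i = side (st j) then odd k else even k)}"
    by (intro Collect_cong conj_cong refl)
  then show ?thesis
    using card_positions_in[OF distinct_uc_single[of j], of "set (bc i)"]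
    by (cases "i = side (st j)") (simp_all only: if_True if_False simp_thms card_even_below card_odd_below)
qed

lemma other_strand:
  assumes "c \<in> crossings S"
  shows "c \<in> set (uc (\<not> j)) \<longleftrightarrow> c \<notin> set (uc j)"
proof -
  have "c \<in> set (uc False) \<union> set (uc True)" using assms unfolding set_uc[symmetric] by simp
  then show ?thesis using uc_disjoint[of j "\<not> j"] by (cases j) auto
qed

lemma strand_along_bridge:
  assumes "k < length (bc i)"
  shows "bc i ! k \<in> set (uc j) \<longleftrightarrow> (bc i ! 0 \<in> set (uc j) \<longleftrightarrow> even k)"
proof (rule alternating_list[where P = "\<lambda>c. c \<in> set (uc j)", OF _ assms])
  fix k assume k: "Suc k < length (bc i)"
  have "bc i ! k \<in> crossings S" "bc i ! Suc k \<in> crossings S"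
    using bc_subset[of i] nth_mem[of k "bc i"] nth_mem[of "Suc k" "bc i"] k by auto
  then show "bc i ! Suc k \<in> set (uc j) \<longleftrightarrow> bc i ! k \<notin> set (uc j)"
    using interlaced[OF k, of j] interlaced[OF k, of "\<not> j"]
      other_strand[of "bc i ! k" j] other_strand[of "bc i ! Suc k" j] by blast
qed

lemma card_bridge_crossings:
  assumes "bc i \<noteq> []"
  shows "card (set (uc j) \<inter> set (bc i))
    = (if bc i ! 0 \<in> set (uc j) then (length (bc i) + 1) div 2 else length (bc i) div 2)"
proof -
  have "{k. k < length (bc i) \<and> bc i ! k \<in> set (uc j)}
    = {k. k < length (bc i) \<and> (if bc i ! 0 \<in> set (uc j) then even k else odd k)}"
  proof (intro Collect_cong conj_cong refl)
    fix k assume k: "k < length (bc i)"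
    show "bc i ! k \<in> set (uc j) \<longleftrightarrow> (if bc i ! 0 \<in> set (uc j) then even k else odd k)"
      unfolding strand_along_bridge[OF k, of j] by simp
  qed
  then show ?thesis
    using card_positions_in[OF distinct_bc_single[of i], of "set (uc j)"]
    by (cases "bc i ! 0 \<in> set (uc j)")
      (simp_all only: if_True if_False simp_thms card_even_below card_odd_below Int_commute)
qed

text \<open>
  The crossings along a bridge belong to the two under-strands alternately.
\<close>

lemma card_strands_differ:
  "card (set (uc j) \<inter> set (bc i)) \<le> card (set (uc (\<not> j)) \<inter> set (bc i)) + 1"
proof (cases "bc i = []")
  case False
  then have "bc i ! 0 \<in> crossings S" using bc_subset[of i] by auto
  then show ?thesis
    using card_bridge_crossings[OF False, of j] card_bridge_crossings[OF False, of "\<not> j"] other_strand[of "bc i ! 0" j]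
    by (cases "bc i ! 0 \<in> set (uc j)") simp_all
qed simp

lemma outer_crossings:
  assumes "card (set (uc j) \<inter> set (bc i)) = card (set (uc (\<not> j)) \<inter> set (bc i)) + 1"
  shows "bc i \<noteq> []" "bc i ! 0 \<in> set (uc j)" "bc i ! (length (bc i) - 1) \<in> set (uc j)"
proof -
  show ne: "bc i \<noteq> []" using assms by auto
  then have "bc i ! 0 \<in> crossings S" using bc_subset[of i] by auto
  then have *: "bc i ! 0 \<in> set (uc j)" "odd (length (bc i))"
    using card_bridge_crossings[OF ne, of j] card_bridge_crossings[OF ne, of "\<not> j"] other_strand[of "bc i ! 0" j] assms
    by (cases "bc i ! 0 \<in> set (uc j)"; cases "even (length (bc i))"; auto elim!: evenE oddE)+
  show "bc i ! 0 \<in> set (uc j)" by (rule *)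
  show "bc i ! (length (bc i) - 1) \<in> set (uc j)"
    using strand_along_bridge[of "length (bc i) - 1" i j] * ne by simp
qed

text \<open>
  Otherwise \<open>j\<close> owns both outermost crossings of the bridge on which it starts, in particular the one next to
  its start. As the strand is under this bridge at every second crossing only, its position is odd, while
  planarity requires it to be even.
\<close>

lemma open_strands_not_longer:
  assumes "side (st j) \<noteq> side (en j)"
  shows "length (uc j) \<le> length (uc (\<not> j))"
proof (rule ccontr)
  assume longer: "\<not> length (uc j) \<le> length (uc (\<not> j))"
  let ?i = "side (st j)"
  have "even (length (uc j))" "even (length (uc (\<not> j)))"
    using parity_of_strand[of j] parity_of_strand[of "\<not> j"] assms closed_strands[of j] by (cases "uc j = []"; cases "uc (\<not> j) = []"; auto)+
  then have halves: "card (set (uc j') \<inter> set (bc ?i)) = length (uc j') div 2" if "j' = j \<or> j' = (\<not> j)" for j'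
    using card_strand_on_bridge[of j' ?i] that by (auto elim!: evenE)
  have "card (set (uc j) \<inter> set (bc ?i)) = card (set (uc (\<not> j)) \<inter> set (bc ?i)) + 1"
    using card_strands_differ[of j ?i] halves[of j] halves[of "\<not> j"] longer
      \<open>even (length (uc j))\<close> \<open>even (length (uc (\<not> j)))\<close> by (auto elim!: evenE)
  from outer_crossings[OF this]
  have ends: "bc ?i \<noteq> []" "bc ?i ! 0 \<in> set (uc j)" "bc ?i ! (length (bc ?i) - 1) \<in> set (uc j)" .
  have "\<exists>m. m < length (bc ?i) \<and> bc ?i ! m \<in> set (uc j) \<and>
     (m = 0 \<and> st j = be ?i ! 0 \<or> Suc m = length (bc ?i) \<and> st j = be ?i ! Suc m)"
  proof -
    have "st j = be ?i ! 0 \<or> st j = be ?i ! length (bc ?i)"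
      using strand_end_in_bridge_ends[of "st j" j] nonempty(1)[of ?i] length_be[of ?i]
      by (simp add: hd_conv_nth last_conv_nth)
    then show ?thesis
    proof
      assume "st j = be ?i ! 0"
      then show ?thesis using ends by (intro exI[of _ 0]) simp
    next
      assume "st j = be ?i ! length (bc ?i)"
      then show ?thesis using ends by (intro exI[of _ "length (bc ?i) - 1"]) simp
    qed
  qed
  then obtain m where m: "m < length (bc ?i)" "bc ?i ! m \<in> set (uc j)"
    "m = 0 \<and> st j = be ?i ! 0 \<or> Suc m = length (bc ?i) \<and> st j = be ?i ! Suc m" by blast
  obtain l where l: "l < length (uc j)" "bc ?i ! m = uc j ! l" using m(2) by (metis in_set_conv_nth)
  have "even l" by (rule even_position_of_adjacent_crossing[OF m(1) l m(3)])
  moreover have "uc j ! l \<in> set (bc ?i)" using m(1) l(2) nth_mem by metis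
  from bridge_of_crossing[OF l(1) this] have "odd l" by (cases "even l") auto
  ultimately show False by simp
qed

text \<open>
  On each bridge the strand that starts there has \<open>(n - 1) / 2\<close> crossings and the other one \<open>(n + 1) / 2\<close> for its own
  length \<open>n\<close>. The counts on a bridge differ by at most one, so neither strand can be longer.
\<close>

lemma closed_strands_equal_length:
  assumes closed: "side (st j) = side (en j)" and "uc j \<noteq> []"
  shows "length (uc (\<not> j)) = length (uc j)"
proof -
  have c1: "side (st j') = side (en j')" for j'
  proof (cases "j' = j")
    case False
    then have "j' = (\<not> j)" by (cases j; cases j') simp_all
    show ?thesis unfolding \<open>j' = (\<not> j)\<close> by (rule iffD1[OF closed_strands closed])
  qed (use closed in simp)
  have c2: "side (st (\<not> j')) = (\<not> side (st j'))" for j'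
    by (rule closed_strands_sides[OF c1])
  have odd: "odd (length (uc j'))" if "uc j' \<noteq> []" for j'
    using parity_of_strand[OF that] c1[of j'] by (simp only:)
  have on: "card (set (uc j') \<inter> set (bc (side (st j')))) = length (uc j') div 2"
    "card (set (uc j') \<inter> set (bc (\<not> side (st j')))) = (length (uc j') + 1) div 2" for j'
    using card_strand_on_bridge[of j'] by simp_all
  have le: "(length (uc j') + 1) div 2 \<le> length (uc (\<not> j')) div 2 + 1" for j'
    using card_strands_differ[of j' "\<not> side (st j')"] on(1)[of "\<not> j'"]
    unfolding on(2) c2[of j'] by (simp only:)
  have ne: "uc (\<not> j) \<noteq> []"
  proof
    assume empty: "uc (\<not> j) = []"
    obtain a where a: "length (uc j) = 2 * a + 1" using odd[OF assms(2)] by (rule oddE)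
    have one: "length (uc j) = 1" using le[of j] unfolding empty a by simp
    have "set (bc (side (st j))) \<subseteq> set (uc j)"
    proof
      fix c assume "c \<in> set (bc (side (st j)))"
      then have "c \<in> crossings S" using bc_subset by (rule rev_subsetD)
      from other_strand[OF this, of j] show "c \<in> set (uc j)" unfolding empty by simp
    qed
    then have "set (uc j) \<inter> set (bc (side (st j))) = set (bc (side (st j)))" by (rule Int_absorb1)
    then have "length (bc (side (st j))) = 0"
      using on(1)[of j] one distinct_card[OF distinct_bc_single[of "side (st j)"]] by simp
    then have "bc (side (st j)) = []" by simp
    from no_single_crossing_loop[OF one closed this] show False .
  qed
  obtain a where a: "length (uc j) = 2 * a + 1" using odd[OF assms(2)] by (rule oddE)
  obtain b where b: "length (uc (\<not> j)) = 2 * b + 1" using odd[OF ne] by (rule oddE)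
  show ?thesis using le[of j] le[of "\<not> j"] unfolding not_not a b by simp
qed

theorem strands_equal_length:
  assumes "side (st False) \<noteq> side (en False) \<or> uc False \<noteq> [] \<or> uc True \<noteq> []"
  shows "length (uc False) = length (uc True)"
proof (cases "side (st False) = side (en False)")
  case True
  then have "side (st True) = side (en True)" using closed_strands[of False] by simp
  show ?thesis
  proof (cases "uc False = []")
    case True
    then have "uc True \<noteq> []" using assms \<open>side (st False) = side (en False)\<close> by simp
    from closed_strands_equal_length[OF \<open>side (st True) = side (en True)\<close> this] show ?thesis by simp
  next
    case False
    from closed_strands_equal_length[OF \<open>side (st False) = side (en False)\<close> this] show ?thesis by simp
  qed
next
  case False
  then have "side (st True) \<noteq> side (en True)" using closed_strands[of False] by simp
  from open_strands_not_longer[OF False] open_strands_not_longer[OF this] show ?thesis by simp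
qed

end

section \<open>The determinant of a Schubert normal form\<close>

context schubert_diagram
begin

definition bridge_colour :: "bool \<Rightarrow> int" where
  "bridge_colour i = of_bool i"

text \<open>
  For \<open>side (st j) = False\<close> these are the colours \<open>0, 2, -2, 4, -4, \<dots>\<close>; the factor
  \<open>1 - 2 * bridge_colour (side (st j))\<close> and the summand exchange \<open>0\<close> and \<open>1\<close>.
\<close>

definition strand_colour :: "bool \<Rightarrow> nat \<Rightarrow> int" where
  "strand_colour j k = bridge_colour (side (st j)) + (1 - 2 * bridge_colour (side (st j))) *
     (if even k then - int k else int k + 1)"

definition colour :: "nat \<Rightarrow> int" where
  "colour x = (if x \<in> bridge_edges then bridge_colour (side x)
     else let j = (x \<in> set (ue True)) in strand_colour j (inv_into {..<length (ue j)} ((!) (ue j)) x))"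

lemma strand_colour_0: "strand_colour j 0 = bridge_colour (side (st j))"
  by (simp add: strand_colour_def)

lemma strand_colour_Suc:
  "strand_colour j (Suc k)
     = 2 * bridge_colour (if even k then \<not> side (st j) else side (st j)) - strand_colour j k"
  by (cases "even k"; cases "side (st j)") (simp_all add: strand_colour_def bridge_colour_def)

lemma colour_be: "x \<in> set (be i) \<Longrightarrow> colour x = bridge_colour i"
  using side_be[of x i] by (auto simp: colour_def bridge_edges_def)

lemma colour_ue:
  assumes "k < length (ue j)"
  shows "colour (ue j ! k) = strand_colour j k"
proof -
  have mem: "ue j ! k \<in> set (ue j)" using assms by simp
  then have "ue j ! k \<in> under_edges" by (auto simp: under_edges_def)
  then have "ue j ! k \<notin> bridge_edges" using bridge_under_disjoint by blast
  moreover have "(ue j ! k \<in> set (ue True)) = j" using mem ue_disjoint[of True False] by (cases j) auto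
  moreover have "inv_into {..<length (ue j)} ((!) (ue j)) (ue j ! k) = k"
    by (rule inv_into_f_f) (use assms distinct_ue[of j] in \<open>auto simp: inj_on_nth\<close>)
  ultimately show ?thesis by (simp add: colour_def Let_def)
qed

definition x0 :: nat where "x0 = hd (be False)"
definition y0 :: nat where "y0 = hd (be True)"

definition slope :: "nat \<Rightarrow>\<^sub>0 int" where
  "slope = frag_of y0 - frag_of x0"

text \<open>
  The edge \<open>x\<close> expressed by one edge of each bridge, using that it has the colour \<open>colour x\<close> when these
  have the colours \<open>0\<close> and \<open>1\<close>.
\<close>

definition weight :: "nat \<Rightarrow> nat \<Rightarrow>\<^sub>0 int" where
  "weight x = frag_of x0 + frag_cmul (colour x) slope"

lemma x0_be: "x0 \<in> set (be False)" and y0_be: "y0 \<in> set (be True)"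
  using nonempty(1) by (simp_all add: x0_def y0_def)

lemma x0_neq_y0: "x0 \<noteq> y0"
  using x0_be y0_be be_disjoint[of False True] by auto

lemma weight_x0: "weight x0 = frag_of x0" and weight_y0: "weight y0 = frag_of y0"
  using colour_be[OF x0_be] colour_be[OF y0_be]
  by (simp_all add: weight_def bridge_colour_def slope_def)

lemma weight_diff: "weight x - weight y = frag_cmul (colour x - colour y) slope"
  by (simp add: weight_def frag_cmul_diff_distrib)

lemma weight_relation:
  "frag_cmul 2 (weight b) - weight a - weight c = frag_cmul (2 * colour b - colour a - colour c) slope"
proof -
  have "frag_cmul 2 (weight b) = weight b + weight b" by (rule frag_double)
  then have "frag_cmul 2 (weight b) - weight a - weight c = (weight b - weight a) + (weight b - weight c)" by simp
  also have "\<dots> = frag_cmul ((colour b - colour a) + (colour b - colour c)) slope"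
    unfolding weight_diff frag_cmul_distrib ..
  also have "(colour b - colour a) + (colour b - colour c) = 2 * colour b - colour a - colour c" by simp
  finally show ?thesis .
qed

abbreviation "relation_group \<equiv> group_closure (relations S)"

lemma vertex_relation_in_group: "v \<in> set S \<Longrightarrow> r \<in> vertex_relations v \<Longrightarrow> r \<in> relation_group"
  by (rule group_closure.base) (auto simp: relations_def)

lemma difference_sym:
  assumes "frag_of x - frag_of y \<in> relation_group"
  shows "frag_of y - frag_of x \<in> relation_group"
  using group_closure.diff[OF zero_in_group_closure assms] by simp

lemma congruent_transfer:
  assumes "frag_of x - weight x \<in> relation_group" "frag_of x - frag_of y \<in> relation_group" "colour x = colour y"
  shows "frag_of y - weight y \<in> relation_group"
proof -
  have "(frag_of x - weight x) - (frag_of x - frag_of y) = frag_of y - weight y"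
    using assms(3) by (simp add: weight_def)
  with group_closure.diff[OF assms(1,2)] show ?thesis by (simp only:)
qed

lemma congruent_bridge:
  assumes "k < length (be i)"
  shows "frag_of (be i ! k) - weight (be i ! k) \<in> relation_group"
  using assms
proof (induction k)
  case 0
  have "be i ! 0 = x0 \<or> be i ! 0 = y0"
    using nonempty(1)[of i] by (cases i) (simp_all add: x0_def y0_def hd_conv_nth)
  then have "frag_of (be i ! 0) - weight (be i ! 0) = 0" using weight_x0 weight_y0 by auto
  then show ?case by (simp only: zero_in_group_closure)
next
  case (Suc k)
  then have k: "k < length (bc i)" "k < length (be i)" using length_be[of i] by simp_all
  obtain a b c d where cr: "S ! (bc i ! k) = Crossing a b c d" "{b, d} = {be i ! k, be i ! Suc k}"
    using over_crossing[OF k(1)] .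
  have "bc i ! k \<in> crossings S" using bc_subset nth_mem[OF k(1)] by blast
  then have "Crossing a b c d \<in> set S" using cr(1) nth_mem[of "bc i ! k" S] by (simp add: crossings_def)
  then have bd: "frag_of b - frag_of d \<in> relation_group"
    by (rule vertex_relation_in_group) simp
  have "frag_of (be i ! k) - frag_of (be i ! Suc k) \<in> relation_group"
    using cr(2) bd difference_sym[OF bd] by (auto simp only: doubleton_eq_iff)
  moreover have "colour (be i ! k) = colour (be i ! Suc k)"
    using colour_be[of "be i ! k" i] colour_be[of "be i ! Suc k" i] k Suc.prems by simp
  ultimately show ?case using congruent_transfer Suc.IH k(2) by blast
qed

lemma congruent_bridge_edge: "x \<in> set (be i) \<Longrightarrow> frag_of x - weight x \<in> relation_group"
  using congruent_bridge[of _ i] by (auto simp only: in_set_conv_nth)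

lemma crossing_colours:
  assumes "Crossing a b c d \<in> set S"
  shows "colour b = colour d" "2 * colour b = colour a + colour c"
proof -
  obtain i m j l where L: "m < length (bc i)" "l < length (uc j)" "bc i ! m = uc j ! l"
    "{b, d} = {be i ! m, be i ! Suc m}" "{a, c} = {ue j ! l, ue j ! Suc l}"
    using crossing_location[OF assms] .
  have "b \<in> {be i ! m, be i ! Suc m}" "d \<in> {be i ! m, be i ! Suc m}" unfolding L(4)[symmetric] by simp_all
  moreover have "be i ! m \<in> set (be i)" "be i ! Suc m \<in> set (be i)" using L(1) length_be[of i] by simp_all
  ultimately have "b \<in> set (be i)" "d \<in> set (be i)" by auto
  then have bd: "colour b = bridge_colour i" "colour d = bridge_colour i" by (simp_all add: colour_be)
  then show "colour b = colour d" by simp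
  have "uc j ! l \<in> set (bc i)" using L(1,3) nth_mem[of m "bc i"] by simp
  then have i: "i = (if even l then \<not> side (st j) else side (st j))" by (rule bridge_of_crossing[OF L(2)])
  have "colour (ue j ! l) + colour (ue j ! Suc l) = 2 * bridge_colour i"
    using L(2) length_ue[of j] by (simp add: colour_ue strand_colour_Suc i)
  moreover have "colour a + colour c = colour (ue j ! l) + colour (ue j ! Suc l)"
    using L(5) by (auto simp: doubleton_eq_iff)
  ultimately show "2 * colour b = colour a + colour c" using bd(1) by simp
qed

lemma congruent_strand:
  assumes "k < length (ue j)"
  shows "frag_of (ue j ! k) - weight (ue j ! k) \<in> relation_group"
  using assms
proof (induction k)
  case 0
  have "frag_of (st j) - frag_of (ue j ! 0) \<in> relation_group"
    using point_start[of j]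
  proof
    assume "Point (st j) (hd (ue j)) \<in> set S"
    then show ?thesis
      by (rule vertex_relation_in_group) (simp add: hd_conv_nth[OF nonempty(2)])
  next
    assume "Point (hd (ue j)) (st j) \<in> set S"
    then have "frag_of (ue j ! 0) - frag_of (st j) \<in> relation_group"
      by (rule vertex_relation_in_group) (simp add: hd_conv_nth[OF nonempty(2)])
    then show ?thesis by (rule difference_sym)
  qed
  moreover have st: "st j \<in> set (be (side (st j)))" using strand_end_in_bridge[of "st j" j] by simp
  then have "colour (st j) = colour (ue j ! 0)"
    using colour_ue[OF 0] strand_colour_0[of j] colour_be[OF st] by simp
  ultimately show ?case using congruent_transfer congruent_bridge_edge[OF st] by blast
next
  case (Suc k)
  then have k: "k < length (uc j)" "k < length (ue j)" using length_ue[of j] by simp_all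
  obtain a b c d where cr: "S ! (uc j ! k) = Crossing a b c d" "{a, c} = {ue j ! k, ue j ! Suc k}"
    using under_crossing[OF k(1)] .
  have mem: "Crossing a b c d \<in> set S" by (rule under_crossing_in_S[OF k(1) cr(1)])
  obtain i m j' l where L: "m < length (bc i)" "l < length (uc j')" "bc i ! m = uc j' ! l"
    "{b, d} = {be i ! m, be i ! Suc m}" "{a, c} = {ue j' ! l, ue j' ! Suc l}"
    using crossing_location[OF mem] .
  have "b \<in> {be i ! m, be i ! Suc m}" unfolding L(4)[symmetric] by simp
  moreover have "be i ! m \<in> set (be i)" "be i ! Suc m \<in> set (be i)" using L(1) length_be[of i] by simp_all
  ultimately have "b \<in> set (be i)" by auto
  then have b: "frag_of b - weight b \<in> relation_group" by (rule congruent_bridge_edge)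
  have rel: "frag_cmul 2 (frag_of b) - frag_of a - frag_of c \<in> relation_group"
    using mem by (rule vertex_relation_in_group) simp
  have step: "frag_of y - weight y \<in> relation_group"
    if x: "frag_of x - weight x \<in> relation_group"
      and rel: "frag_cmul 2 (frag_of b) - frag_of x - frag_of y \<in> relation_group"
      and col: "2 * colour b = colour x + colour y" for x y
  proof -
    have zero: "frag_cmul 2 (weight b) - weight x - weight y = 0"
      unfolding weight_relation using col by simp
    have "(frag_of b - weight b) + (frag_of b - weight b) - (frag_of x - weight x)
        - (frag_cmul 2 (frag_of b) - frag_of x - frag_of y)
      = (frag_of y - weight y) - (frag_cmul 2 (weight b) - weight x - weight y)"
      by (simp add: frag_double algebra_simps)
    also have "\<dots> = frag_of y - weight y" unfolding zero by simp
    finally show ?thesis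
      using group_closure.diff[OF group_closure.diff[OF group_closure_add[OF b b] x] rel] by (simp only:)
  qed
  have rel': "frag_cmul 2 (frag_of b) - frag_of c - frag_of a \<in> relation_group"
  proof -
    have "frag_cmul 2 (frag_of b) - frag_of c - frag_of a = frag_cmul 2 (frag_of b) - frag_of a - frag_of c" by simp
    then show ?thesis using rel by (simp only:)
  qed
  have col: "2 * colour b = colour a + colour c" "2 * colour b = colour c + colour a"
    using crossing_colours(2)[OF mem] by simp_all
  have "a = ue j ! k \<and> c = ue j ! Suc k \<or> a = ue j ! Suc k \<and> c = ue j ! k"
    using cr(2) by (simp only: doubleton_eq_iff)
  then show ?case
  proof (elim disjE conjE)
    assume "a = ue j ! k" "c = ue j ! Suc k"
    then show ?thesis using step[OF _ rel col(1)] Suc.IH k(2) by simp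
  next
    assume "a = ue j ! Suc k" "c = ue j ! k"
    then show ?thesis using step[OF _ rel' col(2)] Suc.IH k(2) by simp
  qed
qed

lemma congruent_edge:
  assumes "x \<in> edges S"
  shows "frag_of x - weight x \<in> relation_group"
proof -
  consider i where "x \<in> set (be i)" | j where "x \<in> set (ue j)"
    using assms unfolding edges_union bridge_edges_def under_edges_def by blast
  then show ?thesis
  proof cases
    case 1
    then show ?thesis by (rule congruent_bridge_edge)
  next
    case 2
    then show ?thesis using congruent_strand[of _ j] by (auto simp only: in_set_conv_nth)
  qed
qed

text \<open>
  All edges are eliminated except for \<open>x0\<close> and \<open>y0\<close>. The relations at crossings and at the starts of the under-strands
  become trivial, and those at the finishes become \<open>(n + 1) (y0 - x0) = 0\<close>.
\<close>

theorem divides_colouring_minors_schubert: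
  assumes n: "\<And>j. length (uc j) = n" and ends: "n = 0 \<Longrightarrow> \<forall>j. side (st j) \<noteq> side (en j)"
  shows "divides_colouring_minors S d \<longleftrightarrow> d dvd int n + 1"
proof -
  let ?g = "frag_cmul (int n + 1) slope"
  have last: "colour (en j) - colour (last (ue j)) = int n + 1 \<or> colour (en j) - colour (last (ue j)) = - (int n + 1)" for j
  proof -
    have "en j \<in> set (be (side (en j)))" using strand_end_in_bridge[of "en j" j] by simp
    then have "colour (en j) = bridge_colour (side (en j))" by (rule colour_be)
    moreover have "last (ue j) = ue j ! n" using nonempty(2)[of j] length_ue[of j] n by (simp add: last_conv_nth)
    then have "colour (last (ue j)) = strand_colour j n" using colour_ue[of n j] length_ue[of j] n by simp
    moreover have "odd n \<longleftrightarrow> side (st j) = side (en j)"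
      using parity_of_strand[of j] n[of j] ends by (cases "uc j = []") auto
    ultimately show ?thesis
      by (cases "even n"; cases "side (st j)"; cases "side (en j)") (simp_all add: strand_colour_def bridge_colour_def)
  qed
  have point: "frag_extend weight (frag_of x - frag_of y) \<in> {0, ?g, - ?g}" if xy: "Point x y \<in> set S" for x y
  proof -
    have ext: "frag_extend weight (frag_of x - frag_of y) = frag_cmul (colour x - colour y) slope"
      by (simp add: frag_extend_diff weight_diff)
    have start: "colour (st j) = colour (hd (ue j))" for j
      using strand_end_in_bridge[of "st j" j] colour_be[of "st j" "side (st j)"] colour_ue[of 0 j]
        nonempty(2)[of j] strand_colour_0[of j] by (simp add: hd_conv_nth)
    obtain j where "(x, y) = (st j, hd (ue j)) \<or> (x, y) = (en j, last (ue j))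
        \<or> (y, x) = (st j, hd (ue j)) \<or> (y, x) = (en j, last (ue j))" using pointE[OF xy] .
    then have "colour x - colour y \<in> {0, int n + 1, - (int n + 1)}"
      using start[of j] last[of j] by auto
    then show ?thesis unfolding ext minus_frag_cmul by (elim insertE emptyE) simp_all
  qed
  have eliminate: "divides_first_minors (edges S) (relations S) = divides_first_minors {x0, y0} (frag_extend weight ` relations S)"
  proof (rule divides_first_minors_eliminate)
    show "Poly_Mapping.keys r \<subseteq> edges S" if "r \<in> relations S" for r using that by (rule keys_relations)
    show "Poly_Mapping.keys (weight x) \<subseteq> {x0, y0}" for x
      by (auto simp: weight_def slope_def in_keys_iff lookup_add lookup_minus split: if_splits)
    show "frag_of x - weight x \<in> group_closure (relations S)" if "x \<in> edges S" for x
      using that by (rule congruent_edge)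
    show "{x0, y0} \<subseteq> edges S"
      using x0_be y0_be unfolding edges_union bridge_edges_def by blast
  qed (use weight_x0 weight_y0 in auto)
  have "group_closure (frag_extend weight ` relations S) = group_closure {?g}"
  proof (rule group_closure_eqI)
    have g: "?g \<in> group_closure {?g}" by (rule group_closure.base) simp
    then have "{0, ?g, - ?g} \<subseteq> group_closure {?g}"
      by (simp only: insert_subset empty_subsetI zero_in_group_closure group_closure_minus_iff simp_thms)
    moreover have "frag_extend weight r \<in> {0, ?g, - ?g}" if r: "r \<in> relations S" for r
    proof -
      obtain v where v: "v \<in> set S" "r \<in> vertex_relations v" using r by (auto simp: relations_def)
      show ?thesis
      proof (cases v)
        case (Crossing a b c d)
        then have mem: "Crossing a b c d \<in> set S" using v by simp
        have "frag_extend weight (frag_of b - frag_of d) = 0"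
          "frag_extend weight (frag_cmul 2 (frag_of b) - frag_of a - frag_of c) = 0"
          using crossing_colours[OF mem]
          by (simp_all add: frag_extend_diff frag_extend_cmul weight_relation weight_diff)
        then show ?thesis using v(2) unfolding Crossing by auto
      next
        case (Point x y)
        then show ?thesis using v point[of x y] by simp
      qed
    qed
    ultimately show "frag_extend weight ` relations S \<subseteq> group_closure {?g}" by blast
    obtain x y where xy: "Point x y \<in> set S" "colour x - colour y = int n + 1 \<or> colour x - colour y = - (int n + 1)"
      using point_finish[of True] last[of True] by force
    let ?G = "group_closure (frag_extend weight ` relations S)"
    have "frag_of x - frag_of y \<in> relations S" using xy(1) by (force simp: relations_def)
    then have "frag_extend weight (frag_of x - frag_of y) \<in> ?G" by (intro group_closure.base) blast
    moreover have "frag_extend weight (frag_of x - frag_of y) = frag_cmul (colour x - colour y) slope"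
      by (simp add: frag_extend_diff weight_diff)
    ultimately have "frag_cmul (colour x - colour y) slope \<in> ?G" by (simp only:)
    then have "?g \<in> ?G \<or> - ?g \<in> ?G" using xy(2) unfolding minus_frag_cmul by (elim disjE) simp_all
    then have "?g \<in> ?G" by (simp only: group_closure_minus_iff simp_thms)
    then show "{?g} \<subseteq> ?G" by blast
  qed
  then have "divides_colouring_minors S = divides_first_minors {x0, y0} {?g}"
    unfolding divides_colouring_minors_def eliminate by (rule divides_first_minors_closure)
  moreover have "divides_first_minors {x0, y0} {?g} d \<longleftrightarrow> d dvd int n + 1"
  proof -
    have card: "card {x0, y0} - 1 = 1" using x0_neq_y0 by simp
    have look: "Poly_Mapping.lookup ?g y0 = int n + 1" "Poly_Mapping.lookup ?g x0 = - (int n + 1)"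
      using x0_neq_y0 by (simp_all add: slope_def lookup_minus)
    have minor: "minor [r] [c] = Poly_Mapping.lookup r c" for r :: "nat \<Rightarrow>\<^sub>0 int" and c
      by (simp add: minor_def det_single)
    show ?thesis
    proof
      assume "divides_first_minors {x0, y0} {?g} d"
      then have "d dvd minor [?g] [y0]"
        unfolding divides_first_minors_def by (rule divides_minorsD) (simp_all add: x0_neq_y0)
      then show "d dvd int n + 1" unfolding minor look .
    next
      assume d: "d dvd int n + 1"
      show "divides_first_minors {x0, y0} {?g} d"
        unfolding divides_first_minors_def
      proof (rule divides_minorsI)
        fix rs :: "(nat \<Rightarrow>\<^sub>0 int) list" and cs
        assume rs: "length rs = card {x0, y0} - 1" "length cs = card {x0, y0} - 1"
          "set rs \<subseteq> {?g}" "set cs \<subseteq> {x0, y0}"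
        obtain r c where rc: "rs = [r]" "cs = [c]" using rs(1,2) unfolding card by (auto simp: length_Suc_conv)
        then have "r = ?g" "c = x0 \<or> c = y0" using rs(3,4) by simp_all
        then have "minor rs cs = int n + 1 \<or> minor rs cs = - (int n + 1)"
          unfolding rc minor using look by (elim disjE) (simp_all only:, simp_all)
        then show "d dvd minor rs cs" using d by (elim disjE) (simp_all only: dvd_minus_iff)
      qed
    qed
  qed
  ultimately show ?thesis by simp
qed

theorem determinant_schubert:
  assumes "side (st False) \<noteq> side (en False) \<or> uc False \<noteq> [] \<or> uc True \<noteq> []"
  shows "int (card (crossings S)) = 2 * int (diagram_determinant S) - 2"
proof -
  let ?n = "length (uc False)"
  have len: "length (uc j) = ?n" for j
    using strands_equal_length[OF assms] by (cases j) simp_all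
  have ends: "\<forall>j. side (st j) \<noteq> side (en j)" if "?n = 0"
  proof -
    have "side (st False) \<noteq> side (en False)" using assms len[of True] that by simp
    then have "side (st j) \<noteq> side (en j)" for j using closed_strands[of False] by (cases j) simp_all
    then show ?thesis by simp
  qed
  have "m dvd diagram_determinant S \<longleftrightarrow> m dvd ?n + 1" for m
  proof -
    have "m dvd diagram_determinant S \<longleftrightarrow> int m dvd int ?n + 1"
      using divides_colouring_minors_schubert[OF len ends, of "int m"]
      unfolding divides_diagram_determinant_iff .
    also have "int ?n + 1 = int (?n + 1)" by simp
    finally show ?thesis unfolding int_dvd_int_iff .
  qed
  then have "diagram_determinant S = ?n + 1" by (metis dvd_antisym dvd_refl)
  moreover have "card (crossings S) = ?n + ?n"
    using distinct_card[OF distinct_uc] len[of True] unfolding set_uc by simp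
  ultimately show ?thesis by simp
qed

end

section \<open>The number of crossings of a Schubert normal form\<close>

context strand_diagram
begin

text \<open>
  Each bridge is then joined to one under-strand by two points, forming a circle.
\<close>

lemma crossingless_closed_strands_trivial:
  assumes "uc False = []" "uc True = []" and closed: "side (st False) = side (en False)"
  shows "same_link S [Point 0 0, Point 1 1]"
proof -
  have none: "crossings S = {}" using set_uc assms(1,2) by simp
  have single: "bc i = []" for i using bc_subset[of i] none by simp
  have be: "be i = [hd (be i)]" for i
    using length_be[of i] single[of i] by (cases "be i") simp_all
  have ue: "ue j = [hd (ue j)]" for j
    using length_ue[of j] assms(1,2) by (cases "ue j"; cases j) simp_all
  have last: "last (ue j) = hd (ue j)" for j
    using arg_cong[OF ue[of j], of last] by (simp only: last.simps if_True refl simp_thms)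
  let ?s = "side (st False)"
  define a c where "a = hd (be ?s)" and "c = hd (be (\<not> ?s))"
  define b d where "b = hd (ue False)" and "d = hd (ue True)"
  have on: "x = hd (be (side x))" if "x \<in> {st j, en j}" for x j
  proof -
    have "x \<in> set (be (side x))" by (rule strand_end_in_bridge[OF that])
    then have "x \<in> set [hd (be (side x))]" using be[of "side x"] by (simp only:)
    then show ?thesis by simp
  qed
  have other: "side (st True) = (\<not> ?s)" "side (en True) = (\<not> ?s)"
    using closed_strands[of False] closed_strands_sides[OF closed] closed
    by (simp_all only: not_False_eq_True simp_thms)
  have ends: "st False = a" "en False = a" "st True = c" "en True = c"
    using on[of "st False" False, OF insertI1] on[of "en False" False, OF insertI2[OF singletonI]]
      on[of "st True" True, OF insertI1] on[of "en True" True, OF insertI2[OF singletonI]]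
    unfolding a_def c_def other closed[symmetric] by (simp_all only:)
  have isp: "\<exists>x y. v = Point x y" if v: "v \<in> set S" for v
  proof (cases v)
    case (Crossing a b c d)
    then obtain i where "i < length S" "S ! i = Crossing a b c d" using v by (auto simp: in_set_conv_nth)
    then have "i \<in> crossings S" by (simp add: crossings_def)
    then show ?thesis using none by simp
  qed simp
  have "points = S" unfolding points_def
  proof (rule filter_True, rule ballI)
    fix v assume "v \<in> set S"
    from isp[OF this] show "case v of Point x y \<Rightarrow> True | Crossing a b c d \<Rightarrow> False" by auto
  qed
  then have "image_mset bridge_end (mset S) = {#(a, b), (a, b), (c, d), (c, d)#}"
    using strand_ends unfolding last ends b_def[symmetric] d_def[symmetric] by simp
  then obtain p q r t where M: "mset S = {#p, q, r, t#}" "bridge_end p = (a, b)" "bridge_end q = (a, b)"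
    "bridge_end r = (c, d)" "bridge_end t = (c, d)" by (rule image_mset_eq_pairD)
  have shape: "v = Point x y \<or> v = Point y x" if "v \<in># mset S" "bridge_end v = (x, y)" for v x y
    using isp[of v] that by (auto simp: bridge_end_def split: if_splits)
  have p: "p = Point a b \<or> p = Point b a" by (rule shape[OF _ M(2)]) (simp add: M(1))
  have q: "q = Point a b \<or> q = Point b a" by (rule shape[OF _ M(3)]) (simp add: M(1))
  have r: "r = Point c d \<or> r = Point d c" by (rule shape[OF _ M(4)]) (simp add: M(1))
  have t: "t = Point c d \<or> t = Point d c" by (rule shape[OF _ M(5)]) (simp add: M(1))
  have mem: "a \<in> set (be ?s)" "c \<in> set (be (\<not> ?s))" "b \<in> set (ue False)" "d \<in> set (ue True)"
    using nonempty unfolding a_def b_def c_def d_def by simp_all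
  have neq: "x \<noteq> y" if "X \<inter> Y = {}" "x \<in> X" "y \<in> Y" for x y :: nat and X Y
    using that by auto
  have ab: "a \<noteq> b" by (rule neq[OF be_ue_disjoint mem(1,3)])
  have ac: "a \<noteq> c" by (rule neq[OF be_disjoint mem(1,2)]) simp
  have ad: "a \<noteq> d" by (rule neq[OF be_ue_disjoint mem(1,4)])
  have cb: "c \<noteq> b" by (rule neq[OF be_ue_disjoint mem(2,3)])
  have bd: "b \<noteq> d" by (rule neq[OF ue_disjoint mem(3,4)]) simp
  have cd: "c \<noteq> d" by (rule neq[OF be_ue_disjoint mem(2,4)])
  note ba = ab[symmetric] and ca = ac[symmetric] and da = ad[symmetric] and bc' = cb[symmetric]
    and db = bd[symmetric] and dc = cd[symmetric]
  have q': "q = Point b a \<or> q = Point a b" using q by (rule disj_commute[THEN iffD1])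
  have t': "t = Point d c \<or> t = Point c d" using t by (rule disj_commute[THEN iffD1])
  from p show ?thesis
  proof
    assume p: "p = Point a b"
    from r show ?thesis
    proof
      assume "r = Point c d"
      then show ?thesis
        using two_circles_trivial[OF ab ac ad bc' bd cd q t link_diagram] M(1) p by (simp only:)
    next
      assume "r = Point d c"
      then show ?thesis
        using two_circles_trivial[OF ab ad ac bd bc' dc q t' link_diagram] M(1) p by (simp only:)
    qed
  next
    assume p: "p = Point b a"
    from r show ?thesis
    proof
      assume "r = Point c d"
      then show ?thesis
        using two_circles_trivial[OF ba bc' bd ac ad cd q' t link_diagram] M(1) p by (simp only:)
    next
      assume "r = Point d c"
      then show ?thesis
        using two_circles_trivial[OF ba bd bc' ad ac dc q' t' link_diagram] M(1) p by (simp only:)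
    qed
  qed
qed

end

lemma link_of_eq:
  assumes "same_link D E"
  shows "link_of D = link_of E"
proof -
  have "same_link E D" using assms unfolding same_link_def by (rule equivclp_sym)
  then show ?thesis unfolding link_of_def using same_link_trans[OF assms] same_link_trans[of E D] by blast
qed

theorem corollary1p3:
  fixes R :: "diagram set" and S :: diagram and D N :: nat
  assumes "nontrivial_rational_link R"
    and "D = link_determinant R"
    and "S \<in> R" and "schubert_normal_form S"
    and "N = card (crossings S)"
  shows "int N = 2 * int D - 2"
proof -
  have R: "is_link R" "R \<noteq> trivial_two_component_link"
    using assms(1) by (simp_all add: nontrivial_rational_link_def rational_link_def)
  obtain D0 where "R = link_of D0" using R(1) by (auto simp: is_link_def)
  then have "same_link D0 S" using assms(3) by (simp add: link_of_def)
  then have link: "R = link_of S" unfolding \<open>R = link_of D0\<close> by (rule link_of_eq)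
  have det: "D = diagram_determinant S"
    unfolding assms(2) by (rule link_determinant_eq[OF R(1) assms(3)])
  have "link_diagram S" using assms(4) unfolding schubert_normal_form_def by (rule conjunct1)
  obtain br us where bridges: "bridge_presentation S br us"
    and "\<forall>j. alternates_from_start S br (us j) \<and>
             alternates_from_start S br (rev (path_edges (us j)), rev (path_crossings (us j)))"
    and "\<forall>i j k. Suc k < length (path_crossings (br i)) \<longrightarrow>
           \<not> {path_crossings (br i) ! k, path_crossings (br i) ! Suc k} \<subseteq> set (path_crossings (us j))"
    using assms(4) unfolding schubert_normal_form_def by (elim conjE exE) (rule that)
  then have alt: "\<And>j. alternates_from_start S br (us j)"
      "\<And>j. alternates_from_start S br (rev (path_edges (us j)), rev (path_crossings (us j)))"
    and inter: "\<And>i j k. Suc k < length (path_crossings (br i)) \<Longrightarrow>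
      \<not> {path_crossings (br i) ! k, path_crossings (br i) ! Suc k} \<subseteq> set (path_crossings (us j))"
    by simp_all
  interpret bridge_diagram S br us by unfold_locales (rule \<open>link_diagram S\<close> bridges)+
  obtain st en where ends: "mset (map bridge_end points) = {#(st False, hd (ue False)), (en False, last (ue False)),
     (st True, hd (ue True)), (en True, last (ue True))#}"
   "{#st False, en False, st True, en True#} = {#hd (be False), last (be False), hd (be True), last (be True)#}"
    using ex_strand_ends by (elim exE conjE)
  interpret strand_diagram S br us st en by unfold_locales (rule ends)+
  have start: "joined_to S (hd (ue j)) (br (side (st j)))" for j
    using point_start[of j] strand_end_in_bridge[of "st j" j] unfolding joined_to_def by blast
  have finish: "joined_to S (last (ue j)) (br (side (en j)))" for j
    using point_finish[of j] strand_end_in_bridge[of "en j" j] unfolding joined_to_def by blast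
  interpret schubert_diagram S br us st en
  proof unfold_locales
    show "uc j ! k \<in> set (bc (if even k then \<not> side (st j) else side (st j)))" if "k < length (uc j)" for j k
      using alt(1)[of j] start[of j] that unfolding alternates_from_start_def by blast
    show "rev (uc j) ! k \<in> set (bc (if even k then \<not> side (en j) else side (en j)))" if "k < length (uc j)" for j k
    proof -
      have "joined_to S (hd (rev (ue j))) (br (side (en j)))" using finish[of j] by (simp only: hd_rev)
      moreover have "k < length (rev (uc j))" using that by simp
      ultimately show ?thesis using alt(2)[of j] unfolding alternates_from_start_def fst_conv snd_conv by blast
    qed
  qed (rule inter)
  have "side (st False) \<noteq> side (en False) \<or> uc False \<noteq> [] \<or> uc True \<noteq> []"
  proof (rule ccontr)
    assume "\<not> (side (st False) \<noteq> side (en False) \<or> uc False \<noteq> [] \<or> uc True \<noteq> [])"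
    then have "same_link S [Point 0 0, Point 1 1]" by (intro crossingless_closed_strands_trivial) simp_all
    then have "R = trivial_two_component_link"
      unfolding link trivial_two_component_link_def by (rule link_of_eq)
    with R(2) show False by simp
  qed
  from determinant_schubert[OF this] show ?thesis unfolding det assms(5) .
qed

end
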